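(* The problem Eulerian Strong Component Arc Deletion restricted to tournaments, parameterized by $k$, is fixed-parameter tractable and has a kernel with at most $4k(4k+2)$ vertices.
   Context: For a digraph $D$, $d^+_D(x)$ and $d^-_D(x)$ denote the out-degree and in-degree of a vertex $x$. $D$ is balanced if $d^+_D(x)=d^-_D(x)$ for every vertex $x$. $D$ is strongly connected if for all vertices $x,y$ there is a directed path from $x$ to $y$ (a single vertex is strongly connected); a strong component is a maximal induced subgraph that is strongly connected. $D$ is Eulerian if and only if it is strongly connected and balanced. For $A'\subseteq A(D)$, $D-A'$ is the digraph obtained by deleting the arcs of $A'$. A set $A'\subseteq A(D)$ is a DESC-set if every strong component of $D-A'$ is Eulerian; $desc(D)$ is the minimum size of a DESC-set of $D$. The problem Eulerian Strong Component Arc Deletion: given a digraph $D$ and a nonnegative integer $k$, decide whether $desc(D)\le k$; here the input digraph is required to be a tournament. A parameterized problem is fixed-parameter tractable if membership of an instance $(I,k)$ can be decided in time $f(k)|I|^{O(1)}$ for some function $f$. A kernelization is a polynomial-time algorithm mapping an instance $(x,k)$ to an instance $(x',k')$ (the kernel) such that $(x,k)$ is a yes-instance iff $(x',k')$ is, $k'\le h(k)$, and $|x'|\le g(k)$ for some functions $h,g$; the kernel here has at most $4k(4k+2)$ vertices.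
   Formalization: The bound of 4k(4k+2) vertices is not required for no-instances with k = 0: there it would force the empty tournament, which is a yes-instance for every parameter, so no equivalent kernel could meet it. *)

theory Defs
  imports "Graph_Theory.Graph_Theory" "HOL-Library.Log_Nat"
begin

section \<open>DESC-sets of digraphs\<close>

definition balanced :: "('a, 'b) pre_digraph \<Rightarrow> bool" where
  "balanced G \<longleftrightarrow> (\<forall>v \<in> verts G. out_degree G v = in_degree G v)"

definition Eulerian :: "('a, 'b) pre_digraph \<Rightarrow> bool" where
  "Eulerian G \<longleftrightarrow> strongly_connected G \<and> balanced G"

definition delete_arcs :: "'a pair_pre_digraph \<Rightarrow> ('a \<times> 'a) set \<Rightarrow> 'a pair_pre_digraph" where
  "delete_arcs D A = D\<lparr>parcs := parcs D - A\<rparr>"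

definition DESC_set :: "'a pair_pre_digraph \<Rightarrow> ('a \<times> 'a) set \<Rightarrow> bool" where
  "DESC_set D A \<longleftrightarrow>
     A \<subseteq> parcs D \<and> (\<forall>C \<in> pre_digraph.sccs (with_proj (delete_arcs D A)). Eulerian C)"

definition desc :: "'a pair_pre_digraph \<Rightarrow> nat" where
  "desc D = (LEAST m. \<exists>A. DESC_set D A \<and> card A = m)"

definition tournament :: "'a pair_pre_digraph \<Rightarrow> bool" where
  "tournament D \<longleftrightarrow> pair_digraph D \<and>
     (\<forall>u \<in> pverts D. \<forall>v \<in> pverts D. u \<noteq> v \<longrightarrow> ((u, v) \<in> parcs D \<longleftrightarrow> (v, u) \<notin> parcs D))"


section \<open>The machine model\<close>

text \<open>
  Running time is measured on a random access machine with unit cost, programmed by structured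
  (while) programs. The memory consists of the natural numbers \<open>s a i\<close>, for a bank
  \<open>a\<close> and an address \<open>i\<close>. Banks are constants in a program, so a program uses only
  finitely many, and \<open>m\<close> banks can be kept in a single memory by putting cell
  \<open>(a, i)\<close> at address \<open>m * i + a\<close>. The only arithmetic is addition and
  truncated subtraction, so a number grows by at most a constant number of bits per step. For this
  reason unit cost is polynomially equivalent to logarithmic cost, and to time on Turing machines.
  An assignment or a test costs one step: the size of its expressions is a constant of the program.
\<close>

type_synonym memory = "nat \<Rightarrow> nat \<Rightarrow> nat"

datatype aexp = Const nat | Cell nat aexp | Plus aexp aexp | Monus aexp aexp

primrec aval :: "aexp \<Rightarrow> memory \<Rightarrow> nat" where
  "aval (Const n) s = n"
| "aval (Cell a e) s = s a (aval e s)"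
| "aval (Plus e f) s = aval e s + aval f s"
| "aval (Monus e f) s = aval e s - aval f s"

text \<open>
  \<open>Assign a e f\<close> writes the value of \<open>f\<close> to the cell of bank \<open>a\<close> whose address
  is the value of \<open>e\<close>. Tests succeed on nonzero values.
\<close>

datatype com =
    Skip
  | Assign nat aexp aexp
  | Seq com com
  | If aexp com com
  | While aexp com

text \<open>\<open>runs c s t s'\<close>: started in \<open>s\<close>, program \<open>c\<close> halts in \<open>s'\<close> after \<open>t\<close> steps.\<close>

inductive runs :: "com \<Rightarrow> memory \<Rightarrow> nat \<Rightarrow> memory \<Rightarrow> bool" where
  Skip: "runs Skip s 1 s"
| Assign: "runs (Assign a e f) s 1 (s(a := (s a)(aval e s := aval f s)))"
| Seq: "runs c s t s' \<Longrightarrow> runs d s' u s'' \<Longrightarrow> runs (Seq c d) s (t + u) s''"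
| IfTrue: "aval e s \<noteq> 0 \<Longrightarrow> runs c s t s' \<Longrightarrow> runs (If e c d) s (t + 1) s'"
| IfFalse: "aval e s = 0 \<Longrightarrow> runs d s t s' \<Longrightarrow> runs (If e c d) s (t + 1) s'"
| WhileFalse: "aval e s = 0 \<Longrightarrow> runs (While e c) s 1 s"
| WhileTrue: "aval e s \<noteq> 0 \<Longrightarrow> runs c s t s' \<Longrightarrow> runs (While e c) s' u s'' \<Longrightarrow>
    runs (While e c) s (t + u + 1) s''"

text \<open>
  Input and output conventions for a bit string \<open>x\<close> with a parameter \<open>k\<close>: bank 0 holds
  the length of \<open>x\<close> and \<open>k\<close>, bank 1 holds the bits of \<open>x\<close>.
\<close>

definition input_memory :: "bool list \<Rightarrow> nat \<Rightarrow> memory" where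
  "input_memory x k = (\<lambda>_ _. 0)
     (0 := (\<lambda>_. 0)(0 := length x, 1 := k),
      1 := (\<lambda>i. if i < length x \<and> x ! i then 1 else 0))"

definition output_memory :: "memory \<Rightarrow> bool list \<times> nat" where
  "output_memory s = (map (\<lambda>i. s 1 i \<noteq> 0) [0..<s 0 0], s 0 1)"


section \<open>Parameterized problems\<close>

text \<open>
  A parameterized problem is given by an encoding of its inputs as bit strings, the set \<open>X\<close> of
  admissible inputs and the set \<open>L\<close> of yes-instances \<open>(x, k)\<close>. The size of
  \<open>(x, k)\<close> counts \<open>k\<close> in binary; the summand 1 makes it positive.
\<close>

definition instance_size :: "('i \<Rightarrow> bool list) \<Rightarrow> 'i \<times> nat \<Rightarrow> nat" where
  "instance_size enc = (\<lambda>(x, k). length (enc x) + floorlog 2 k + 1)"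

definition fixed_parameter_tractable ::
    "('i \<Rightarrow> bool list) \<Rightarrow> 'i set \<Rightarrow> ('i \<times> nat) set \<Rightarrow> bool" where
  "fixed_parameter_tractable enc X L \<longleftrightarrow>
     (\<exists>c f d. \<forall>x \<in> X. \<forall>k. \<exists>t s. runs c (input_memory (enc x) k) t s \<and>
        s 0 0 = (if (x, k) \<in> L then 1 else 0) \<and>
        t \<le> f k * instance_size enc (x, k) ^ d)"

text \<open>
  The length of the output is added to the running time, since the output convention
  would otherwise let a program produce a long string of zeros in one step.
\<close>

definition polynomial_time ::
    "('i \<Rightarrow> bool list) \<Rightarrow> 'i set \<Rightarrow> ('i \<times> nat \<Rightarrow> 'i \<times> nat) \<Rightarrow> bool" where
  "polynomial_time enc X K \<longleftrightarrow>
     (\<exists>c b d. \<forall>x \<in> X. \<forall>k. \<exists>t s. runs c (input_memory (enc x) k) t s \<and>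
        output_memory s = (enc (fst (K (x, k))), snd (K (x, k))) \<and>
        t + length (enc (fst (K (x, k)))) \<le> b * instance_size enc (x, k) ^ d)"

definition kernelization ::
    "('i \<Rightarrow> bool list) \<Rightarrow> 'i set \<Rightarrow> ('i \<times> nat) set \<Rightarrow> ('i \<times> nat \<Rightarrow> 'i \<times> nat) \<Rightarrow> bool" where
  "kernelization enc X L K \<longleftrightarrow>
     polynomial_time enc X K \<and>
     (\<forall>x \<in> X. \<forall>k. fst (K (x, k)) \<in> X \<and> ((x, k) \<in> L \<longleftrightarrow> K (x, k) \<in> L)) \<and>
     (\<exists>h. \<forall>x \<in> X. \<forall>k. snd (K (x, k)) \<le> h k) \<and>
     (\<exists>g. \<forall>x \<in> X. \<forall>k. length (enc (fst (K (x, k)))) \<le> g k)"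


section \<open>Eulerian Strong Component Arc Deletion on tournaments\<close>

text \<open>
  As inputs of algorithms, digraphs have vertices \<open>0, \<dots>, n - 1\<close> and are encoded by the
  rows of their adjacency matrix. The tournament without vertices is included.
  For \<open>k = 0\<close> it is the only kernel that a bound \<open>4 * k * (4 * k + 2)\<close> on the number of vertices
  leaves, and it is a yes-instance for every parameter: no-instances with \<open>k = 0\<close> have to be
  exempt from the bound.
\<close>

definition tournaments :: "nat pair_pre_digraph set" where
  "tournaments = {D. tournament D \<and> (\<exists>n. pverts D = {..<n})}"

definition adjacency_encoding :: "nat pair_pre_digraph \<Rightarrow> bool list" where
  "adjacency_encoding D =
     [(i, j) \<in> parcs D. i \<leftarrow> [0..<card (pverts D)], j \<leftarrow> [0..<card (pverts D)]]"

definition arc_deletion_problem :: "(nat pair_pre_digraph \<times> nat) set" where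
  "arc_deletion_problem = {(D, k). desc D \<le> k}"

end

theory Submission
  imports Defs "HOL-Library.Nat_Bijection"
begin

text \<open>
  A tournament \<open>T\<close> with a DESC-set \<open>A\<close> of at most \<open>k\<close> arcs has at most \<open>2 * k\<close> vertices touched by
  \<open>A\<close>. The out-degree of an untouched vertex is determined by the position of its strong component
  in \<open>T - A\<close>, and an arc from \<open>w\<close> to \<open>u\<close> belongs to \<open>A\<close> if the out-degree of \<open>u\<close> exceeds
  that of \<open>w\<close> by more than \<open>k\<close>. A threshold between out-degrees that only such arcs cross backwards
  cuts \<open>T\<close>: the backward arcs are deleted in every solution, and the pieces become independent.
  A piece much larger than its range of out-degrees is a single component of \<open>T - A\<close>, so
  its cost is the least number of arcs whose deletion balances it, a minimum cost flow. Balanced pieces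
  cost nothing. The remaining pieces form the kernel: the range of out-degrees of a piece is bounded
  by the number of its touched vertices, which gives at most \<open>16 * k * k\<close> vertices altogether.
  Fixed-parameter tractability follows by trying all sets of arcs of the kernel.
\<close>

section \<open>Programs composed of bounded sums and iterated array updates\<close>

text \<open>What makes the reduction possible is that cuts, pieces and the choice of pieces to keep
  depend only on \<open>T\<close> and \<open>k\<close>; the solution \<open>A\<close> and the levels
  occur in the analysis alone. A large piece cannot enter the kernel, whose size must not depend on
  it, so its exact cost has to be subtracted from \<open>k\<close>. Strong connectivity in every
  solution turns the condition there into one on degrees, and nothing is lost by this: in a finite
  balanced relation every arc lies on a cycle. The kernel is not an induced subtournament: arcs
  between its pieces are all directed downwards, for the backward ones are already paid for. Origin
  of the constants: a touched vertex accounts for at most \<open>2 * k\<close> thresholds, and a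
  kept piece has at most twice its range of degrees plus \<open>4 * k\<close> vertices and contains
  a touched one. This makes at most \<open>8 * k\<close> vertices per touched vertex, of which there
  are at most \<open>2 * k\<close>. An input that exceeds the bounds is replaced by a fixed
  no-instance on 4 vertices, which the vertex bound admits for every positive
  \<open>k\<close>.\<close>

definition cap :: "memory \<Rightarrow> nat" where
  "cap m = m 2 0"

text \<open>Programs are specified up to their scratch banks 3, 4 and 5. Bank 2, which carries
  \<open>cap\<close>, is among the banks that must coincide.\<close>

definition agree :: "memory \<Rightarrow> memory \<Rightarrow> bool" where
  "agree s m \<longleftrightarrow> (\<forall>a. a \<notin> {3, 4, 5} \<longrightarrow> s a = m a)"

lemma agree_refl [simp]: "agree s s"
  by (simp add: agree_def)

lemma agree_cap: "agree s m \<Longrightarrow> s 2 0 = cap m"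
  by (simp add: agree_def cap_def)

section \<open>Polynomial bounds and composition of timed runs\<close>

definition poly_bounded :: "(nat \<Rightarrow> nat) \<Rightarrow> bool" where
  "poly_bounded T \<longleftrightarrow> (\<exists>K D. \<forall>L. T L \<le> K * (L + 1) ^ D)"

lemma poly_bounded_const: "poly_bounded (\<lambda>_. c)"
  unfolding poly_bounded_def by (rule exI[of _ c], rule exI[of _ 0]) simp

lemma poly_bounded_id: "poly_bounded (\<lambda>L. L)"
  unfolding poly_bounded_def by (rule exI[of _ 1], rule exI[of _ 1]) simp

lemma poly_bounded_add:
  assumes "poly_bounded S" "poly_bounded T"
  shows "poly_bounded (\<lambda>L. S L + T L)"
proof -
  obtain K D K' D' where S: "\<And>L. S L \<le> K * (L + 1) ^ D" and T: "\<And>L. T L \<le> K' * (L + 1) ^ D'"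
    using assms unfolding poly_bounded_def by metis
  have "S L + T L \<le> (K + K') * (L + 1) ^ (D + D')" for L
  proof -
    have "(L + 1) ^ D \<le> (L + 1) ^ (D + D')" "(L + 1) ^ D' \<le> (L + 1) ^ (D + D')"
      by (intro power_increasing; simp)+
    then have "K * (L + 1) ^ D + K' * (L + 1) ^ D' \<le> K * (L + 1) ^ (D + D') + K' * (L + 1) ^ (D + D')"
      by (intro add_mono mult_le_mono2)
    with S[of L] T[of L] show ?thesis by (simp only: add_mult_distrib)
  qed
  then show ?thesis unfolding poly_bounded_def by blast
qed

lemma poly_bounded_mult:
  assumes "poly_bounded S" "poly_bounded T"
  shows "poly_bounded (\<lambda>L. S L * T L)"
proof -
  obtain K D K' D' where S: "\<And>L. S L \<le> K * (L + 1) ^ D" and T: "\<And>L. T L \<le> K' * (L + 1) ^ D'"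
    using assms unfolding poly_bounded_def by metis
  have "S L * T L \<le> (K * K') * (L + 1) ^ (D + D')" for L
    using mult_le_mono[OF S[of L] T[of L]] by (simp only: power_add ac_simps)
  then show ?thesis unfolding poly_bounded_def by blast
qed

lemmas poly_bounded_intros = poly_bounded_add poly_bounded_mult poly_bounded_const poly_bounded_id

lemma runs_seq:
  assumes "\<exists>t s'. runs c s t s' \<and> t \<le> A \<and> P s'"
    and "\<And>s'. P s' \<Longrightarrow> \<exists>u s''. runs d s' u s'' \<and> u \<le> B \<and> R s''"
  shows "\<exists>t s'. runs (Seq c d) s t s' \<and> t \<le> A + B \<and> R s'"
proof -
  obtain t s' where 1: "runs c s t s'" "t \<le> A" "P s'" using assms(1) by blast
  obtain u s'' where 2: "runs d s' u s''" "u \<le> B" "R s''" using assms(2)[OF 1(3)] by blast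
  show ?thesis using runs.Seq[OF 1(1) 2(1)] 1 2 by (meson add_mono)
qed

lemma runs_assign:
  "R (s(a := (s a)(aval e s := aval f s))) \<Longrightarrow> \<exists>t s'. runs (Assign a e f) s t s' \<and> t \<le> 1 \<and> R s'"
  using runs.Assign by blast

lemma runs_if:
  assumes "aval e s \<noteq> 0 \<Longrightarrow> \<exists>t s'. runs c s t s' \<and> t \<le> A \<and> P s'"
    and "aval e s = 0 \<Longrightarrow> \<exists>t s'. runs d s t s' \<and> t \<le> B \<and> P s'"
  shows "\<exists>t s'. runs (If e c d) s t s' \<and> t \<le> A + B + 1 \<and> P s'"
proof (cases "aval e s = 0")
  case True
  then obtain t s' where "runs d s t s'" "t \<le> B" "P s'" using assms by blast
  with runs.IfFalse[OF True this(1)] show ?thesis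
    by (intro exI[of _ "t + 1"] exI[of _ s']) simp
next
  case False
  then obtain t s' where "runs c s t s'" "t \<le> A" "P s'" using assms by blast
  with runs.IfTrue[OF False this(1)] show ?thesis
    by (intro exI[of _ "t + 1"] exI[of _ s']) simp
qed

text \<open>The invariant carries the iteration number, and the test holds exactly below
  \<open>N\<close>, so the loop runs \<open>N - i\<close> times. One bound \<open>T\<close> for the
  body then yields both termination and the time.\<close>

lemma runs_while_count:
  assumes "I i s" "i \<le> N"
    and test: "\<And>i s. I i s \<Longrightarrow> i \<le> N \<Longrightarrow> aval e s \<noteq> 0 \<longleftrightarrow> i < N"
    and step: "\<And>i s. I i s \<Longrightarrow> i < N \<Longrightarrow> \<exists>t s'. runs c s t s' \<and> t \<le> T \<and> I (Suc i) s'"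
  shows "\<exists>t s'. runs (While e c) s t s' \<and> t \<le> (N - i) * (T + 1) + 1 \<and> I N s'"
  using assms(1,2)
proof (induction "N - i" arbitrary: i s)
  case 0
  then have "i = N" by simp
  with 0 test have "aval e s = 0" by blast
  from runs.WhileFalse[OF this] 0 \<open>i = N\<close> show ?case by (metis le_add2)
next
  case (Suc j)
  then have "i < N" by simp
  with Suc.prems test have e: "aval e s \<noteq> 0" by simp
  obtain t s' where 1: "runs c s t s'" "t \<le> T" "I (Suc i) s'"
    using step[OF Suc.prems(1) \<open>i < N\<close>] by blast
  obtain u s'' where 2: "runs (While e c) s' u s''" "u \<le> (N - Suc i) * (T + 1) + 1" "I N s''"
  proof -
    have "j = N - Suc i" "Suc i \<le> N" using Suc.hyps(2) \<open>i < N\<close> by auto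
    from Suc.hyps(1)[OF this(1) 1(3) this(2)] show ?thesis using that by blast
  qed
  have "N - i = Suc (N - Suc i)" using \<open>i < N\<close> by simp
  then have "t + u + 1 \<le> (N - i) * (T + 1) + 1" using 1(2) 2(2) by simp
  with runs.WhileTrue[OF e 1(1) 2(1)] 2(3) show ?case by blast
qed

text \<open>
  Bank 3 holds the values of the variables, bank 4 is a stack of intermediate results and bank 5 is
  the buffer of \<open>upd\<close>. All sums range below \<open>cap m\<close>; therefore time bounds need no
  information about the computed values.
\<close>

abbreviation result :: "nat \<Rightarrow> nat \<Rightarrow> nat \<Rightarrow> memory \<Rightarrow> memory \<Rightarrow> bool" where
  "result l d v s s' \<equiv> s' 4 d = v \<and> (\<forall>a. a \<noteq> 3 \<and> a \<noteq> 4 \<longrightarrow> s' a = s a) \<and>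
     (\<forall>i<l. s' 3 i = s 3 i) \<and> (\<forall>i<d. s' 4 i = s 4 i)"

text \<open>The code takes the stack depth \<open>d\<close> as an argument, so that subexpressions
  can be evaluated above pending results. \<open>xs\<close> lists the variables as projections of an
  environment \<open>e\<close>; the i-th of them is kept in cell i of bank 3.\<close>

definition evaluates ::
    "(nat \<Rightarrow> com) \<Rightarrow> (nat \<Rightarrow> nat) \<Rightarrow> ('e \<Rightarrow> nat) list \<Rightarrow> (memory \<Rightarrow> 'e \<Rightarrow> nat) \<Rightarrow> bool" where
  "evaluates c T xs f \<longleftrightarrow> (\<forall>d m e s. agree s m \<longrightarrow> (\<forall>i<length xs. s 3 i = (xs ! i) e) \<longrightarrow>
     (\<exists>t s'. runs (c d) s t s' \<and> t \<le> T (cap m) \<and> result (length xs) d (f m e) s s'))"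

text \<open>Expressions are functions of memory and environment instead of syntax. The closure
  lemmas below obtain a program from the shape of the right-hand side of a definition.\<close>

definition computable :: "('e \<Rightarrow> nat) list \<Rightarrow> (memory \<Rightarrow> 'e \<Rightarrow> nat) \<Rightarrow> bool" where
  "computable xs f \<longleftrightarrow> (\<exists>c T. poly_bounded T \<and> evaluates c T xs f)"

lemma computableI:
  assumes "poly_bounded T"
    and "\<And>d m e s. agree s m \<Longrightarrow> \<forall>i<length xs. s 3 i = (xs ! i) e \<Longrightarrow>
       \<exists>t s'. runs (c d) s t s' \<and> t \<le> T (cap m) \<and> result (length xs) d (f m e) s s'"
  shows "computable xs f"
  unfolding computable_def evaluates_def
  by (rule exI[of _ c], rule exI[of _ T], intro conjI assms(1) allI impI) (rule assms(2))

lemma evaluatesD: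
  assumes "evaluates c T xs f" "agree s m" "\<forall>i<length xs. s 3 i = (xs ! i) e"
  shows "\<exists>t s'. runs (c d) s t s' \<and> t \<le> T (cap m) \<and> result (length xs) d (f m e) s s'"
  using assms(1)[unfolded evaluates_def] assms(2,3) by simp

section \<open>Arithmetic, memory access, conditionals and bounded sums\<close>

lemma computable_const: "computable xs (\<lambda>m e. n)"
  by (rule computableI[where c = "\<lambda>d. Assign 4 (Const d) (Const n)" and T = "\<lambda>_. 1"])
    (rule poly_bounded_const, rule runs_assign, simp)

lemma computable_var: "x \<in> set xs \<Longrightarrow> computable xs (\<lambda>m e. x e)"
proof -
  assume "x \<in> set xs"
  then obtain i where i: "i < length xs" "xs ! i = x" by (auto simp: in_set_conv_nth)
  show ?thesis
    by (rule computableI[where c = "\<lambda>d. Assign 4 (Const d) (Cell 3 (Const i))" and T = "\<lambda>_. 1"],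
        rule poly_bounded_const, rule runs_assign) (use i in auto)
qed

lemma computable_binop:
  assumes f: "computable xs f" and g: "computable xs g"
    and F: "\<And>a b s. aval (F a b) s = h (aval a s) (aval b s)"
  shows "computable xs (\<lambda>m e. h (f m e) (g m e))"
proof -
  obtain cf Tf where T: "poly_bounded Tf"
    and cf: "evaluates cf Tf xs f" using f unfolding computable_def by blast
  obtain cg Tg where T': "poly_bounded Tg"
    and cg: "evaluates cg Tg xs g" using g unfolding computable_def by blast
  show ?thesis
  proof (rule computableI[where T = "\<lambda>L. Tf L + (Tg L + 1)" and
        c = "\<lambda>d. Seq (cf d) (Seq (cg (Suc d)) (Assign 4 (Const d) (F (Cell 4 (Const d)) (Cell 4 (Const (Suc d))))))"], goal_cases)
    case 1 show ?case by (intro poly_bounded_intros T T')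
  next
    case (2 d m e s)
    show ?case
    proof (rule runs_seq[OF evaluatesD[OF cf 2]])
      fix s' assume s': "result (length xs) d (f m e) s s'"
      have a: "agree s' m" using s' 2 by (auto simp: agree_def)
      have x: "\<forall>i<length xs. s' 3 i = (xs ! i) e" using s' 2 by auto
      show "\<exists>u s''. runs (Seq (cg (Suc d)) (Assign 4 (Const d) (F (Cell 4 (Const d)) (Cell 4 (Const (Suc d)))))) s' u s'' \<and>
          u \<le> Tg (cap m) + 1 \<and> result (length xs) d (h (f m e) (g m e)) s s''"
        by (rule runs_seq[OF evaluatesD[OF cg a x]])
          (rule runs_assign, use s' F in \<open>auto simp: less_Suc_eq\<close>)
    qed
  qed
qed

lemma computable_add: "computable xs f \<Longrightarrow> computable xs g \<Longrightarrow> computable xs (\<lambda>m e. f m e + g m e)"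
  by (rule computable_binop[where F = Plus and h = "(+)"]) auto

lemma computable_diff: "computable xs f \<Longrightarrow> computable xs g \<Longrightarrow> computable xs (\<lambda>m e. f m e - g m e)"
  by (rule computable_binop[where F = Monus and h = "(-)"]) auto

lemma computable_Suc: "computable xs f \<Longrightarrow> computable xs (\<lambda>m e. Suc (f m e))"
  using computable_add[OF _ computable_const[of xs 1]] by simp

lemma computable_read:
  assumes f: "computable xs f" and a: "a \<notin> {3, 4, 5}"
  shows "computable xs (\<lambda>m e. m a (f m e))"
proof -
  obtain cf Tf where T: "poly_bounded Tf"
    and cf: "evaluates cf Tf xs f" using f unfolding computable_def by blast
  show ?thesis
  proof (rule computableI[where T = "\<lambda>L. Tf L + 1" and
        c = "\<lambda>d. Seq (cf d) (Assign 4 (Const d) (Cell a (Cell 4 (Const d))))"], goal_cases)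
    case 1 show ?case by (intro poly_bounded_intros T)
  next
    case (2 d m e s)
    then have "s a = m a" using a by (auto simp: agree_def)
    then show ?case
      by (intro runs_seq[OF evaluatesD[OF cf 2]], intro runs_assign) (use a in auto)
  qed
qed

definition decidable :: "('e \<Rightarrow> nat) list \<Rightarrow> (memory \<Rightarrow> 'e \<Rightarrow> bool) \<Rightarrow> bool" where
  "decidable xs P \<longleftrightarrow> computable xs (\<lambda>m e. of_bool (P m e))"

lemma computable_if:
  assumes p: "decidable xs P" and f: "computable xs f" and g: "computable xs g"
  shows "computable xs (\<lambda>m e. if P m e then f m e else g m e)"
proof -
  obtain cp Tp where Tp: "poly_bounded Tp"
    and cp: "evaluates cp Tp xs (\<lambda>m e. of_bool (P m e))" using p unfolding decidable_def computable_def by blast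
  obtain cf Tf where T: "poly_bounded Tf"
    and cf: "evaluates cf Tf xs f" using f unfolding computable_def by blast
  obtain cg Tg where T': "poly_bounded Tg"
    and cg: "evaluates cg Tg xs g" using g unfolding computable_def by blast
  show ?thesis
  proof (rule computableI[where T = "\<lambda>L. Tp L + (Tf L + Tg L + 1)" and
        c = "\<lambda>d. Seq (cp d) (If (Cell 4 (Const d)) (cf d) (cg d))"], goal_cases)
    case 1 show ?case by (intro poly_bounded_intros T T' Tp)
  next
    case (2 d m e s)
    show ?case
    proof (rule runs_seq[OF evaluatesD[OF cp 2]])
      fix s' assume s': "result (length xs) d (of_bool (P m e)) s s'"
      have a: "agree s' m" using s' 2 by (auto simp: agree_def)
      have x: "\<forall>i<length xs. s' 3 i = (xs ! i) e" using s' 2 by auto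
      show "\<exists>u s''. runs (If (Cell 4 (Const d)) (cf d) (cg d)) s' u s'' \<and> u \<le> Tf (cap m) + Tg (cap m) + 1 \<and>
          result (length xs) d (if P m e then f m e else g m e) s s''"
        by (rule runs_if) (use s' evaluatesD[OF cf a x, of d] evaluatesD[OF cg a x, of d] in auto)
    qed
  qed
qed

text \<open>The bound variable becomes a new last variable: the environment is paired with the
  index, the old variables read its first component, and cell \<open>length xs\<close> of bank 3 is
  the loop counter. The partial sum stays in stack cell \<open>d\<close> while the summand is
  evaluated above it.\<close>

lemma computable_sum:
  assumes "computable (map (\<lambda>x p. x (fst p)) xs @ [snd]) (\<lambda>m p. g m (fst p) (snd p))"
  shows "computable xs (\<lambda>m e. \<Sum>i<cap m. g m e i)"
proof -
  let ?l = "length xs"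
  let ?ys = "map (\<lambda>x p. x (fst p)) xs @ [snd] :: ('a \<times> nat \<Rightarrow> nat) list"
  obtain cg Tg where T: "poly_bounded Tg"
    and cg: "evaluates cg Tg ?ys (\<lambda>m p. g m (fst p) (snd p))" using assms unfolding computable_def by blast
  let ?body = "\<lambda>d. Seq (cg (Suc d)) (Seq (Assign 4 (Const d) (Plus (Cell 4 (Const d)) (Cell 4 (Const (Suc d)))))
     (Assign 3 (Const ?l) (Plus (Cell 3 (Const ?l)) (Const 1))))"
  let ?test = "Monus (Cell 2 (Const 0)) (Cell 3 (Const ?l))"
  show ?thesis
  proof (rule computableI[where T = "\<lambda>L. 1 + (1 + (L * (Tg L + (1 + 1) + 1) + 1))" and
        c = "\<lambda>d. Seq (Assign 4 (Const d) (Const 0)) (Seq (Assign 3 (Const ?l) (Const 0)) (While ?test (?body d)))"], goal_cases)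
    case 1 show ?case by (intro poly_bounded_intros T)
  next
    case (2 d m e s)
    define I where "I i s' \<longleftrightarrow> s' 3 ?l = i \<and> result (length xs) d (\<Sum>j<i. g m e j) s s'" for i s'
    have L: "s 2 0 = cap m" using 2 agree_cap by blast
    have w: "\<exists>t s''. runs (While ?test (?body d)) s' t s'' \<and> t \<le> cap m * (Tg (cap m) + (1 + 1) + 1) + 1 \<and> I (cap m) s''"
      if "I 0 s'" for s'
    proof -
      have "\<exists>t s''. runs (While ?test (?body d)) s' t s'' \<and> t \<le> (cap m - 0) * (Tg (cap m) + (1 + 1) + 1) + 1 \<and> I (cap m) s''"
      proof (rule runs_while_count[where I = I, OF that])
        fix i s' assume I: "I i s'" "i < cap m"
        have a: "agree s' m" using I 2 by (auto simp: agree_def I_def)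
        have x: "\<forall>j<length ?ys. s' 3 j = (?ys ! j) (e, i)"
          using I 2 by (auto simp: I_def nth_append less_Suc_eq)
        show "\<exists>t s''. runs (?body d) s' t s'' \<and> t \<le> Tg (cap m) + (1 + 1) \<and> I (Suc i) s''"
        proof (rule runs_seq[OF evaluatesD[OF cg a x]])
          fix s1
          assume s1: "result (length ?ys) (Suc d) (g m (fst (e, i)) (snd (e, i))) s' s1"
          show "\<exists>t s''. runs (Seq (Assign 4 (Const d) (Plus (Cell 4 (Const d)) (Cell 4 (Const (Suc d)))))
             (Assign 3 (Const ?l) (Plus (Cell 3 (Const ?l)) (Const 1)))) s1 t s'' \<and> t \<le> 1 + 1 \<and> I (Suc i) s''"
          proof (rule runs_seq, rule runs_assign, rule refl, rule runs_assign)
            fix s2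
            assume "s2 = s1(4 := (s1 4)(aval (Const d) s1 := aval (Plus (Cell 4 (Const d)) (Cell 4 (Const (Suc d)))) s1))"
            then show "I (Suc i) (s2(3 := (s2 3)(aval (Const ?l) s2 := aval (Plus (Cell 3 (Const ?l)) (Const 1)) s2)))"
              using I(1) s1 by (simp add: I_def)
          qed
        qed
      qed (auto simp: I_def L)
      then show ?thesis by simp
    qed
    have R: "\<exists>t s''. runs (While ?test (?body d)) s' t s'' \<and> t \<le> cap m * (Tg (cap m) + (1 + 1) + 1) + 1 \<and>
        result (length xs) d (\<Sum>j<cap m. g m e j) s s''" if "I 0 s'" for s'
      using w[OF that] unfolding I_def by blast
    show ?case
    proof (rule runs_seq, rule runs_assign, rule refl, rule runs_seq, rule runs_assign, rule refl)
      fix s1 s2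
      assume "s1 = s(4 := (s 4)(aval (Const d) s := aval (Const 0) s))"
        "s2 = s1(3 := (s1 3)(aval (Const ?l) s1 := aval (Const 0) s1))"
      then have "I 0 s2" by (simp add: I_def)
      then show "\<exists>t s''. runs (While ?test (?body d)) s2 t s'' \<and> t \<le> cap m * (Tg (cap m) + (1 + 1) + 1) + 1 \<and>
        result (length xs) d (\<Sum>j<cap m. g m e j) s s''" by (rule R)
    qed
  qed
qed


section \<open>Conditions as truncated arithmetic on 0 and 1\<close>

lemma decidable_less: "computable xs f \<Longrightarrow> computable xs g \<Longrightarrow> decidable xs (\<lambda>m e. f m e < g m e)"
proof -
  assume *: "computable xs f" "computable xs g"
  \<comment> \<open>Truncated subtraction from 1, applied twice, maps every positive difference to 1
    and 0 to 0.\<close>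
  have "(\<lambda>m e. of_bool (f m e < g m e) :: nat) = (\<lambda>m e. 1 - (1 - (g m e - f m e)))"
    by (auto simp: fun_eq_iff)
  then show ?thesis unfolding decidable_def
    by (simp only:) (intro computable_diff computable_const *)
qed

lemma decidable_not: "decidable xs P \<Longrightarrow> decidable xs (\<lambda>m e. \<not> P m e)"
proof -
  assume *: "decidable xs P"
  have "(\<lambda>m e. of_bool (\<not> P m e) :: nat) = (\<lambda>m e. 1 - of_bool (P m e))"
    by (auto simp: fun_eq_iff)
  then show ?thesis using * unfolding decidable_def
    by (simp only:) (intro computable_diff computable_const)
qed

lemma decidable_conj: "decidable xs P \<Longrightarrow> decidable xs Q \<Longrightarrow> decidable xs (\<lambda>m e. P m e \<and> Q m e)"
proof -
  assume *: "decidable xs P" "decidable xs Q"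
  have "(\<lambda>m e. of_bool (P m e \<and> Q m e) :: nat) = (\<lambda>m e. (of_bool (P m e) + of_bool (Q m e)) - 1)"
    by (auto simp: fun_eq_iff)
  then show ?thesis using * unfolding decidable_def
    by (simp only:) (intro computable_diff computable_add computable_const)
qed

lemma decidable_disj: "decidable xs P \<Longrightarrow> decidable xs Q \<Longrightarrow> decidable xs (\<lambda>m e. P m e \<or> Q m e)"
  using decidable_not[OF decidable_conj[OF decidable_not decidable_not]] by simp

lemma decidable_imp: "decidable xs P \<Longrightarrow> decidable xs Q \<Longrightarrow> decidable xs (\<lambda>m e. P m e \<longrightarrow> Q m e)"
  using decidable_not[OF decidable_conj[OF _ decidable_not]] by simp

lemma decidable_le: "computable xs f \<Longrightarrow> computable xs g \<Longrightarrow> decidable xs (\<lambda>m e. f m e \<le> g m e)"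
  using decidable_not[OF decidable_less] by (simp add: not_less)

lemma decidable_eq: "computable xs f \<Longrightarrow> computable xs g \<Longrightarrow> decidable xs (\<lambda>m e. f m e = g m e)"
  using decidable_conj[OF decidable_le decidable_le] by (simp add: eq_iff)

lemma computable_of_bool: "decidable xs P \<Longrightarrow> computable xs (\<lambda>m e. of_bool (P m e))"
  by (simp add: decidable_def)

lemma decidable_ex:
  assumes "decidable (map (\<lambda>x p. x (fst p)) xs @ [snd]) (\<lambda>m p. P m (fst p) (snd p))"
  shows "decidable xs (\<lambda>m e. \<exists>i<cap m. P m e i)"
proof -
  have "(\<lambda>m e. of_bool (\<exists>i<cap m. P m e i) :: nat) = (\<lambda>m e. of_bool (0 < (\<Sum>i<cap m. of_bool (P m e i) :: nat)))"
    by (intro ext arg_cong[where f = of_bool]) (auto simp: zero_less_iff_neq_zero)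
  then show ?thesis unfolding decidable_def
    using decidable_less[OF computable_const computable_sum, OF assms[unfolded decidable_def], of 0]
    by (simp only: decidable_def)
qed

lemma decidable_all:
  assumes "decidable (map (\<lambda>x p. x (fst p)) xs @ [snd]) (\<lambda>m p. P m (fst p) (snd p))"
  shows "decidable xs (\<lambda>m e. \<forall>i<cap m. P m e i)"
  using decidable_not[OF decidable_ex[OF decidable_not[OF assms]]] by simp

lemma computable_cap: "computable xs (\<lambda>m e. cap m)"
  unfolding cap_def by (rule computable_read[OF computable_const]) simp

text \<open>This product is the address arithmetic of matrices. The value of \<open>f\<close> is
  saved in cell \<open>d + 1\<close>, cell \<open>d + 2\<close> counts, and cell \<open>d\<close>
  accumulates, so \<open>f\<close> is evaluated only once.\<close>

lemma computable_times_cap: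
  assumes f: "computable xs f"
  shows "computable xs (\<lambda>m e. f m e * cap m)"
proof -
  obtain cf Tf where T: "poly_bounded Tf"
    and cf: "evaluates cf Tf xs f" using f unfolding computable_def by blast
  let ?cell = "\<lambda>i. Cell 4 (Const i)"
  let ?test = "\<lambda>d. Monus (Cell 2 (Const 0)) (?cell (d + 2))"
  let ?body = "\<lambda>d. Seq (Assign 4 (Const d) (Plus (?cell d) (?cell (d + 1))))
     (Assign 4 (Const (d + 2)) (Plus (?cell (d + 2)) (Const 1)))"
  show ?thesis
  proof (rule computableI[where T = "\<lambda>L. Tf L + (1 + (1 + (1 + (L * (1 + 1 + 1) + 1))))" and
        c = "\<lambda>d. Seq (cf d) (Seq (Assign 4 (Const (d + 1)) (?cell d))
          (Seq (Assign 4 (Const d) (Const 0)) (Seq (Assign 4 (Const (d + 2)) (Const 0))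
            (While (?test d) (?body d)))))"], goal_cases)
    case 1 show ?case by (intro poly_bounded_intros T)
  next
    case (2 d m e s)
    define I where "I i s' \<longleftrightarrow> s' 4 (d + 2) = i \<and> s' 4 (d + 1) = f m e \<and> result (length xs) d (f m e * i) s s'" for i s'
    have L: "s 2 0 = cap m" using 2 agree_cap by blast
    have "\<exists>t s''. runs (While (?test d) (?body d)) s' t s'' \<and>
        t \<le> (cap m - 0) * (1 + 1 + 1) + 1 \<and> I (cap m) s''" if "I 0 s'" for s'
    proof (rule runs_while_count[where I = I, OF that])
      fix i s' assume I: "I i s'" "i < cap m"
      show "\<exists>t s''. runs (?body d) s' t s'' \<and> t \<le> 1 + 1 \<and> I (Suc i) s''"
      proof (rule runs_seq, rule runs_assign, rule refl, rule runs_assign)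
        fix s2
        assume "s2 = s'(4 := (s' 4)(aval (Const d) s' := aval (Plus (?cell d) (?cell (d + 1))) s'))"
        then show "I (Suc i) (s2(4 := (s2 4)(aval (Const (d + 2)) s2 := aval (Plus (?cell (d + 2)) (Const 1)) s2)))"
          using I(1) by (simp add: I_def)
      qed
    qed (auto simp: I_def L)
    then have w: "\<exists>t s''. runs (While (?test d) (?body d)) s' t s'' \<and> t \<le> cap m * (1 + 1 + 1) + 1 \<and>
        result (length xs) d (f m e * cap m) s s''" if "I 0 s'" for s'
      using that unfolding I_def minus_nat.diff_0 by blast
    show ?case
    proof (rule runs_seq[OF evaluatesD[OF cf 2]], rule runs_seq, rule runs_assign, rule refl,
        rule runs_seq, rule runs_assign, rule refl, rule runs_seq, rule runs_assign, rule refl, rule w)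
      fix s0 s1 s2 s3
      assume "result (length xs) d (f m e) s s0"
        "s1 = s0(4 := (s0 4)(aval (Const (d + 1)) s0 := aval (?cell d) s0))"
        "s2 = s1(4 := (s1 4)(aval (Const d) s1 := aval (Const 0) s1))"
        "s3 = s2(4 := (s2 4)(aval (Const (d + 2)) s2 := aval (Const 0) s2))"
      then show "I 0 s3" by (simp add: I_def)
    qed
  qed
qed

text \<open>Row-major layout with rows of length \<open>cap m\<close>. The addresses of row 0 do not
  depend on \<open>cap m\<close>, so vectors kept there survive a change of the capacity.\<close>

definition mat :: "memory \<Rightarrow> nat \<Rightarrow> nat \<Rightarrow> nat \<Rightarrow> nat" where
  "mat m a i j = m a (i * cap m + j)"

lemma computable_mat:
  assumes "computable xs f" "computable xs g" "a \<notin> {3, 4, 5}"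
  shows "computable xs (\<lambda>m e. mat m a (f m e) (g m e))"
proof -
  have "computable xs (\<lambda>m e. m a (f m e * cap m + g m e))"
    by (intro computable_read computable_add computable_times_cap assms)
  then show ?thesis by (simp add: mat_def)
qed


section \<open>Commands as transformations of the memory\<close>

abbreviation executes ::
    "(nat \<Rightarrow> com) \<Rightarrow> (nat \<Rightarrow> nat) \<Rightarrow> (memory \<Rightarrow> memory) \<Rightarrow> nat \<Rightarrow> memory \<Rightarrow> memory \<Rightarrow> bool" where
  "executes c T F d m s \<equiv> \<exists>t s'. runs (c d) s t s' \<and> t \<le> T (cap m) \<and> agree s' (F m) \<and>
     cap (F m) = cap m \<and> (\<forall>i<d. s' 4 i = s 4 i)"

text \<open>Preservation of \<open>cap\<close> lets one bound \<open>T (cap m)\<close> serve all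
  rounds of an iteration. The stack below \<open>d\<close> is preserved because it holds the
  counters of enclosing loops.\<close>

definition cmd :: "(memory \<Rightarrow> memory) \<Rightarrow> bool" where
  "cmd F \<longleftrightarrow> (\<exists>c T. poly_bounded T \<and> (\<forall>d m s. agree s m \<longrightarrow>
     (executes c T F d m s)))"

lemma cmdI:
  assumes "poly_bounded T"
    and "\<And>d m s. agree s m \<Longrightarrow>
       executes c T F d m s"
  shows "cmd F"
  unfolding cmd_def by (rule exI[of _ c], rule exI[of _ T], intro conjI assms(1) allI impI) (rule assms(2))

lemma cmd_comp:
  assumes "cmd F" "cmd G"
  shows "cmd (\<lambda>m. G (F m))"
proof -
  obtain c T where T: "poly_bounded T" and c: "\<And>d m s. agree s m \<Longrightarrow>
     executes c T F d m s"
    using assms(1) unfolding cmd_def by auto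
  obtain c' T' where T': "poly_bounded T'" and c': "\<And>d m s. agree s m \<Longrightarrow>
     executes c' T' G d m s"
    using assms(2) unfolding cmd_def by auto
  show ?thesis
  proof (rule cmdI[where c = "\<lambda>d. Seq (c d) (c' d)" and T = "\<lambda>L. T L + T' L"], goal_cases)
    case 1 show ?case by (intro poly_bounded_intros T T')
  next
    case (2 d m s)
    show ?case
    proof (rule runs_seq[OF c[OF 2]], elim conjE)
      fix s' assume s': "agree s' (F m)" "cap (F m) = cap m" "\<forall>i<d. s' 4 i = s 4 i"
      show "\<exists>u s''. runs (c' d) s' u s'' \<and> u \<le> T' (cap m) \<and> agree s'' (G (F m)) \<and> cap (G (F m)) = cap m \<and>
          (\<forall>i<d. s'' 4 i = s 4 i)"
        using c'[OF s'(1), of d] s' by simp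
    qed
  qed
qed

lemma cmd_if:
  assumes "decidable [] P" "cmd F" "cmd G"
  shows "cmd (\<lambda>m. if P m () then F m else G m)"
proof -
  obtain c T where T: "poly_bounded T" and c: "\<And>d m s. agree s m \<Longrightarrow>
     executes c T F d m s"
    using assms(2) unfolding cmd_def by auto
  obtain c' T' where T': "poly_bounded T'" and c': "\<And>d m s. agree s m \<Longrightarrow>
     executes c' T' G d m s"
    using assms(3) unfolding cmd_def by auto
  obtain cp Tp where Tp: "poly_bounded Tp"
    and cp: "evaluates cp Tp [] (\<lambda>m e. of_bool (P m e))" using assms(1) unfolding decidable_def computable_def by blast
  show ?thesis
  proof (rule cmdI[where c = "\<lambda>d. Seq (cp d) (If (Cell 4 (Const d)) (c d) (c' d))"
        and T = "\<lambda>L. Tp L + (T L + T' L + 1)"], goal_cases)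
    case 1 show ?case by (intro poly_bounded_intros T T' Tp)
  next
    case (2 d m s)
    show ?case
    proof (rule runs_seq[OF evaluatesD[OF cp 2, of "()"]], simp, elim conjE)
      fix s' assume s': "s' 4 d = of_bool (P m ())" "\<forall>a. a \<noteq> 3 \<and> a \<noteq> 4 \<longrightarrow> s' a = s a" "\<forall>i<d. s' 4 i = s 4 i"
      then have a: "agree s' m" using 2 by (auto simp: agree_def)
      show "\<exists>u s''. runs (If (Cell 4 (Const d)) (c d) (c' d)) s' u s'' \<and> u \<le> T (cap m) + T' (cap m) + 1 \<and>
          agree s'' (if P m () then F m else G m) \<and> cap (if P m () then F m else G m) = cap m \<and>
          (\<forall>i<d. s'' 4 i = s 4 i)"
        by (rule runs_if) (use c[OF a, of d] c'[OF a, of d] s' in auto)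
    qed
  qed
qed

text \<open>The number of rounds is always \<open>cap m\<close>. An iteration that reaches its goal
  earlier has to be designed so that further rounds do no harm.\<close>

lemma cmd_repeat:
  assumes "cmd F"
  shows "cmd (\<lambda>m. (F ^^ cap m) m)"
proof -
  obtain c T where T: "poly_bounded T" and c: "\<And>d m s. agree s m \<Longrightarrow>
     executes c T F d m s"
    using assms unfolding cmd_def by auto
  let ?test = "\<lambda>d. Monus (Cell 2 (Const 0)) (Cell 4 (Const d))"
  let ?body = "\<lambda>d. Seq (c (Suc d)) (Assign 4 (Const d) (Plus (Cell 4 (Const d)) (Const 1)))"
  show ?thesis
  proof (rule cmdI[where c = "\<lambda>d. Seq (Assign 4 (Const d) (Const 0)) (While (?test d) (?body d))"
        and T = "\<lambda>L. 1 + (L * (T L + 1 + 1) + 1)"], goal_cases)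
    case 1 show ?case by (intro poly_bounded_intros T)
  next
    case (2 d m s)
    define I where "I i s' \<longleftrightarrow> s' 4 d = i \<and> agree s' ((F ^^ i) m) \<and> cap ((F ^^ i) m) = cap m \<and>
      (\<forall>i<d. s' 4 i = s 4 i)" for i s'
    have "\<exists>t s''. runs (While (?test d) (?body d)) s' t s'' \<and>
        t \<le> (cap m - 0) * (T (cap m) + 1 + 1) + 1 \<and> I (cap m) s''" if "I 0 s'" for s'
    proof (rule runs_while_count[where I = I, OF that])
      fix i s' assume I: "I i s'" "i < cap m"
      then have a: "agree s' ((F ^^ i) m)" and capi: "cap ((F ^^ i) m) = cap m" by (auto simp: I_def)
      show "\<exists>t s''. runs (?body d) s' t s'' \<and> t \<le> T (cap m) + 1 \<and> I (Suc i) s''"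
      proof (rule runs_seq[OF c[OF a, unfolded capi]], elim conjE)
        fix s1 assume s1: "agree s1 (F ((F ^^ i) m))" "cap (F ((F ^^ i) m)) = cap m"
          "\<forall>k<Suc d. s1 4 k = s' 4 k"
        show "\<exists>t s''. runs (Assign 4 (Const d) (Plus (Cell 4 (Const d)) (Const 1))) s1 t s'' \<and> t \<le> 1 \<and> I (Suc i) s''"
          by (rule runs_assign) (use s1 I(1) in \<open>auto simp: I_def agree_def\<close>)
      qed
    next
      fix i s' assume I: "I i s'"
      then show "aval (?test d) s' \<noteq> 0 \<longleftrightarrow> i < cap m"
        using agree_cap[of s'] by (auto simp: I_def)
    qed simp
    then have w: "\<exists>t s''. runs (While (?test d) (?body d)) s' t s'' \<and> t \<le> cap m * (T (cap m) + 1 + 1) + 1 \<and>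
        agree s'' ((F ^^ cap m) m) \<and> cap ((F ^^ cap m) m) = cap m \<and> (\<forall>i<d. s'' 4 i = s 4 i)" if "I 0 s'" for s'
      using that unfolding I_def minus_nat.diff_0 by blast
    show ?case
    proof (rule runs_seq, rule runs_assign, rule refl, rule w)
      fix s0 assume "s0 = s(4 := (s 4)(aval (Const d) s := aval (Const 0) s))"
      then show "I 0 s0" using 2 by (simp add: I_def agree_def)
    qed
  qed
qed

text \<open>All entries are computed from the old memory, which is why a buffer is required. A
  function that reads the bank it writes, such as \<open>g_age\<close>, thereby performs one
  synchronous round.\<close>

definition upd :: "nat \<Rightarrow> (memory \<Rightarrow> nat \<Rightarrow> nat \<Rightarrow> nat) \<Rightarrow> memory \<Rightarrow> memory" where
  "upd a g m = m(a := (\<lambda>x. if x < cap m * cap m then g m (x div cap m) (x mod cap m) else m a x))"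

lemma cap_upd [simp]: "a \<noteq> 2 \<Longrightarrow> cap (upd a g m) = cap m"
  by (simp add: cap_def upd_def)

lemma matrix_index_less: "i < L \<Longrightarrow> j < L \<Longrightarrow> i * L + j < L * (L :: nat)"
proof -
  assume "i < L" "j < L"
  then have "i * L + j < (i + 1) * L" by simp
  also have "\<dots> \<le> L * L" using \<open>i < L\<close> by (intro mult_le_mono1) simp
  finally show ?thesis .
qed

lemma mat_upd:
  "a \<noteq> 2 \<Longrightarrow> i < cap m \<Longrightarrow> j < cap m \<Longrightarrow> mat (upd a g m) b i j = (if b = a then g m i j else mat m b i j)"
  by (auto simp: mat_def upd_def cap_upd[unfolded upd_def] matrix_index_less)

lemma upd_other: "b \<noteq> a \<Longrightarrow> upd a g m b = m b"
  by (simp add: upd_def)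

text \<open>Row and column are counted in variables 0 and 1 while stack cell \<open>d\<close> runs
  through the linear index, so neither multiplication nor division occurs. The copying loop counts
  the same cell down, which serves as its test.\<close>

lemma cmd_upd:
  assumes g: "computable [fst, snd] (\<lambda>m e. g m (fst e) (snd e))" and a: "a \<notin> {2, 3, 4, 5}"
  shows "cmd (upd a g)"
proof -
  obtain cg Tg where T: "poly_bounded Tg"
    and cg: "evaluates cg Tg [fst, snd] (\<lambda>m e. g m (fst e) (snd e))"
    using g unfolding computable_def by blast
  let ?inc = "\<lambda>b i. Assign b (Const i) (Plus (Cell b (Const i)) (Const 1))"
  let ?c4 = "\<lambda>d. Cell 4 (Const d)"
  let ?test = "\<lambda>v. Monus (Cell 2 (Const 0)) (Cell 3 (Const v))"
  let ?body = "\<lambda>d. Seq (cg (Suc d)) (Seq (Assign 5 (?c4 d) (?c4 (Suc d))) (Seq (?inc 4 d) (?inc 3 1)))"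
  let ?row = "\<lambda>d. Seq (Assign 3 (Const 1) (Const 0)) (Seq (While (?test 1) (?body d)) (?inc 3 0))"
  let ?copy = "\<lambda>d. Seq (Assign 4 (Const d) (Monus (?c4 d) (Const 1))) (Assign a (?c4 d) (Cell 5 (?c4 d)))"
  let ?R = "\<lambda>L. 1 + (L * (Tg L + (1 + (1 + 1)) + 1) + 1 + 1)"
  show ?thesis
  proof (rule cmdI[where c = "\<lambda>d. Seq (Assign 4 (Const d) (Const 0)) (Seq (Assign 3 (Const 0) (Const 0))
          (Seq (While (?test 0) (?row d)) (While (?c4 d) (?copy d))))"
        and T = "\<lambda>L. 1 + (1 + (L * (?R L + 1) + 1 + (L * L * (1 + 1 + 1) + 1)))"], goal_cases)
    case 1 show ?case by (intro poly_bounded_intros T)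
  next
    case (2 d m s)
    let ?L = "cap m"
    let ?G = "\<lambda>x. g m (x div ?L) (x mod ?L)"
    have L: "s 2 0 = ?L" using 2 agree_cap by blast
    define J where "J i j s' \<longleftrightarrow> s' 3 0 = i \<and> s' 3 1 = j \<and> s' 4 d = i * ?L + j \<and>
       (\<forall>x<i * ?L + j. s' 5 x = ?G x) \<and> (\<forall>b. b \<notin> {3, 4, 5} \<longrightarrow> s' b = s b) \<and>
       (\<forall>i<d. s' 4 i = s 4 i)" for i j s'
    define I where "I i s' \<longleftrightarrow> s' 3 0 = i \<and> s' 4 d = i * ?L \<and>
       (\<forall>x<i * ?L. s' 5 x = ?G x) \<and> (\<forall>b. b \<notin> {3, 4, 5} \<longrightarrow> s' b = s b) \<and>
       (\<forall>i<d. s' 4 i = s 4 i)" for i s'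
    \<comment> \<open>After \<open>k\<close> copies exactly the last \<open>k\<close> entries below
      \<open>?L * ?L\<close> have their new values, since copying proceeds from the top.\<close>
    define K where "K k s' \<longleftrightarrow> k \<le> ?L * ?L \<and> s' 4 d = ?L * ?L - k \<and>
       (\<forall>x<?L * ?L. s' 5 x = ?G x) \<and>
       (\<forall>x. s' a x = (if ?L * ?L - k \<le> x \<and> x < ?L * ?L then ?G x else s a x)) \<and>
       (\<forall>b. b \<notin> {3, 4, 5, a} \<longrightarrow> s' b = s b) \<and> (\<forall>i<d. s' 4 i = s 4 i)" for k s'
    have inner: "\<exists>t s''. runs (While (?test 1) (?body d)) s' t s'' \<and>
        t \<le> (?L - 0) * (Tg ?L + (1 + (1 + 1)) + 1) + 1 \<and> J i ?L s''" if "J i 0 s'" for i s'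
    proof (rule runs_while_count[where I = "J i", OF that])
      fix j s' assume J: "J i j s'" "j < ?L"
      have ag: "agree s' m" using J(1) 2 by (auto simp: J_def agree_def)
      have x: "\<forall>k<length [fst, snd]. s' 3 k = ([fst, snd] ! k) (i, j)"
        using J(1) by (auto simp: J_def less_Suc_eq)
      show "\<exists>t s''. runs (?body d) s' t s'' \<and> t \<le> Tg ?L + (1 + (1 + 1)) \<and> J i (Suc j) s''"
      proof (rule runs_seq[OF evaluatesD[OF cg ag x]], rule runs_seq, rule runs_assign, rule refl,
          rule runs_seq, rule runs_assign, rule refl, rule runs_assign, elim conjE)
        fix s1 s2 s3
        assume s1: "s1 4 (Suc d) = g m (fst (i, j)) (snd (i, j))" "\<forall>a. a \<noteq> 3 \<and> a \<noteq> 4 \<longrightarrow> s1 a = s' a"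
          "\<forall>k<length [fst, snd]. s1 3 k = s' 3 k" "\<forall>k<Suc d. s1 4 k = s' 4 k"
          and s2: "s2 = s1(5 := (s1 5)(aval (?c4 d) s1 := aval (?c4 (Suc d)) s1))"
          and s3: "s3 = s2(4 := (s2 4)(aval (Const d) s2 := aval (Plus (?c4 d) (Const 1)) s2))"
        have eq: "(i * ?L + j) div ?L = i" "(i * ?L + j) mod ?L = j" using J(2) by auto
        show "J i (Suc j) (s3(3 := (s3 3)(aval (Const 1) s3 := aval (Plus (Cell 3 (Const 1)) (Const 1)) s3)))"
          using J(1) s1 eq unfolding s3 s2 by (auto simp: J_def less_Suc_eq)
      qed
    qed (auto simp: J_def L)
    have outer: "\<exists>t s''. runs (While (?test 0) (?row d)) s' t s'' \<and>
        t \<le> (?L - 0) * (?R ?L + 1) + 1 \<and> I ?L s''" if "I 0 s'" for s'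
    proof (rule runs_while_count[where I = I, OF that])
      fix i s' assume I: "I i s'" "i < ?L"
      show "\<exists>t s''. runs (?row d) s' t s'' \<and> t \<le> ?R ?L \<and> I (Suc i) s''"
      proof (rule runs_seq, rule runs_assign, rule refl, rule runs_seq[where P = "J i ?L"])
        fix s1 assume "s1 = s'(3 := (s' 3)(aval (Const 1) s' := aval (Const 0) s'))"
        then have "J i 0 s1" using I(1) by (simp add: I_def J_def)
        from inner[OF this] show "\<exists>t s''. runs (While (?test 1) (?body d)) s1 t s'' \<and>
            t \<le> ?L * (Tg ?L + (1 + (1 + 1)) + 1) + 1 \<and> J i ?L s''" by simp
      next
        fix s2 assume "J i ?L s2"
        then show "\<exists>u s''. runs (?inc 3 0) s2 u s'' \<and> u \<le> 1 \<and> I (Suc i) s''"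
          by (intro runs_assign) (auto simp: I_def J_def add.commute)
      qed
    qed (auto simp: I_def L)
    have copy: "\<exists>t s''. runs (While (?c4 d) (?copy d)) s' t s'' \<and>
        t \<le> (?L * ?L - 0) * (1 + 1 + 1) + 1 \<and> K (?L * ?L) s''" if "K 0 s'" for s'
    proof (rule runs_while_count[where I = K, OF that])
      fix k s' assume K: "K k s'" "k < ?L * ?L"
      show "\<exists>t s''. runs (?copy d) s' t s'' \<and> t \<le> 1 + 1 \<and> K (Suc k) s''"
      proof (rule runs_seq, rule runs_assign, rule refl, rule runs_assign)
        fix s1 assume s1: "s1 = s'(4 := (s' 4)(aval (Const d) s' := aval (Monus (?c4 d) (Const 1)) s'))"
        have *: "?L * ?L - Suc k \<le> x \<and> x < ?L * ?L \<longleftrightarrow> x = ?L * ?L - Suc k \<or> ?L * ?L - k \<le> x \<and> x < ?L * ?L" for x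
          using K(2) by auto
        show "K (Suc k) (s1(a := (s1 a)(aval (?c4 d) s1 := aval (Cell 5 (?c4 d)) s1)))"
          using K a unfolding K_def * s1 by auto
      qed
    qed (auto simp: K_def)
    show ?case
    proof (rule runs_seq, rule runs_assign, rule refl, rule runs_seq, rule runs_assign, rule refl,
        rule runs_seq[where P = "I ?L"])
      fix s1 s2 assume "s1 = s(4 := (s 4)(aval (Const d) s := aval (Const 0) s))"
        "s2 = s1(3 := (s1 3)(aval (Const 0) s1 := aval (Const 0) s1))"
      then have "I 0 s2" by (simp add: I_def)
      from outer[OF this] show "\<exists>t s'. runs (While (?test 0) (?row d)) s2 t s' \<and> t \<le> ?L * (?R ?L + 1) + 1 \<and> I ?L s'"
        by simp
    next
      fix s3 assume "I ?L s3"
      then have "K 0 s3" using a by (auto simp: I_def K_def)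
      from copy[OF this] obtain t s' where r: "runs (While (?c4 d) (?copy d)) s3 t s'"
        "t \<le> ?L * ?L * (1 + 1 + 1) + 1" "K (?L * ?L) s'" by auto
      have "agree s' (upd a g m)"
        using r(3) 2 a by (auto simp: K_def agree_def upd_def fun_eq_iff)
      moreover have "\<forall>i<d. s' 4 i = s 4 i" using r(3) by (simp add: K_def)
      ultimately show "\<exists>u s''. runs (While (?c4 d) (?copy d)) s3 u s'' \<and> u \<le> ?L * ?L * (1 + 1 + 1) + 1 \<and>
          agree s'' (upd a g m) \<and> cap (upd a g m) = ?L \<and> (\<forall>i<d. s'' 4 i = s 4 i)"
        using r(1,2) a by auto
    qed
  qed
qed


lemmas computable_rules =
  computable_const computable_cap computable_add computable_diff computable_Suc computable_sum computable_if
  computable_of_bool computable_mat decidable_less decidable_le decidable_eq decidable_conj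
  decidable_disj decidable_imp decidable_not decidable_ex decidable_all computable_read

text \<open>The machine has no multiplication, so a product is a bounded sum, correct if the left
  factor is at most \<open>cap m\<close>. A factor without such a bound goes to the right.\<close>

definition mulc :: "memory \<Rightarrow> nat \<Rightarrow> nat \<Rightarrow> nat" where
  "mulc m a b = (\<Sum>i<cap m. if i < a then b else 0)"

lemma mulc: "a \<le> cap m \<Longrightarrow> mulc m a b = a * b"
proof -
  assume "a \<le> cap m"
  then have "{i \<in> {..<cap m}. i < a} = {..<a}" by auto
  then show ?thesis by (simp add: mulc_def flip: sum.inter_filter)
qed

section \<open>Balanced relations and strong components\<close>

definition bal :: "('a \<times> 'a) set \<Rightarrow> bool" where
  "bal E \<longleftrightarrow> (\<forall>v. card (E `` {v}) = card (E\<inverse> `` {v}))"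

text \<open>These are the arcs inside strong components: an arc lies in one exactly if its head
  reaches its tail. Degrees in \<open>cyc E\<close> are degrees within components, so one statement
  about a relation replaces the quantification over components.\<close>

definition cyc :: "('a \<times> 'a) set \<Rightarrow> ('a \<times> 'a) set" where
  "cyc E = {(v, w) \<in> E. (w, v) \<in> E\<^sup>*}"

lemma balanced_with_proj_iff:
  assumes "\<And>u v. (u, v) \<in> arcs H \<Longrightarrow> u \<in> verts H \<and> v \<in> verts H" "tail H = fst" "head H = snd"
  shows "balanced H \<longleftrightarrow> bal (arcs H)"
proof -
  have "out_degree H v = card (arcs H `` {v})" for v
  proof -
    have "out_arcs H v = Pair v ` (arcs H `` {v})" using assms by (auto simp: out_arcs_def)
    then show ?thesis by (simp add: out_degree_def card_image inj_on_def)
  qed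
  moreover have "in_degree H v = card ((arcs H)\<inverse> `` {v})" for v
  proof -
    have "in_arcs H v = (\<lambda>u. (u, v)) ` ((arcs H)\<inverse> `` {v})" using assms by (auto simp: in_arcs_def)
    then show ?thesis by (simp add: in_degree_def card_image inj_on_def)
  qed
  moreover have "arcs H `` {v} = {} \<and> (arcs H)\<inverse> `` {v} = {}" if "v \<notin> verts H" for v
    using assms that by auto
  ultimately show ?thesis unfolding balanced_def bal_def by (metis card.empty)
qed

text \<open>Strong components are strongly connected by definition, so only balance is at stake. At
  a vertex of a component the induced subgraph has the same arcs as \<open>cyc\<close>, and at all
  other vertices it has none.\<close>

lemma DESC_set_iff:
  assumes "pair_digraph D"
  shows "DESC_set D A \<longleftrightarrow> A \<subseteq> parcs D \<and> bal (cyc (parcs D - A))"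
proof -
  interpret D: pair_digraph D by fact
  define E where "E = parcs D - A"
  interpret H: pair_wf_digraph "delete_arcs D A"
    by unfold_locales (auto simp: delete_arcs_def D.arc_fst_in_verts D.arc_snd_in_verts)
  have E: "(u, v) \<in> E \<Longrightarrow> u \<in> pverts D \<and> v \<in> pverts D" for u v
    using D.arc_fst_in_verts D.arc_snd_in_verts by (force simp: E_def)
  have reach: "u \<rightarrow>\<^sup>*\<^bsub>with_proj (delete_arcs D A)\<^esub> v \<longleftrightarrow> (u, v) \<in> E\<^sup>*" if "u \<in> pverts D" for u v
    using H.reachable_conv'[of u v] that by (simp add: delete_arcs_def E_def)
  have "Eulerian C \<longleftrightarrow> balanced C" if "C \<in> pre_digraph.sccs (with_proj (delete_arcs D A))" for C
    using that by (auto simp: Eulerian_def H.sccs_def)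
  moreover have pv: "pverts (delete_arcs D A) = pverts D" "parcs (delete_arcs D A) = E"
    by (simp_all add: delete_arcs_def E_def)
  have "pre_digraph.sccs (with_proj (delete_arcs D A)) =
      (\<lambda>u. with_proj (delete_arcs D A) \<restriction> H.scc_of u) ` pverts D"
    by (simp only: H.sccs_conv_sccs_verts H.sccs_verts_conv_scc_of image_image with_proj_simps pv)
  ultimately have "DESC_set D A \<longleftrightarrow> A \<subseteq> parcs D \<and> (\<forall>u\<in>pverts D. balanced (with_proj (delete_arcs D A) \<restriction> H.scc_of u))"
    unfolding DESC_set_def by simp
  moreover have "(\<forall>u\<in>pverts D. balanced (with_proj (delete_arcs D A) \<restriction> H.scc_of u)) \<longleftrightarrow> bal (cyc E)"
  proof -
    let ?S = "\<lambda>u. {v. (u, v) \<in> E\<^sup>* \<and> (v, u) \<in> E\<^sup>*}"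
    let ?A = "\<lambda>u. {e \<in> E. fst e \<in> ?S u \<and> snd e \<in> ?S u}"
    have V: "(u, v) \<in> E\<^sup>* \<Longrightarrow> u \<in> pverts D \<Longrightarrow> v \<in> pverts D" for u v
      by (induction rule: rtrancl_induct) (auto dest: E)
    have scc: "H.scc_of u = ?S u" if u: "u \<in> pverts D" for u
    proof (intro set_eqI iffI)
      fix v assume "v \<in> H.scc_of u"
      then have *: "u \<rightarrow>\<^sup>*\<^bsub>with_proj (delete_arcs D A)\<^esub> v" "v \<rightarrow>\<^sup>*\<^bsub>with_proj (delete_arcs D A)\<^esub> u"
        by (auto simp: H.scc_of_def)
      then have "v \<in> pverts D" using H.reachable_in_verts(1)[OF *(2)] by (simp add: pv)
      with * u show "v \<in> ?S u" by (simp add: reach)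
    next
      fix v assume "v \<in> ?S u"
      then show "v \<in> H.scc_of u" using u V[of u v] by (simp add: H.scc_of_def reach)
    qed
    have b: "balanced (with_proj (delete_arcs D A) \<restriction> H.scc_of u) \<longleftrightarrow> bal (?A u)" if "u \<in> pverts D" for u
      unfolding scc[OF that] by (subst balanced_with_proj_iff) (auto simp: pv)
    have im: "?A u `` {v} = cyc E `` {v}" "(?A u)\<inverse> `` {v} = (cyc E)\<inverse> `` {v}" if v: "v \<in> ?S u" for u v
    proof -
      have "(v, w) \<in> ?A u \<longleftrightarrow> (v, w) \<in> cyc E" "(w, v) \<in> ?A u \<longleftrightarrow> (w, v) \<in> cyc E" for w
        using v by (auto simp: cyc_def intro: rtrancl_trans r_into_rtrancl)
      then show "?A u `` {v} = cyc E `` {v}" "(?A u)\<inverse> `` {v} = (cyc E)\<inverse> `` {v}"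
        by (simp_all only: set_eq_iff Image_singleton_iff converse_iff simp_thms)
    qed
    have im0: "?A u `` {v} = {}" "(?A u)\<inverse> `` {v} = {}" if "v \<notin> ?S u" for u v
      using that by (simp_all only: set_eq_iff Image_singleton_iff converse_iff mem_Collect_eq fst_conv snd_conv empty_iff) simp_all
    have out: "cyc E `` {v} = {}" "(cyc E)\<inverse> `` {v} = {}" if "v \<notin> pverts D" for v
      using that E by (auto simp: cyc_def)
    have self: "v \<in> ?S v" for v by simp
    have "(\<forall>u\<in>pverts D. bal (?A u)) \<longleftrightarrow> bal (cyc E)"
    proof
      assume l: "\<forall>u\<in>pverts D. bal (?A u)"
      show "bal (cyc E)" unfolding bal_def
      proof
        fix v
        show "card (cyc E `` {v}) = card ((cyc E)\<inverse> `` {v})"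
        proof (cases "v \<in> pverts D")
          case True
          then have "card (?A v `` {v}) = card ((?A v)\<inverse> `` {v})" using l unfolding bal_def by blast
          then show ?thesis by (simp only: im[OF self])
        qed (use out in simp)
      qed
    next
      assume r: "bal (cyc E)"
      show "\<forall>u\<in>pverts D. bal (?A u)" unfolding bal_def
      proof (intro ballI allI)
        fix u v
        show "card (?A u `` {v}) = card ((?A u)\<inverse> `` {v})"
        proof (cases "v \<in> ?S u")
          case True
          then show ?thesis using r unfolding bal_def by (simp only: im[OF True])
        qed (use im0 in simp)
      qed
    qed
    then show ?thesis using b by simp
  qed
  ultimately show ?thesis by (simp add: E_def)
qed

section \<open>Arcs on cycles under balance, monotone functions, restriction and renaming\<close>

lemma bal_empty [simp]: "bal {}"
  by (simp add: bal_def)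

lemma card_eq_sum_Image:
  assumes "finite E" "finite S"
  shows "card {e \<in> E. fst e \<in> S} = (\<Sum>x\<in>S. card (E `` {x}))"
proof -
  have "{e \<in> E. fst e \<in> S} = Sigma S (\<lambda>x. E `` {x})" by auto
  then show ?thesis using assms by (simp add: finite_Image)
qed

lemma card_eq_sum_converse_Image:
  assumes "finite E" "finite S"
  shows "card {e \<in> E. snd e \<in> S} = (\<Sum>x\<in>S. card (E\<inverse> `` {x}))"
proof -
  have "{e \<in> E. snd e \<in> S} = prod.swap ` {e \<in> E\<inverse>. fst e \<in> S}" by force
  then have "card {e \<in> E. snd e \<in> S} = card {e \<in> E\<inverse>. fst e \<in> S}"
    by (simp add: card_image)
  then show ?thesis using assms card_eq_sum_Image[of "E\<inverse>" S] by simp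
qed

text \<open>
  The set of vertices reachable from the head of an arc emits as many arcs as it receives, and all
  arcs it emits end in it; so all arcs it receives start in it.
\<close>

lemma cyc_bal:
  assumes "finite E" "bal E"
  shows "cyc E = E"
proof -
  have "(v, u) \<in> E\<^sup>*" if uv: "(u, v) \<in> E" for u v
  proof -
    define S where "S = E\<^sup>* `` {v}"
    have "y = v \<or> y \<in> snd ` E" if "(v, y) \<in> E\<^sup>*" for y
      using that by cases force+
    then have "S \<subseteq> insert v (snd ` E)" by (auto simp: S_def)
    then have fin: "finite S" using assms(1) by (meson finite_imageI finite_insert finite_subset)
    have "{e \<in> E. fst e \<in> S} \<subseteq> {e \<in> E. snd e \<in> S}"
      by (auto simp: S_def intro: rtrancl_into_rtrancl)
    moreover have "card {e \<in> E. fst e \<in> S} = card {e \<in> E. snd e \<in> S}"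
      using assms fin by (simp add: card_eq_sum_Image card_eq_sum_converse_Image bal_def)
    ultimately have "{e \<in> E. fst e \<in> S} = {e \<in> E. snd e \<in> S}"
      using assms(1) by (intro card_subset_eq) auto
    moreover have "(u, v) \<in> {e \<in> E. snd e \<in> S}" using uv by (simp add: S_def)
    ultimately have "u \<in> S" by (metis (no_types, lifting) fst_conv mem_Collect_eq)
    then show ?thesis by (simp add: S_def)
  qed
  then show ?thesis by (auto simp: cyc_def)
qed

lemma rtrancl_mono_fun:
  fixes f :: "'a \<Rightarrow> 'b :: preorder"
  assumes "\<And>u v. (u, v) \<in> E \<Longrightarrow> f v \<le> f u" "(u, v) \<in> E\<^sup>*"
  shows "f v \<le> f u"
  using assms(2) by induction (auto dest: assms(1) intro: order_trans)

text \<open>A function that never increases along arcs is constant on a closed walk, so an arc on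
  which it drops lies on no cycle. It is applied to the piece number.\<close>

lemma cyc_mono_fun:
  fixes f :: "'a \<Rightarrow> 'b :: order"
  assumes f: "\<And>u v. (u, v) \<in> E \<Longrightarrow> f v \<le> f u"
  shows "cyc E = cyc {(u, v) \<in> E. f u = f v}"
proof -
  let ?E = "{(u, v) \<in> E. f u = f v}"
  have "(u, v) \<in> ?E\<^sup>*" if "(u, v) \<in> E\<^sup>*" "f u = f v" for u v
    using that
  proof (induction rule: converse_rtrancl_induct)
    case (step x y)
    have "f y \<le> f x" "f v \<le> f y" using f step.hyps rtrancl_mono_fun[of E f, OF f] by auto
    with step show ?case by (auto intro: converse_rtrancl_into_rtrancl)
  qed simp
  moreover have "?E\<^sup>* \<subseteq> E\<^sup>*" by (rule rtrancl_mono) auto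
  moreover have "f u = f v" if "(u, v) \<in> E" "(v, u) \<in> E\<^sup>*" for u v
    using f[OF that(1)] rtrancl_mono_fun[of E f, OF f that(2)] by simp
  ultimately show ?thesis by (auto simp: cyc_def)
qed

text \<open>No arc joins the inside and the outside of \<open>P\<close>, so a walk that ends inside
  has never been outside.\<close>

lemma cyc_restrict:
  assumes P: "\<And>u v. (u, v) \<in> E \<Longrightarrow> P u \<longleftrightarrow> P v"
  shows "cyc {(u, v) \<in> E. P u} = {(u, v) \<in> cyc E. P u}"
proof -
  have "(u, v) \<in> {(u, v) \<in> E. P u}\<^sup>*" if "(u, v) \<in> E\<^sup>*" "P v" for u v
    using that
  proof (induction rule: converse_rtrancl_induct)
    case (step y z)
    have "P z \<longleftrightarrow> P v" using step.hyps(2) by (induction rule: converse_rtrancl_induct) (auto simp: P)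
    with step P have "(y, z) \<in> {(u, v) \<in> E. P u}" by simp
    then show ?case using step by (blast intro: converse_rtrancl_into_rtrancl)
  qed simp
  moreover have "{(u, v) \<in> E. P u}\<^sup>* \<subseteq> E\<^sup>*" by (rule rtrancl_mono) auto
  ultimately show ?thesis by (auto simp: cyc_def)
qed

lemma bal_restrict:
  assumes P: "\<And>u v. (u, v) \<in> E \<Longrightarrow> P u \<longleftrightarrow> P v" and "bal E"
  shows "bal {(u, v) \<in> E. P u}"
  unfolding bal_def
proof
  fix v
  have "{(u, v) \<in> E. P u} `` {v} = (if P v then E `` {v} else {})"
    "{(u, v) \<in> E. P u}\<inverse> `` {v} = (if P v then E\<inverse> `` {v} else {})" using P by auto
  then show "card ({(u, v) \<in> E. P u} `` {v}) = card ({(u, v) \<in> E. P u}\<inverse> `` {v})"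
    using assms(2) by (simp add: bal_def)
qed

text \<open>All arcs at a vertex lie on the same side, so its degrees are its degrees in one of the
  two parts.\<close>

lemma bal_unrestrict:
  assumes P: "\<And>u v. (u, v) \<in> E \<Longrightarrow> P u \<longleftrightarrow> P v"
    and b: "bal {(u, v) \<in> E. P u}" "bal {(u, v) \<in> E. \<not> P u}"
  shows "bal E"
  unfolding bal_def
proof
  fix v
  have *: "E `` {v} = (if P v then {(u, v) \<in> E. P u} `` {v} else {(u, v) \<in> E. \<not> P u} `` {v})"
    "E\<inverse> `` {v} = (if P v then {(u, v) \<in> E. P u}\<inverse> `` {v} else {(u, v) \<in> E. \<not> P u}\<inverse> `` {v})" using P by auto
  show "card (E `` {v}) = card (E\<inverse> `` {v})"
    using b[unfolded bal_def, THEN spec, of v] unfolding * by (cases "P v") (simp_all only: if_True if_False)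
qed

lemma rtrancl_map_prod:
  assumes "inj_on r V" "E \<subseteq> V \<times> V" "u \<in> V" "v \<in> V"
  shows "(r u, r v) \<in> (map_prod r r ` E)\<^sup>* \<longleftrightarrow> (u, v) \<in> E\<^sup>*"
proof
  show "(u, v) \<in> E\<^sup>* \<Longrightarrow> (r u, r v) \<in> (map_prod r r ` E)\<^sup>*"
    by (induction rule: rtrancl_induct) (auto intro: rtrancl_into_rtrancl rev_image_eqI)
  have "\<forall>v\<in>V. y = r v \<longrightarrow> (u, v) \<in> E\<^sup>*" if "(r u, y) \<in> (map_prod r r ` E)\<^sup>*" for y
    using that
  proof (induction rule: rtrancl_induct)
    case base
    then show ?case using assms by (auto dest: inj_onD)
  next
    case (step y z)
    then obtain a b where ab: "(a, b) \<in> E" "y = r a" "z = r b" by auto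
    then have "(u, a) \<in> E\<^sup>*" "a \<in> V" "b \<in> V" using step.IH assms(2) by auto
    then show ?case using ab inj_onD[OF assms(1)] by (auto intro: rtrancl_into_rtrancl)
  qed
  then show "(r u, r v) \<in> (map_prod r r ` E)\<^sup>* \<Longrightarrow> (u, v) \<in> E\<^sup>*" using assms(4) by blast
qed

text \<open>Together with \<open>bal_map_prod\<close> this allows the vertices of the kernel to be
  renumbered by \<open>rank\<close>.\<close>

lemma cyc_map_prod:
  assumes "inj_on r V" "E \<subseteq> V \<times> V"
  shows "cyc (map_prod r r ` E) = map_prod r r ` cyc E"
proof -
  have *: "(r v, r u) \<in> (map_prod r r ` E)\<^sup>* \<longleftrightarrow> (v, u) \<in> E\<^sup>*" if "(u, v) \<in> E" for u v
    using rtrancl_map_prod[OF assms] that assms(2) by blast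
  have "cyc (map_prod r r ` E) = {e \<in> map_prod r r ` E. (snd e, fst e) \<in> (map_prod r r ` E)\<^sup>*}"
    unfolding cyc_def by (rule set_eqI) (simp only: mem_Collect_eq case_prod_beta prod.collapse)
  also have "\<dots> = map_prod r r ` {e \<in> E. (r (snd e), r (fst e)) \<in> (map_prod r r ` E)\<^sup>*}"
    by (rule set_eqI) (simp only: mem_Collect_eq image_iff; force)
  also have "{e \<in> E. (r (snd e), r (fst e)) \<in> (map_prod r r ` E)\<^sup>*} = cyc E"
    using * unfolding cyc_def by (intro set_eqI) (simp only: mem_Collect_eq case_prod_beta prod.collapse; metis prod.collapse)
  finally show ?thesis .
qed

lemma bal_map_prod:
  assumes "inj_on r V" "E \<subseteq> V \<times> V"
  shows "bal (map_prod r r ` E) \<longleftrightarrow> bal E"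
proof -
  have r: "r u = r v \<longleftrightarrow> u = v" if "u \<in> V" "v \<in> V" for u v
    using assms(1) that by (auto dest: inj_onD)
  have im: "card ((map_prod r r ` E) `` {r v}) = card (E `` {v})"
    "card ((map_prod r r ` E)\<inverse> `` {r v}) = card (E\<inverse> `` {v})" if "v \<in> V" for v
  proof -
    have "(map_prod r r ` E) `` {r v} = r ` (E `` {v})" "(map_prod r r ` E)\<inverse> `` {r v} = r ` (E\<inverse> `` {v})"
      using assms(2) r that by (force simp: image_iff)+
    moreover have "inj_on r (E `` {v})" "inj_on r (E\<inverse> `` {v})"
      using assms by (auto elim: inj_on_subset)
    ultimately show "card ((map_prod r r ` E) `` {r v}) = card (E `` {v})"
      "card ((map_prod r r ` E)\<inverse> `` {r v}) = card (E\<inverse> `` {v})" by (simp_all add: card_image)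
  qed
  have out: "(map_prod r r ` E) `` {y} = {} \<and> (map_prod r r ` E)\<inverse> `` {y} = {}" if "y \<notin> r ` V" for y
    using assms(2) that by auto
  have out': "E `` {y} = {} \<and> E\<inverse> `` {y} = {}" if "y \<notin> V" for y
    using assms(2) that by auto
  show ?thesis
  proof
    assume b: "bal (map_prod r r ` E)"
    show "bal E" unfolding bal_def
    proof
      fix v
      show "card (E `` {v}) = card (E\<inverse> `` {v})"
      proof (cases "v \<in> V")
        case True
        then show ?thesis using b[unfolded bal_def, rule_format, of "r v"] by (simp only: im)
      qed (use out' in simp)
    qed
  next
    assume b: "bal E"
    show "bal (map_prod r r ` E)" unfolding bal_def
    proof
      fix y
      show "card ((map_prod r r ` E) `` {y}) = card ((map_prod r r ` E)\<inverse> `` {y})"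
      proof (cases "y \<in> r ` V")
        case True
        then show ?thesis using b[unfolded bal_def] by (auto simp only: im)
      qed (use out in simp)
    qed
  qed
qed

section \<open>Levels of strong components\<close>

lemma finite_relation_Image:
  assumes "finite E"
  shows "finite (E `` X)"
proof (rule finite_subset)
  show "E `` X \<subseteq> snd ` E" by force
qed (use assms in simp)

locale tournament_relation =
  fixes n :: nat and T :: "(nat \<times> nat) set"
  assumes T_subset: "T \<subseteq> {..<n} \<times> {..<n}"
    and T_irrefl: "(v, v) \<notin> T"
    and T_total: "u < n \<Longrightarrow> v < n \<Longrightarrow> u \<noteq> v \<Longrightarrow> (u, v) \<in> T \<longleftrightarrow> (v, u) \<notin> T"
begin

lemma T_verts: "(u, v) \<in> T \<Longrightarrow> u < n \<and> v < n"
  using T_subset by auto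

lemma T_antisym: "(u, v) \<in> T \<Longrightarrow> (v, u) \<notin> T"
  using T_total T_irrefl T_verts by metis

lemma finite_T: "finite T"
  using T_subset finite_subset by blast

definition deg :: "nat \<Rightarrow> nat" where
  "deg v = card (T `` {v})"

lemma card_in_T: "v < n \<Longrightarrow> card (T\<inverse> `` {v}) + deg v + 1 = n"
proof -
  assume v: "v < n"
  have "{..<n} = insert v (T `` {v} \<union> T\<inverse> `` {v})"
  proof (intro set_eqI)
    fix u
    show "u \<in> {..<n} \<longleftrightarrow> u \<in> insert v (T `` {v} \<union> T\<inverse> `` {v})"
      using T_total[of u v] T_verts[of u v] T_verts[of v u] v by auto
  qed
  moreover have "T `` {v} \<inter> T\<inverse> `` {v} = {}" using T_antisym[of v] by blast
  moreover have "v \<notin> T `` {v} \<union> T\<inverse> `` {v}" using T_irrefl by auto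
  moreover have "finite (T `` {v})" "finite (T\<inverse> `` {v})"
    using finite_T by (simp_all add: finite_relation_Image)
  ultimately have "card {..<n} = Suc (card (T `` {v}) + card (T\<inverse> `` {v}))"
    by (simp add: card_Un_disjoint)
  then show ?thesis by (simp add: deg_def)
qed

end

text \<open>\<open>A_bal\<close> is the DESC property in the form of \<open>DESC_set_iff\<close>.
  The set \<open>A\<close> is arbitrary: what is derived here holds for every solution with at most
  \<open>k\<close> arcs.\<close>

locale tournament_solution = tournament_relation +
  fixes A :: "(nat \<times> nat) set" and k :: nat
  assumes A_subset: "A \<subseteq> T" and A_bal: "bal (cyc (T - A))" and A_card: "card A \<le> k"
begin

abbreviation "E \<equiv> T - A"

definition R :: "nat \<Rightarrow> nat set" where
  "R x = {y. y < n \<and> (x, y) \<in> E\<^sup>*}"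

definition comp :: "nat \<Rightarrow> nat set" where
  "comp x = {y. y < n \<and> (x, y) \<in> E\<^sup>* \<and> (y, x) \<in> E\<^sup>*}"

text \<open>
  For a vertex that no arc of \<open>A\<close> touches, the level is twice the out-degree plus 1, since half of
  its strong component follows it and it is comparable with everything else.
\<close>

definition level :: "nat \<Rightarrow> nat" where
  "level x = 2 * card (R x - comp x) + card (comp x)"

definition touched :: "nat set" where
  "touched = fst ` A \<union> snd ` A"

lemma finite_A: "finite A"
  using A_subset finite_T finite_subset by blast

lemma finite_sets [simp]: "finite (R x)" "finite (comp x)"
  by (simp_all add: R_def comp_def)

lemma comp_subset: "comp x \<subseteq> R x"
  by (auto simp: R_def comp_def)

lemma card_touched: "card touched \<le> 2 * k"
proof -
  have "card touched \<le> card (fst ` A) + card (snd ` A)" unfolding touched_def by (rule card_Un_le)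
  also have "\<dots> \<le> card A + card A" by (intro add_mono card_image_le finite_A)
  finally show ?thesis using A_card by simp
qed

lemma finite_cyc: "finite (cyc E)"
  by (rule finite_subset[OF _ finite_T]) (auto simp: cyc_def)

lemma card_Image_A: "card (A `` {x}) \<le> card A" "card (A\<inverse> `` {x}) \<le> card A"
proof -
  have "A `` {x} \<subseteq> snd ` A" "A\<inverse> `` {x} \<subseteq> fst ` A" by force+
  then show "card (A `` {x}) \<le> card A" "card (A\<inverse> `` {x}) \<le> card A"
    using surj_card_le[OF finite_A] by blast+
qed

lemma untouched_card:
  assumes "x \<notin> touched"
  shows "A `` {x} = {}" "A\<inverse> `` {x} = {}"
  using assms by (force simp: touched_def)+

lemma E_verts: "(u, v) \<in> E \<Longrightarrow> u < n \<and> v < n"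
  using T_verts by auto

text \<open>An out-neighbour of \<open>x\<close> in \<open>T\<close> lies strictly after the
  component of \<open>x\<close>, or is joined to \<open>x\<close> inside it, or is reached by an arc
  of \<open>A\<close>; in-neighbours are treated dually. Balance makes the two degrees inside the
  component equal, so twice either of them is less than \<open>card (comp x)\<close>. The error
  terms are the arcs of \<open>A\<close> that leave or enter \<open>x\<close>.\<close>

lemma level_bounds:
  assumes "x < n"
  shows "2 * deg x + 1 \<le> level x + 2 * card (A `` {x})"
    and "level x \<le> 2 * deg x + 1 + 2 * card (A\<inverse> `` {x})"
proof -
  let ?O = "cyc E `` {x}" and ?I = "(cyc E)\<inverse> `` {x}"
  have fin: "finite (A `` {x})" "finite (A\<inverse> `` {x})" "finite ?O" "finite ?I"
    using finite_A finite_T finite_cyc by (simp_all add: finite_relation_Image)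
  have dj: "?O \<inter> ?I = {}" using T_antisym[of x] unfolding cyc_def by blast
  moreover have "?O \<union> ?I \<subseteq> comp x - {x}"
    using E_verts T_irrefl by (auto simp: cyc_def comp_def)
  moreover have "x \<in> comp x" using assms by (simp add: comp_def)
  ultimately have "insert x (?O \<union> ?I) \<subseteq> comp x" by blast
  then have "card (insert x (?O \<union> ?I)) \<le> card (comp x)" by (rule card_mono[rotated]) simp
  moreover have "x \<notin> ?O \<union> ?I" using T_irrefl by (auto simp: cyc_def)
  ultimately have "card ?O + card ?I + 1 \<le> card (comp x)"
    using fin dj by (simp add: card_Un_disjoint)
  moreover have OI: "card ?O = card ?I" using A_bal by (simp add: bal_def)
  ultimately have half: "2 * card ?O + 1 \<le> card (comp x)" by simp
  have "T `` {x} \<subseteq> (R x - comp x) \<union> ?O \<union> A `` {x}"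
    using E_verts assms by (auto simp: R_def comp_def cyc_def)
  then have "deg x \<le> card ((R x - comp x) \<union> ?O \<union> A `` {x})"
    unfolding deg_def by (intro card_mono) (auto simp: fin)
  also have "\<dots> \<le> card (R x - comp x) + card ?O + card (A `` {x})"
    by (intro order_trans[OF card_Un_le] add_mono card_Un_le order_refl)
  finally show "2 * deg x + 1 \<le> level x + 2 * card (A `` {x})"
    using half by (simp add: level_def)
  have "T\<inverse> `` {x} \<subseteq> ({..<n} - R x) \<union> ?I \<union> A\<inverse> `` {x}"
    using E_verts assms by (auto simp: R_def comp_def cyc_def)
  then have "card (T\<inverse> `` {x}) \<le> card (({..<n} - R x) \<union> ?I \<union> A\<inverse> `` {x})"
    by (intro card_mono) (auto simp: fin)
  also have "\<dots> \<le> card ({..<n} - R x) + card ?I + card (A\<inverse> `` {x})"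
    by (intro order_trans[OF card_Un_le] add_mono card_Un_le order_refl)
  finally have "card (T\<inverse> `` {x}) \<le> card ({..<n} - R x) + card ?I + card (A\<inverse> `` {x})" .
  moreover have "R x \<subseteq> {..<n}" by (auto simp: R_def)
  then have "card ({..<n} - R x) + card (R x) = n"
    using card_Diff_subset[of "R x" "{..<n}"] card_mono[of "{..<n}" "R x"] by simp
  moreover have "card (R x) = card (R x - comp x) + card (comp x)"
    using card_Diff_subset[of "comp x" "R x"] card_mono[of "R x" "comp x"] comp_subset by auto
  ultimately show "level x \<le> 2 * deg x + 1 + 2 * card (A\<inverse> `` {x})"
    using card_in_T[OF assms] half OI by (simp add: level_def)
qed

lemma R_mono: "(x, y) \<in> E\<^sup>* \<Longrightarrow> R y \<subseteq> R x"
  unfolding R_def by (blast dest: rtrancl_trans)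

lemma level_eq: "(x, y) \<in> E\<^sup>* \<Longrightarrow> (y, x) \<in> E\<^sup>* \<Longrightarrow> level x = level y"
proof -
  assume *: "(x, y) \<in> E\<^sup>*" "(y, x) \<in> E\<^sup>*"
  then have "R x = R y" "comp x = comp y"
    unfolding R_def comp_def by (blast dest: rtrancl_trans)+
  then show ?thesis by (simp add: level_def)
qed

text \<open>The level of \<open>x\<close> is twice the size of \<open>R x\<close> minus the size of
  \<open>comp x\<close>. Now \<open>R x\<close> contains \<open>R y - comp y\<close> and, disjoint
  from it, the set \<open>?W\<close>. So the levels differ by at least twice the size of
  \<open>?W\<close> minus the sizes of the two components, and this is at least the size of
  \<open>?W\<close>, as the components are disjoint subsets of it.\<close>

lemma level_gap:
  assumes "(x, y) \<in> E\<^sup>*" "(y, x) \<notin> E\<^sup>*" "x < n" "y < n"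
    and U: "U \<subseteq> R x" "U \<inter> (R y - comp y) = {}"
  shows "level y + card U \<le> level x"
proof -
  let ?W = "U \<union> comp x \<union> comp y"
  have finU: "finite U" using U(1) finite_sets(1) by (rule finite_subset)
  have "R y - comp y \<subseteq> R x" "comp y \<subseteq> R x" "comp x \<subseteq> R x"
    using R_mono[OF assms(1)] comp_subset by blast+
  moreover have disj: "?W \<inter> (R y - comp y) = {}"
  proof -
    have "z \<notin> R y - comp y" if "z \<in> comp x" for z
    proof
      assume "z \<in> R y - comp y"
      then have "(y, z) \<in> E\<^sup>*" by (simp add: R_def)
      moreover have "(z, x) \<in> E\<^sup>*" using that by (simp add: comp_def)
      ultimately show False using assms(2) by (meson rtrancl_trans)
    qed
    then show ?thesis using U by blast
  qed
  ultimately have "card (?W \<union> (R y - comp y)) \<le> card (R x)"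
    using U by (intro card_mono) auto
  then have 1: "card ?W + card (R y - comp y) \<le> card (R x)"
    using disj finU by (subst (asm) card_Un_disjoint) auto
  have "comp x \<inter> comp y = {}"
  proof (rule ccontr)
    assume "comp x \<inter> comp y \<noteq> {}"
    then obtain z where "(y, z) \<in> E\<^sup>*" "(z, x) \<in> E\<^sup>*" by (auto simp: comp_def)
    then show False using assms(2) by (meson rtrancl_trans)
  qed
  then have "card (comp x) + card (comp y) = card (comp x \<union> comp y)"
    by (simp add: card_Un_disjoint)
  also have "\<dots> \<le> card ?W" using finU by (intro card_mono) auto
  finally have 2: "card (comp x) + card (comp y) \<le> card ?W" .
  have 3: "card U \<le> card ?W" using finU by (intro card_mono) auto
  have "card (R x) = card (R x - comp x) + card (comp x)"
    using card_Diff_subset[of "comp x" "R x"] card_mono[of "R x" "comp x"] comp_subset by auto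
  with 1 2 3 show ?thesis by (simp add: level_def)
qed

lemma level_mono:
  assumes "(x, y) \<in> E\<^sup>*" "x < n" "y < n"
  shows "level y \<le> level x"
  using level_gap[of x y "{}"] level_eq[of x y] assms by (cases "(y, x) \<in> E\<^sup>*") auto

text \<open>Every arc of \<open>T\<close> at an untouched vertex survives in
  \<open>E\<close>.\<close>

lemma comparable:
  assumes "x \<notin> touched" "x < n" "y < n"
  shows "(x, y) \<in> E\<^sup>* \<or> (y, x) \<in> E\<^sup>*"
proof (cases "x = y")
  case False
  have "(x, y) \<notin> A" "(y, x) \<notin> A" using assms(1) by (force simp: touched_def)+
  then show ?thesis using T_total[of x y] assms False by blast
qed simp

text \<open>If the arc survived, \<open>u\<close> would have at most the level of \<open>w\<close>.
  By \<open>level_bounds\<close> the out-degrees can contradict this order only by the number of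
  arcs of \<open>A\<close> leaving \<open>u\<close> plus the number of those entering
  \<open>w\<close>, and together these are at most \<open>k\<close>.\<close>

lemma long_back_arc_in_A:
  assumes "(w, u) \<in> T" "deg w + k < deg u"
  shows "(w, u) \<in> A"
proof (rule ccontr)
  assume "(w, u) \<notin> A"
  then have E: "(w, u) \<in> E" using assms by simp
  have v: "w < n" "u < n" using assms T_verts by auto
  have "level u \<le> level w" using E v by (intro level_mono) auto
  moreover have "card (A `` {u}) + card (A\<inverse> `` {w}) \<le> k"
  proof -
    let ?A1 = "{e \<in> A. fst e = u}" and ?A2 = "{e \<in> A. snd e = w}"
    have "A `` {u} = snd ` ?A1" "A\<inverse> `` {w} = fst ` ?A2" by force+
    then have "card (A `` {u}) + card (A\<inverse> `` {w}) \<le> card ?A1 + card ?A2"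
      using card_image_le[of ?A1 snd] card_image_le[of ?A2 fst] finite_A by simp
    \<comment> \<open>A common element would be the arc from \<open>u\<close> to \<open>w\<close>,
      but \<open>T\<close> contains the opposite arc.\<close>
    also have "\<dots> = card (?A1 \<union> ?A2)"
      using finite_A T_antisym[OF assms(1)] A_subset by (subst card_Un_disjoint) auto
    also have "\<dots> \<le> card A" using finite_A by (intro card_mono) auto
    finally show ?thesis using A_card by simp
  qed
  ultimately show False using level_bounds[OF v(1)] level_bounds[OF v(2)] assms(2) by linarith
qed

lemma untouched_level: "x < n \<Longrightarrow> x \<notin> touched \<Longrightarrow> level x = 2 * deg x + 1"
  using level_bounds[of x] untouched_card[of x] by simp

text \<open>Levels never rise along surviving arcs, and on untouched vertices levels and out-degrees
  give the same order.\<close>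

lemma touched_of_back_arc:
  assumes "(w, u) \<in> T" "deg w < deg u"
  shows "w \<in> touched \<or> u \<in> touched"
proof (rule ccontr)
  assume *: "\<not> ?thesis"
  then have "(w, u) \<notin> A" by (force simp: touched_def)
  then have "(w, u) \<in> E" using assms by simp
  moreover have "w < n" "u < n" using assms T_verts by auto
  ultimately have "level u \<le> level w" by (intro level_mono) auto
  then show False using untouched_level * \<open>w < n\<close> \<open>u < n\<close> assms(2) by simp
qed

text \<open>
  The untouched vertices of \<open>P\<close> and one further vertex are pairwise comparable, so they have a first
  and a last one, and the untouched vertices lie between these two.
\<close>

lemma large_strong:
  assumes P: "P \<subseteq> {..<n}" and ab: "a \<in> P" "b \<in> P" "(a, b) \<notin> E\<^sup>*"
  shows "\<exists>x\<in>P. \<exists>y\<in>P. card P + 2 * deg y \<le> 2 * deg x + 4 * k"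
proof -
  define U where "U = P - touched"
  have finP: "finite P" using P finite_subset by auto
  have cardU: "card P \<le> card U + 2 * k"
  proof -
    have "finite touched" using finite_A by (simp add: touched_def)
    then have "card P \<le> card (U \<union> touched)" using finP by (intro card_mono) (auto simp: U_def)
    also have "\<dots> \<le> card U + card touched" by (rule card_Un_le)
    finally show ?thesis using card_touched by simp
  qed
  show ?thesis
  proof (cases "U = {}")
    case True
    then have "card P + 2 * deg a \<le> 2 * deg a + 4 * k" using cardU by simp
    then show ?thesis using ab(1) by blast
  next
    case False
    then obtain u where u: "u \<in> U" by blast
    \<comment> \<open>If all of \<open>P\<close> were mutually reachable with \<open>u\<close>, then
      \<open>a\<close> would reach \<open>b\<close> through \<open>u\<close>.\<close>
    have "\<exists>z\<in>P. \<not> ((u, z) \<in> E\<^sup>* \<and> (z, u) \<in> E\<^sup>*)"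
      using ab by (meson rtrancl_trans)
    then obtain z where z: "z \<in> P" "\<not> ((u, z) \<in> E\<^sup>* \<and> (z, u) \<in> E\<^sup>*)" by blast
    define Z where "Z = insert z U"
    have Z: "finite Z" "Z \<noteq> {}" "Z \<subseteq> P" "U \<subseteq> Z" "u \<in> Z" "z \<in> Z"
      using finP z u by (auto simp: Z_def U_def)
    have lt: "x < n" if "x \<in> Z" for x using that Z P by auto
    have cmp: "(x, y) \<in> E\<^sup>* \<or> (y, x) \<in> E\<^sup>*" if "x \<in> Z" "y \<in> Z" for x y
    proof (cases "x = y")
      case False
      then have "x \<notin> touched \<or> y \<notin> touched" using that by (auto simp: Z_def U_def)
      then show ?thesis using comparable lt that by blast
    qed simp
    \<comment> \<open>Among pairwise comparable vertices, one with a largest reachable set reaches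
      all others, and one with a smallest set is reached by all.\<close>
    obtain t where t: "t \<in> Z" "\<And>y. y \<in> Z \<Longrightarrow> card (R y) \<le> card (R t)"
    proof -
      have "Max ((\<lambda>x. card (R x)) ` Z) \<in> (\<lambda>x. card (R x)) ` Z" using Z by (intro Max_in) auto
      then obtain t where "t \<in> Z" "card (R t) = Max ((\<lambda>x. card (R x)) ` Z)" by auto
      then show ?thesis using that[of t] Z(1) by simp
    qed
    obtain l where l: "l \<in> Z" "\<And>y. y \<in> Z \<Longrightarrow> card (R l) \<le> card (R y)"
    proof -
      have "Min ((\<lambda>x. card (R x)) ` Z) \<in> (\<lambda>x. card (R x)) ` Z" using Z by (intro Min_in) auto
      then obtain t where "t \<in> Z" "card (R t) = Min ((\<lambda>x. card (R x)) ` Z)" by auto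
      then show ?thesis using that[of t] Z(1) by simp
    qed
    have self: "x \<in> Z \<Longrightarrow> x \<in> R x" for x using lt by (simp add: R_def)
    have top: "(t, y) \<in> E\<^sup>*" if "y \<in> Z" for y
    proof (rule ccontr)
      assume *: "(t, y) \<notin> E\<^sup>*"
      then have "R t \<subseteq> R y" using cmp t(1) that R_mono by blast
      then have "R t = R y" using t(2)[OF that] by (intro card_seteq) auto
      then show False using self[OF that] * by (auto simp: R_def)
    qed
    have low: "(y, l) \<in> E\<^sup>*" if "y \<in> Z" for y
    proof (rule ccontr)
      assume *: "(y, l) \<notin> E\<^sup>*"
      then have "R y \<subseteq> R l" using cmp l(1) that R_mono by blast
      then have "R y = R l" using l(2)[OF that] by (intro card_seteq) auto
      then show False using self[OF l(1)] * by (auto simp: R_def)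
    qed
    have lt': "(l, t) \<notin> E\<^sup>*"
    proof
      assume "(l, t) \<in> E\<^sup>*"
      then have "(x, y) \<in> E\<^sup>*" if "x \<in> Z" "y \<in> Z" for x y
        using low[OF that(1)] top[OF that(2)] by (meson rtrancl_trans)
      then show False using z(2) Z by blast
    qed
    have "level l + card U \<le> level t"
    proof (rule level_gap)
      show "U \<subseteq> R t" using top lt Z by (auto simp: R_def)
      show "U \<inter> (R l - comp l) = {}" using low lt Z by (auto simp: R_def comp_def)
    qed (use top l t lt lt' in auto)
    \<comment> \<open>Of the two ends only \<open>z\<close> can be touched, so at most one error
      term of \<open>level_bounds\<close> is nonzero, and the error in the levels is at most
      \<open>2 * k\<close>. The touched vertices of \<open>P\<close>, absent from \<open>U\<close>,
      account for the other \<open>2 * k\<close>.\<close>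
    moreover have "card (A\<inverse> `` {t}) + card (A `` {l}) \<le> k"
    proof -
      have "t \<noteq> l" using lt' by auto
      then have "t \<notin> touched \<or> l \<notin> touched" using t(1) l(1) by (auto simp: Z_def U_def)
      then show ?thesis using untouched_card card_Image_A[of t] card_Image_A[of l] A_card by auto
    qed
    moreover have "2 * deg l + 1 \<le> level l + 2 * card (A `` {l})"
        "level t \<le> 2 * deg t + 1 + 2 * card (A\<inverse> `` {t})"
      using level_bounds lt t(1) l(1) by auto
    ultimately have "card P + 2 * deg l \<le> 2 * deg t + 4 * k" using cardU by linarith
    then show ?thesis using t(1) l(1) Z(3) by blast
  qed
qed

end

section \<open>Cutting a tournament into pieces\<close>

locale tournament_parameter = tournament_relation +
  fixes k :: nat
begin

text \<open>The arcs in question cross \<open>t\<close> backwards. All of them have to be so long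
  that \<open>long_back_arc_in_A\<close> puts them into every solution.\<close>

definition valid :: "nat \<Rightarrow> bool" where
  "valid t \<longleftrightarrow> (\<forall>(w, u)\<in>T. deg w < t \<and> t \<le> deg u \<longrightarrow> deg w + k < deg u)"

text \<open>Counting valid thresholds numbers the pieces in the order of out-degrees. Threshold 0 is
  left out, as no vertex lies below it.\<close>

definition cuts :: "nat \<Rightarrow> nat" where
  "cuts d = card {t. 0 < t \<and> t \<le> d \<and> valid t}"

definition piece :: "nat \<Rightarrow> nat" where
  "piece v = cuts (deg v)"

definition members :: "nat \<Rightarrow> nat set" where
  "members v = {u. u < n \<and> piece u = piece v}"

definition B :: "(nat \<times> nat) set" where
  "B = {(w, u) \<in> T. piece w < piece u}"

definition I :: "(nat \<times> nat) set" where
  "I = {(u, v) \<in> T. piece u = piece v}"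

definition balanced_at :: "nat \<Rightarrow> bool" where
  "balanced_at v \<longleftrightarrow> card (I `` {v}) = card (I\<inverse> `` {v})"

text \<open>The inequality is the conclusion of \<open>large_strong\<close>; where it fails, the
  piece is strongly connected after deletion of any solution. Pieces without unbalanced vertices are
  dropped because they need no deletions.\<close>

definition keep :: "nat \<Rightarrow> bool" where
  "keep v \<longleftrightarrow> v < n \<and> (\<exists>u\<in>members v. \<not> balanced_at u) \<and>
     (\<exists>x\<in>members v. \<exists>y\<in>members v. card (members v) + 2 * deg y \<le> 2 * deg x + 4 * k)"

definition I_kept :: "(nat \<times> nat) set" where
  "I_kept = {(u, v) \<in> I. keep u}"

definition I_solved :: "(nat \<times> nat) set" where
  "I_solved = {(u, v) \<in> I. \<not> keep u}"

lemma cuts_mono: "d \<le> e \<Longrightarrow> cuts d \<le> cuts e"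
  unfolding cuts_def by (rule card_mono) (auto intro: finite_subset[of _ "{..e}"])

lemma cuts_less_iff: "cuts d < cuts e \<longleftrightarrow> (\<exists>t. d < t \<and> t \<le> e \<and> valid t)"
proof
  assume less: "cuts d < cuts e"
  show "\<exists>t. d < t \<and> t \<le> e \<and> valid t"
  proof (rule ccontr)
    assume "\<not> ?thesis"
    then have "{t. 0 < t \<and> t \<le> e \<and> valid t} \<subseteq> {t. 0 < t \<and> t \<le> d \<and> valid t}"
      by (auto simp: not_less)
    then have "cuts e \<le> cuts d"
      unfolding cuts_def by (rule card_mono[rotated]) (auto intro: finite_subset[of _ "{..d}"])
    then show False using less by simp
  qed
next
  assume "\<exists>t. d < t \<and> t \<le> e \<and> valid t"
  then obtain t where t: "d < t" "t \<le> e" "valid t" by blast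
  have "{t. 0 < t \<and> t \<le> d \<and> valid t} \<subset> {t. 0 < t \<and> t \<le> e \<and> valid t}"
    using t by (intro psubsetI) (auto simp: set_eq_iff intro!: exI[of _ t])
  then show "cuts d < cuts e"
    unfolding cuts_def by (rule psubset_card_mono[rotated]) (auto intro: finite_subset[of _ "{..e}"])
qed

text \<open>A short backward arc invalidates every threshold that it crosses.\<close>

lemma back_arc_piece:
  assumes "(w, u) \<in> T" "deg w \<le> deg u" "deg u \<le> deg w + k"
  shows "piece w = piece u"
proof -
  have "\<not> piece w < piece u"
  proof
    assume "piece w < piece u"
    then obtain t where "deg w < t" "t \<le> deg u" "valid t"
      by (auto simp: piece_def cuts_less_iff)
    then have "deg w + k < deg u" using assms(1) unfolding valid_def by blast
    then show False using assms(3) by simp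
  qed
  then show ?thesis using cuts_mono[OF assms(2)] by (simp add: piece_def)
qed

lemma keep_cong: "u < n \<Longrightarrow> v < n \<Longrightarrow> piece u = piece v \<Longrightarrow> keep u \<longleftrightarrow> keep v"
  by (simp add: keep_def members_def)

lemma I_subset: "I \<subseteq> T" "I_kept \<subseteq> I" "I_solved \<subseteq> I" "B \<subseteq> T"
  by (auto simp: I_def I_kept_def I_solved_def B_def)

lemma I_keep: "(u, v) \<in> I \<Longrightarrow> keep u \<longleftrightarrow> keep v"
  using T_verts[of u v] keep_cong[of u v] by (simp add: I_def)

lemma B_disjoint: "B \<inter> I = {}" "I_kept \<inter> I_solved = {}"
  by (auto simp: B_def I_def I_kept_def I_solved_def)

lemma finite_I: "finite B" "finite I" "finite I_kept" "finite I_solved"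
  using finite_T I_subset by (meson finite_subset)+

text \<open>Without \<open>B\<close> the piece number never increases along arcs, so cycles stay
  within pieces and the kept and solved parts separate. For the solved part balance is enough, since
  by \<open>cyc_bal\<close> all arcs of a finite balanced relation lie on cycles.\<close>

lemma solution_of_parts:
  assumes "A \<subseteq> I_kept" "bal (cyc (I_kept - A))" "F \<subseteq> I_solved" "bal (I_solved - F)"
  shows "B \<union> A \<union> F \<subseteq> T" "bal (cyc (T - (B \<union> A \<union> F)))"
    "card (B \<union> A \<union> F) \<le> card B + card F + card A"
proof -
  show "B \<union> A \<union> F \<subseteq> T" using assms I_subset by blast
  show "card (B \<union> A \<union> F) \<le> card B + card F + card A"
    using card_Un_le[of "B \<union> A" F] card_Un_le[of B A] by simp
  let ?E = "I - (A \<union> F)"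
  have "cyc (T - (B \<union> A \<union> F)) = cyc {(u, v) \<in> T - (B \<union> A \<union> F). piece u = piece v}"
    by (rule cyc_mono_fun) (auto simp: B_def)
  also have "{(u, v) \<in> T - (B \<union> A \<union> F). piece u = piece v} = ?E"
    by (auto simp: I_def B_def)
  finally have cyc: "cyc (T - (B \<union> A \<union> F)) = cyc ?E" .
  have k: "(u, v) \<in> ?E \<Longrightarrow> keep u \<longleftrightarrow> keep v" for u v using I_keep by blast
  have 1: "{(u, v) \<in> ?E. keep u} = I_kept - A"
    using assms by (auto simp: I_kept_def I_solved_def)
  have 2: "{(u, v) \<in> ?E. \<not> keep u} = I_solved - F"
    using assms by (auto simp: I_kept_def I_solved_def)
  have "bal (cyc ?E)"
  proof (rule bal_unrestrict[where P = keep])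
    show "keep u \<longleftrightarrow> keep v" if "(u, v) \<in> cyc ?E" for u v using that k by (auto simp: cyc_def)
    show "bal {(u, v) \<in> cyc ?E. keep u}"
      using assms(2) by (simp only: 1 flip: cyc_restrict[of ?E keep, OF k])
    have "{(u, v) \<in> cyc ?E. \<not> keep u} = cyc (I_solved - F)"
      by (subst cyc_restrict[symmetric]) (use k 2 in auto)
    also have "\<dots> = I_solved - F" using assms(4) finite_I by (intro cyc_bal) auto
    finally show "bal {(u, v) \<in> cyc ?E. \<not> keep u}" using assms(4) by simp
  qed
  then show "bal (cyc (T - (B \<union> A \<union> F)))" by (simp add: cyc)
qed

end

sublocale tournament_solution \<subseteq> tournament_parameter n T k
  by unfold_locales

section \<open>What an arbitrary solution pays for, and how many vertices are kept\<close>

context tournament_solution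
begin

lemma B_subset_A: "B \<subseteq> A"
proof
  fix e assume "e \<in> B"
  then obtain w u where e: "e = (w, u)" "(w, u) \<in> T" "piece w < piece u" by (auto simp: B_def)
  then obtain t where "deg w < t" "t \<le> deg u" "valid t"
    by (auto simp: piece_def cuts_less_iff)
  then have "deg w + k < deg u" using e(2) unfolding valid_def by blast
  then show "e \<in> A" using long_back_arc_in_A e by simp
qed

lemma E_piece: "(u, v) \<in> E \<Longrightarrow> piece v \<le> piece u"
  using B_subset_A by (auto simp: B_def not_less)

lemma cyc_E: "cyc E = cyc (I - A)"
proof -
  have "cyc E = cyc {(u, v) \<in> E. piece u = piece v}"
    by (rule cyc_mono_fun) (rule E_piece)
  also have "{(u, v) \<in> E. piece u = piece v} = I - A" by (auto simp: I_def)
  finally show ?thesis .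
qed

lemma cyc_E_iff: "(u, v) \<in> cyc E \<longleftrightarrow> (u, v) \<in> I \<and> (u, v) \<notin> A \<and> (v, u) \<in> E\<^sup>*"
proof -
  have "(u, v) \<in> I - A" if "(u, v) \<in> cyc E" using that unfolding cyc_E by (simp add: cyc_def)
  then show ?thesis using I_subset by (auto simp: cyc_def)
qed

lemma bal_kept: "bal (cyc (I_kept - A))"
proof -
  have k: "(u, v) \<in> I - A \<Longrightarrow> keep u \<longleftrightarrow> keep v" for u v using I_keep by blast
  have "{(u, v) \<in> I - A. keep u} = I_kept - A" by (auto simp: I_kept_def)
  then have "cyc (I_kept - A) = {(u, v) \<in> cyc (I - A). keep u}"
    using cyc_restrict[of "I - A" keep, OF k] by simp
  moreover have "bal {(u, v) \<in> cyc (I - A). keep u}"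
    by (rule bal_restrict) (use A_bal cyc_E k in \<open>auto simp: cyc_def\<close>)
  ultimately show ?thesis by simp
qed

text \<open>\<open>F\<close> takes the arcs of \<open>A\<close> in solved pieces, except in balanced
  ones, where nothing is to be deleted. An unbalanced solved piece is too large not to be strongly
  connected in \<open>E\<close>; hence its surviving arcs all lie in \<open>cyc E\<close> and
  inherit the balance of \<open>cyc E\<close>. The three numbers count disjoint subsets of
  \<open>A\<close>.\<close>

lemma solved_part:
  obtains F where "F \<subseteq> I_solved" "bal (I_solved - F)" "card B + card F + card (A \<inter> I_kept) \<le> k"
proof
  define F where "F = {(u, v) \<in> A \<inter> I_solved. \<exists>x\<in>members u. \<not> balanced_at x}"
  show "F \<subseteq> I_solved" by (auto simp: F_def)
  have "card B + card F + card (A \<inter> I_kept) = card (B \<union> F) + card (A \<inter> I_kept)"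
    using finite_I B_disjoint I_subset finite_subset[OF \<open>F \<subseteq> I_solved\<close>] \<open>F \<subseteq> I_solved\<close>
    by (subst card_Un_disjoint) auto
  also have "\<dots> = card (B \<union> F \<union> (A \<inter> I_kept))"
    using finite_I B_disjoint I_subset finite_subset[OF \<open>F \<subseteq> I_solved\<close>] \<open>F \<subseteq> I_solved\<close>
    by (subst card_Un_disjoint) auto
  also have "\<dots> \<le> card A" using B_subset_A finite_A by (intro card_mono) (auto simp: F_def)
  finally show "card B + card F + card (A \<inter> I_kept) \<le> k" using A_card by simp
  have "card ((I_solved - F) `` {v}) = card ((I_solved - F)\<inverse> `` {v})" for v
  proof (cases "v < n \<and> \<not> keep v")
    case False
    have "(I_solved - F) `` {v} = {}" "(I_solved - F)\<inverse> `` {v} = {}"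
      using False T_verts I_keep by (auto simp: I_solved_def I_def)
    then show ?thesis by simp
  next
    case v: True
    have m: "members u = members v" if "(u, v) \<in> I \<or> (v, u) \<in> I" for u
      using that by (auto simp: I_def members_def)
    have s: "(v, u) \<in> I_solved \<longleftrightarrow> (v, u) \<in> I" "(u, v) \<in> I_solved \<longleftrightarrow> (u, v) \<in> I" for u
      using v I_keep[of u v] by (auto simp: I_solved_def)
    show ?thesis
    proof (cases "\<forall>x\<in>members v. balanced_at x")
      case True
      then have "(I_solved - F) `` {v} = I `` {v}" "(I_solved - F)\<inverse> `` {v} = I\<inverse> `` {v}"
        using s m by (auto simp: F_def)
      moreover have "balanced_at v" using True v by (simp add: members_def)
      ultimately show ?thesis by (simp add: balanced_at_def)
    next
      case False
      then have large: "\<not> (\<exists>x\<in>members v. \<exists>y\<in>members v. card (members v) + 2 * deg y \<le> 2 * deg x + 4 * k)"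
        using v by (auto simp: keep_def)
      have strong: "(a, b) \<in> E\<^sup>*" if "a \<in> members v" "b \<in> members v" for a b
        using large_strong[of "members v" a b] large that by (auto simp: members_def)
      have vm: "v \<in> members v" using v by (simp add: members_def)
      have "(v, u) \<in> I_solved - F \<longleftrightarrow> (v, u) \<in> cyc E" "(u, v) \<in> I_solved - F \<longleftrightarrow> (u, v) \<in> cyc E" for u
      proof -
        have 1: "(v, u) \<in> I_solved - F \<longleftrightarrow> (v, u) \<in> I - A" "(u, v) \<in> I_solved - F \<longleftrightarrow> (u, v) \<in> I - A"
          using s[of u] m[of u] False by (auto simp: F_def)
        have 2: "u \<in> members v" if "(v, u) \<in> I \<or> (u, v) \<in> I"
          using that T_verts by (auto simp: I_def members_def)
        show "(v, u) \<in> I_solved - F \<longleftrightarrow> (v, u) \<in> cyc E"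
          unfolding 1 cyc_E_iff using 2 strong[OF _ vm, of u] by auto
        show "(u, v) \<in> I_solved - F \<longleftrightarrow> (u, v) \<in> cyc E"
          unfolding 1 cyc_E_iff using 2 strong[OF vm, of u] by auto
      qed
      then have "(I_solved - F) `` {v} = cyc E `` {v}" "(I_solved - F)\<inverse> `` {v} = (cyc E)\<inverse> `` {v}"
        by (simp_all only: set_eq_iff Image_singleton_iff converse_iff simp_thms)
      then show ?thesis using A_bal by (simp add: bal_def)
    qed
  qed
  then show "bal (I_solved - F)" by (simp add: bal_def)
qed

text \<open>No integer in the range is a valid threshold, so each is crossed by a short backward
  arc. Both ends of the arc lie in the piece, and one of them is touched. A touched vertex accounts
  only for thresholds within distance \<open>k\<close> of its out-degree, at most
  \<open>2 * k\<close> of them.\<close>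

lemma deg_range:
  assumes v: "x \<in> members v" "y \<in> members v"
  shows "deg x \<le> deg y + 2 * k * card (touched \<inter> members v)"
proof -
  let ?X = "touched \<inter> members v"
  have fin: "finite ?X" by (simp add: members_def)
  have "{deg y <.. deg x} \<subseteq> (\<Union>z\<in>?X. {deg z + 1 - k .. deg z + k})"
  proof
    fix t assume t: "t \<in> {deg y <.. deg x}"
    have p: "cuts (deg y) = piece v" "cuts (deg x) = piece v"
      using v by (auto simp: members_def piece_def)
    have "\<not> valid t"
    proof
      assume "valid t"
      then have "cuts (deg y) < cuts (deg x)" using t by (auto simp: cuts_less_iff)
      then show False using p by simp
    qed
    then obtain w u where wu: "(w, u) \<in> T" "deg w < t" "t \<le> deg u" "deg u \<le> deg w + k"
      unfolding valid_def by (force simp: not_less)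
    \<comment> \<open>The cut number at \<open>t - 1\<close> lies between those of \<open>w\<close>
      and \<open>u\<close>, which are equal; so this identifies their common piece.\<close>
    have "cuts (t - 1) = piece v"
    proof (rule antisym)
      show "cuts (t - 1) \<le> piece v" using cuts_mono[of "t - 1" "deg x"] p t by auto
      show "piece v \<le> cuts (t - 1)" using cuts_mono[of "deg y" "t - 1"] p t by auto
    qed
    moreover have "cuts (deg w) \<le> cuts (t - 1)" "cuts (t - 1) \<le> cuts (deg u)"
      using wu by (auto intro: cuts_mono)
    moreover have "piece w = piece u" using wu by (intro back_arc_piece) auto
    ultimately have "w \<in> members v" "u \<in> members v"
      using T_verts[OF wu(1)] by (auto simp: members_def piece_def)
    moreover have "w \<in> touched \<or> u \<in> touched" using wu by (intro touched_of_back_arc) auto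
    ultimately have "w \<in> ?X \<or> u \<in> ?X" by blast
    moreover have "t \<in> {deg w + 1 - k .. deg w + k}" "t \<in> {deg u + 1 - k .. deg u + k}" using wu by auto
    ultimately show "t \<in> (\<Union>z\<in>?X. {deg z + 1 - k .. deg z + k})" by blast
  qed
  then have "card {deg y <.. deg x} \<le> card (\<Union>z\<in>?X. {deg z + 1 - k .. deg z + k})"
    using fin by (intro card_mono) auto
  also have "\<dots> \<le> (\<Sum>z\<in>?X. card {deg z + 1 - k .. deg z + k})"
    using fin by (rule card_UN_le)
  also have "\<dots> \<le> (\<Sum>z\<in>?X. 2 * k)" by (rule sum_mono) simp
  finally show ?thesis by (simp add: mult.commute)
qed

text \<open>By \<open>deg_range\<close> an untouched piece has constant out-degree, hence constant
  level. Its vertices are pairwise comparable, and reachability in one direction only would make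
  levels differ. So the piece is strongly connected without losing an arc, and it is balanced, which
  \<open>keep\<close> excludes.\<close>

lemma kept_touched:
  assumes "keep v"
  shows "touched \<inter> members v \<noteq> {}"
proof
  assume X: "touched \<inter> members v = {}"
  have d: "deg x = deg y" if "x \<in> members v" "y \<in> members v" for x y
    using deg_range[OF that] deg_range[OF that(2,1)] X by simp
  have strong: "(x, y) \<in> E\<^sup>*" if xy: "x \<in> members v" "y \<in> members v" for x y
  proof (rule ccontr)
    assume n: "(x, y) \<notin> E\<^sup>*"
    have lt: "x < n" "y < n" and u: "x \<notin> touched" "y \<notin> touched" using xy X by (auto simp: members_def)
    have yx: "(y, x) \<in> E\<^sup>*" using comparable[of x y] n u lt by blast
    have "level x + card {y} \<le> level y"
      using yx n lt by (intro level_gap) (auto simp: R_def)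
    then show False using untouched_level lt u d[OF xy] by simp
  qed
  have "balanced_at x" if x: "x \<in> members v" for x
  proof -
    have u: "x \<notin> touched" using x X by blast
    have "(x, y) \<in> I \<longleftrightarrow> (x, y) \<in> cyc E" "(y, x) \<in> I \<longleftrightarrow> (y, x) \<in> cyc E" for y
    proof -
      have a: "(x, y) \<notin> A" "(y, x) \<notin> A" using u by (force simp: touched_def)+
      have "y \<in> members v" if "(x, y) \<in> I \<or> (y, x) \<in> I"
        using that T_verts x by (auto simp: I_def members_def)
      then show "(x, y) \<in> I \<longleftrightarrow> (x, y) \<in> cyc E" "(y, x) \<in> I \<longleftrightarrow> (y, x) \<in> cyc E"
        unfolding cyc_E_iff using strong[OF x, of y] strong[of y x] x a by auto
    qed
    then have "I `` {x} = cyc E `` {x}" "I\<inverse> `` {x} = (cyc E)\<inverse> `` {x}"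
      by (simp_all only: set_eq_iff Image_singleton_iff converse_iff simp_thms)
    then show ?thesis using A_bal by (simp add: balanced_at_def bal_def)
  qed
  then show False using assms by (auto simp: keep_def)
qed

text \<open>A kept piece with \<open>t\<close> touched vertices has range at most
  \<open>2 * k * t\<close> and thus at most \<open>4 * k * t + 4 * k\<close> vertices, which is at
  most \<open>8 * k * t\<close> because \<open>t\<close> is positive. Pieces are disjoint, so these
  \<open>t\<close> add up to at most \<open>2 * k\<close>.\<close>

lemma card_kept: "card {v. keep v} \<le> 16 * k * k"
proof -
  let ?P = "members ` {v. keep v}"
  have finK: "finite {v. keep v}" by (rule finite_subset[of _ "{..<n}"]) (auto simp: keep_def)
  have fint: "finite touched" using finite_A by (simp add: touched_def)
  have disj: "M \<inter> N = {}" if "M \<in> ?P" "N \<in> ?P" "M \<noteq> N" for M N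
    using that by (auto simp: members_def)
  have M: "card M \<le> 8 * k * card (touched \<inter> M)" if "M \<in> ?P" for M
  proof -
    obtain v where v: "keep v" "M = members v" using \<open>M \<in> ?P\<close> by blast
    then obtain x y where xy: "x \<in> M" "y \<in> M" "card M + 2 * deg y \<le> 2 * deg x + 4 * k"
      by (auto simp: keep_def)
    have "deg x \<le> deg y + 2 * k * card (touched \<inter> M)" using deg_range xy v by blast
    then have "card M \<le> 4 * k * card (touched \<inter> M) + 4 * k" using xy(3) by simp
    moreover have "1 \<le> card (touched \<inter> M)"
      using kept_touched[OF v(1)] v(2) fint by (simp add: Suc_le_eq card_gt_0_iff)
    then have "4 * k * 1 \<le> 4 * k * card (touched \<inter> M)" by (rule mult_le_mono2)
    then have "4 * k \<le> 4 * k * card (touched \<inter> M)" by (simp only: mult_1_right)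
    ultimately have "card M \<le> 4 * k * card (touched \<inter> M) + 4 * k * card (touched \<inter> M)" by linarith
    then show ?thesis by simp
  qed
  have "{v. keep v} \<subseteq> \<Union> ?P" by (auto simp: members_def keep_def)
  then have "card {v. keep v} \<le> card (\<Union> ?P)" using finK by (intro card_mono) (auto simp: members_def)
  also have "\<dots> \<le> (\<Sum>M\<in>?P. card M)" using finK by (intro card_Union_le_sum_card)
  also have "\<dots> \<le> (\<Sum>M\<in>?P. 8 * k * card (touched \<inter> M))" by (intro sum_mono M)
  also have "\<dots> = 8 * k * (\<Sum>M\<in>?P. card (touched \<inter> M))" by (simp add: sum_distrib_left)
  also have "(\<Sum>M\<in>?P. card (touched \<inter> M)) = card (\<Union>M\<in>?P. touched \<inter> M)"
    using disj finK fint by (subst card_UN_disjoint) auto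
  also have "\<dots> \<le> card touched" using fint by (intro card_mono) auto
  finally have "card {v. keep v} \<le> 8 * k * card touched" by simp
  also have "\<dots> \<le> 8 * k * (2 * k)" using card_touched by (intro mult_le_mono2)
  finally show ?thesis by simp
qed

end

section \<open>Balancing an oriented graph by deleting arcs\<close>

text \<open>Starting from the empty set, the iterates of a monotone map increase, and every round
  before the fixed point adds an element of \<open>S\<close>.\<close>

lemma iterate_stable:
  fixes \<Phi> :: "'a set \<Rightarrow> 'a set"
  assumes "mono \<Phi>" and bound: "\<And>X. \<Phi> X \<subseteq> S" and "finite S" "card S \<le> t"
  shows "\<Phi> ((\<Phi> ^^ t) {}) = (\<Phi> ^^ t) {}"
proof -
  define f where "f t = (\<Phi> ^^ t) {}" for t
  have inc: "f t \<subseteq> f (Suc t)" for t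
    by (induction t) (auto simp: f_def dest!: monoD[OF \<open>mono \<Phi>\<close>])
  have fin: "finite (f (Suc t))" for t
    using bound[of "f t"] \<open>finite S\<close> finite_subset by (auto simp: f_def)
  have "f (Suc t) = f t \<or> Suc t \<le> card (f (Suc t))" for t
  proof (induction t)
    case 0
    have "f 0 = {}" by (simp add: f_def)
    moreover have "f (Suc 0) \<noteq> {} \<Longrightarrow> Suc 0 \<le> card (f (Suc 0))"
      using fin[of 0] by (simp add: Suc_le_eq card_gt_0_iff)
    ultimately show ?case by blast
  next
    case (Suc t)
    show ?case
    proof (cases "f (Suc t) = f t")
      case True
      then show ?thesis by (simp add: f_def)
    next
      case False
      with Suc have "Suc t \<le> card (f (Suc t))" by simp
      moreover have "f (Suc (Suc t)) \<noteq> f (Suc t) \<Longrightarrow> card (f (Suc t)) < card (f (Suc (Suc t)))"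
        using inc[of "Suc t"] fin[of "Suc t"] by (intro psubset_card_mono) auto
      ultimately show ?thesis by fastforce
    qed
  qed
  moreover have "card (f (Suc t)) \<le> card S"
    using bound \<open>finite S\<close> by (intro card_mono) (auto simp: f_def)
  ultimately have "f (Suc t) = f t" using \<open>card S \<le> t\<close> by (metis not_less_eq_eq order_trans)
  then show ?thesis by (simp add: f_def)
qed

text \<open>
  Ages count the rounds since a vertex was found to reach \<open>D\<close>; so they increase towards \<open>D\<close>.
\<close>

definition age_step :: "nat \<Rightarrow> (nat \<Rightarrow> bool) \<Rightarrow> (nat \<Rightarrow> nat \<Rightarrow> bool) \<Rightarrow> (nat \<Rightarrow> nat) \<Rightarrow> nat \<Rightarrow> nat" where
  "age_step n D W a v = a v + of_bool (v < n \<and> (D v \<or> (\<exists>w<n. W v w \<and> 0 < a w)))"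

definition age :: "nat \<Rightarrow> (nat \<Rightarrow> bool) \<Rightarrow> (nat \<Rightarrow> nat \<Rightarrow> bool) \<Rightarrow> nat \<Rightarrow> nat \<Rightarrow> nat" where
  "age n D W t = (age_step n D W ^^ t) (\<lambda>_. 0)"

lemma age_0 [simp]: "age n D W 0 v = 0"
  by (simp add: age_def)

lemma age_Suc: "age n D W (Suc t) v = age n D W t v + of_bool (v < n \<and> (D v \<or> (\<exists>w<n. W v w \<and> 0 < age n D W t w)))"
  by (simp add: age_def age_step_def)

lemma age_le: "age n D W t v \<le> t"
  by (induction t) (auto simp: age_Suc)

lemma age_pos_supported:
  "0 < age n D W t v \<Longrightarrow> v < n \<and> (D v \<or> (\<exists>w<n. W v w \<and> 0 < age n D W t w))"
proof (induction t arbitrary: v)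
  case (Suc t)
  show ?case
  proof (cases "0 < age n D W t v")
    case True
    from Suc.IH[OF this] show ?thesis by (auto simp: age_Suc)
  next
    case False
    with Suc.prems have "v < n \<and> (D v \<or> (\<exists>w<n. W v w \<and> 0 < age n D W t w))"
      by (auto simp: age_Suc split: if_splits)
    then show ?thesis by (auto simp: age_Suc)
  qed
qed simp

lemma age_grows: "0 < age n D W t v \<Longrightarrow> age n D W (Suc t) v = age n D W t v + 1"
  using age_pos_supported[of n D W t v] by (simp add: age_Suc)

text \<open>A vertex outside \<open>D\<close> becomes positive only after one of its successors, and
  positive ages all grow by 1 per round, so the successor keeps its lead. Moving to larger ages
  therefore ends in \<open>D\<close>.\<close>

lemma age_next: "0 < age n D W t v \<Longrightarrow> \<not> D v \<Longrightarrow> \<exists>w<n. W v w \<and> age n D W t v < age n D W t w"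
proof (induction t arbitrary: v)
  case (Suc t)
  show ?case
  proof (cases "0 < age n D W t v")
    case True
    from Suc.IH[OF this Suc.prems(2)] obtain w where "w < n" "W v w" "age n D W t v < age n D W t w" by blast
    then show ?thesis using age_grows[OF True] age_grows[of n D W t w] by (intro exI[of _ w]) simp
  next
    case False
    with Suc.prems obtain w where w: "w < n" "W v w" "0 < age n D W t w"
      by (auto simp: age_Suc split: if_splits)
    then show ?thesis using age_grows[OF w(3)] False by (intro exI[of _ w]) (auto simp: age_Suc)
  qed
qed simp

text \<open>The vertices of positive age are the iterates of a monotone operator on sets of
  vertices, so \<open>n\<close> rounds reach its fixed point.\<close>

lemma age_pos_closed:
  assumes "n \<le> t" "v < n" "D v \<or> (\<exists>w<n. W v w \<and> 0 < age n D W t w)"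
  shows "0 < age n D W t v"
proof -
  define \<Phi> where "\<Phi> X = {v. v < n \<and> (D v \<or> (\<exists>w\<in>X. w < n \<and> W v w))}" for X
  have pos: "{v. 0 < age n D W t v} = (\<Phi> ^^ t) {}" for t
  proof (induction t)
    case (Suc t)
    have "{v. 0 < age n D W (Suc t) v} = \<Phi> {v. 0 < age n D W t v}"
      using age_pos_supported[of n D W t] by (auto simp: age_Suc \<Phi>_def)
    then show ?case by (simp add: Suc.IH)
  qed simp
  have "\<Phi> ((\<Phi> ^^ t) {}) = (\<Phi> ^^ t) {}"
    by (rule iterate_stable[where S = "{..<n}"]) (use assms(1) in \<open>auto simp: \<Phi>_def mono_def\<close>)
  then have "\<Phi> {v. 0 < age n D W t v} = {v. 0 < age n D W t v}" by (simp only: pos)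
  moreover have "v \<in> \<Phi> {v. 0 < age n D W t v}" using assms(2,3) by (auto simp: \<Phi>_def)
  ultimately show ?thesis by blast
qed

text \<open>
  Fewest arcs whose deletion balances an oriented graph \<open>G\<close>, by a primal-dual method.
  The residual graph \<open>Q\<close> contains the arcs of \<open>G\<close> not deleted and the reverses of the deleted
  ones; so moving a unit of excess along an arc of \<open>Q\<close> means to reverse that arc.
\<close>

locale oriented_graph =
  fixes n :: nat and G :: "(nat \<times> nat) set"
  assumes G_subset: "G \<subseteq> {..<n} \<times> {..<n}" and G_antisym: "(u, v) \<in> G \<Longrightarrow> (v, u) \<notin> G"
begin

lemma finite_G: "finite G"
  using G_subset finite_subset by blast

lemma G_verts: "(u, v) \<in> G \<Longrightarrow> u < n \<and> v < n"
  using G_subset by auto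

definition residual :: "(nat \<times> nat) set \<Rightarrow> bool" where
  "residual Q \<longleftrightarrow> Q \<subseteq> G \<union> G\<inverse> \<and> (\<forall>(u, v)\<in>G. (u, v) \<in> Q \<longleftrightarrow> (v, u) \<notin> Q)"

text \<open>Deleting an arc costs 1, restoring it costs -1. Feasibility means that all residual arcs
  have nonnegative reduced cost for the potential \<open>p\<close>; \<open>tight\<close> means
  reduced cost 0.\<close>

definition feasible :: "(nat \<times> nat) set \<Rightarrow> (nat \<Rightarrow> nat) \<Rightarrow> bool" where
  "feasible Q p \<longleftrightarrow> (\<forall>(u, v)\<in>Q. ((u, v) \<in> G \<longrightarrow> p v \<le> p u + 1) \<and> ((v, u) \<in> G \<longrightarrow> p v + 1 \<le> p u))"

definition tight :: "(nat \<times> nat) set \<Rightarrow> (nat \<Rightarrow> nat) \<Rightarrow> nat \<Rightarrow> nat \<Rightarrow> bool" where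
  "tight Q p u v \<longleftrightarrow> (u, v) \<in> Q \<and> ((u, v) \<in> G \<and> p v = p u + 1 \<or> (v, u) \<in> G \<and> p v + 1 = p u)"

definition excess :: "(nat \<times> nat) set \<Rightarrow> nat \<Rightarrow> int" where
  "excess Q v = int (card ((G \<inter> Q) `` {v})) - int (card ((G \<inter> Q)\<inverse> `` {v}))"

text \<open>A Lagrangian value: the arcs deleted so far, corrected by the excess still present,
  priced by \<open>p\<close>. Once no excess is left it is the number of deleted arcs.\<close>

definition dual :: "(nat \<times> nat) set \<Rightarrow> (nat \<Rightarrow> nat) \<Rightarrow> int" where
  "dual Q p = int (card (G - Q)) - (\<Sum>v<n. excess Q v * int (p v))"

definition total :: "(nat \<times> nat) set \<Rightarrow> int" where
  "total Q = (\<Sum>v<n. max 0 (excess Q v))"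

definition flip :: "nat \<Rightarrow> nat \<Rightarrow> (nat \<times> nat) set \<Rightarrow> (nat \<times> nat) set" where
  "flip u v Q = insert (v, u) (Q - {(u, v)})"

text \<open>Summation by parts: each arc contributes \<open>f\<close> at its tail and the negative
  of \<open>f\<close> at its head.\<close>

lemma sum_excess:
  assumes "H \<subseteq> G"
  shows "(\<Sum>v<n. (int (card (H `` {v})) - int (card (H\<inverse> `` {v}))) * f v) = (\<Sum>(u, v)\<in>H. f u - f v)"
proof -
  have fin: "finite H" using assms finite_G finite_subset by blast
  have "(\<Sum>(u, v)\<in>H. f u) = (\<Sum>v<n. int (card (H `` {v})) * f v)"
  proof -
    have "H = Sigma {..<n} (\<lambda>u. H `` {u})" using assms G_subset by auto
    then have "(\<Sum>(u, v)\<in>H. f u) = (\<Sum>(u, v)\<in>Sigma {..<n} (\<lambda>u. H `` {u}). f u)" by simp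
    also have "\<dots> = (\<Sum>u<n. \<Sum>v\<in>H `` {u}. f u)"
      using fin by (subst sum.Sigma) (auto intro: finite_subset[of _ "snd ` H"] rev_image_eqI)
    finally show ?thesis by simp
  qed
  moreover have "(\<Sum>(u, v)\<in>H. f v) = (\<Sum>v<n. int (card (H\<inverse> `` {v})) * f v)"
  proof -
    have "(\<Sum>(u, v)\<in>H. f v) = (\<Sum>(v, u)\<in>H\<inverse>. f v)"
      by (rule sum.reindex_bij_witness[of _ prod.swap prod.swap]) auto
    also have "H\<inverse> = Sigma {..<n} (\<lambda>u. H\<inverse> `` {u})" using assms G_subset by auto
    also have "(\<Sum>(u, v)\<in>Sigma {..<n} (\<lambda>u. H\<inverse> `` {u}). f u) = (\<Sum>u<n. \<Sum>v\<in>H\<inverse> `` {u}. f u)"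
      using fin by (subst sum.Sigma) (auto intro: finite_subset[of _ "fst ` H"] rev_image_eqI)
    finally show ?thesis by simp
  qed
  ultimately show ?thesis
    by (simp add: case_prod_beta sum_subtractf left_diff_distrib)
qed

text \<open>Weak duality. With the reduced costs \<open>r\<close>, both sides are the sum of
  \<open>r\<close> over a set of deleted arcs minus the same constant. Feasibility makes
  \<open>r\<close> nonpositive on \<open>G - Q\<close> and nonnegative on the rest of
  \<open>G\<close>, so \<open>G - Q\<close> minimizes this sum over all subsets of
  \<open>G\<close>.\<close>

lemma dual_le:
  assumes res: "residual Q" and fea: "feasible Q p" and F: "F \<subseteq> G" "bal (G - F)"
  shows "dual Q p \<le> int (card F)"
proof -
  define r where "r = (\<lambda>(u, v). 1 + int (p u) - int (p v))"
  have finF: "finite F" using F finite_G finite_subset by blast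
  have split: "int (card (G - H)) - (\<Sum>(u, v)\<in>H. int (p u) - int (p v)) = (\<Sum>e\<in>G - H. r e) - (\<Sum>(u, v)\<in>G. int (p u) - int (p v))"
    if "H \<subseteq> G" for H
  proof -
    have "(\<Sum>e\<in>G - H. r e) = int (card (G - H)) + (\<Sum>(u, v)\<in>G - H. int (p u) - int (p v))"
      by (simp add: r_def case_prod_beta sum.distrib sum_subtractf)
    moreover have "(\<Sum>(u, v)\<in>G. int (p u) - int (p v)) = (\<Sum>(u, v)\<in>G - H. int (p u) - int (p v)) + (\<Sum>(u, v)\<in>H. int (p u) - int (p v))"
      using that finite_G by (rule sum.subset_diff)
    ultimately show ?thesis by simp
  qed
  have "dual Q p = int (card (G - G \<inter> Q)) - (\<Sum>(u, v)\<in>G \<inter> Q. int (p u) - int (p v))"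
    using sum_excess[of "G \<inter> Q" "\<lambda>v. int (p v)"] by (simp add: dual_def excess_def Diff_Int)
  also have "\<dots> = (\<Sum>e\<in>G - Q. r e) - (\<Sum>(u, v)\<in>G. int (p u) - int (p v))"
    by (subst split) (simp_all add: Diff_Int)
  finally have 1: "dual Q p = (\<Sum>e\<in>G - Q. r e) - (\<Sum>(u, v)\<in>G. int (p u) - int (p v))" .
  have "(\<Sum>(u, v)\<in>G - F. int (p u) - int (p v)) = 0"
    using sum_excess[of "G - F" "\<lambda>v. int (p v)"] F(2) by (simp add: bal_def)
  moreover have GF: "G - (G - F) = F" using F(1) by blast
  ultimately have 2: "int (card F) = (\<Sum>e\<in>F. r e) - (\<Sum>(u, v)\<in>G. int (p u) - int (p v))"
    using split[of "G - F"] unfolding GF by simp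
  have neg: "r e \<le> 0" if e: "e \<in> G - Q" for e
  proof -
    obtain u v where uv: "e = (u, v)" "(u, v) \<in> G" "(u, v) \<notin> Q" using e by (cases e) auto
    then have "(v, u) \<in> Q" using res by (auto simp: residual_def)
    then have "p u + 1 \<le> p v" using fea uv by (auto simp: feasible_def)
    then show ?thesis using uv by (simp add: r_def)
  qed
  have pos: "0 \<le> r e" if e: "e \<in> G \<inter> Q" for e
    using fea e by (cases e) (auto simp: feasible_def r_def)
  have "(\<Sum>e\<in>G - Q. r e) \<le> (\<Sum>e\<in>F - Q. r e)"
  proof -
    have "(\<Sum>e\<in>G - Q. r e) = (\<Sum>e\<in>(G - Q) - (F - Q). r e) + (\<Sum>e\<in>F - Q. r e)"
      using F(1) finite_G by (intro sum.subset_diff) auto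
    moreover have "(\<Sum>e\<in>(G - Q) - (F - Q). r e) \<le> 0" by (intro sum_nonpos neg) auto
    ultimately show ?thesis by simp
  qed
  also have "\<dots> \<le> (\<Sum>e\<in>F. r e)"
    using finF pos F(1) by (intro sum_mono2) auto
  finally show ?thesis using 1 2 by simp
qed

lemma optimal:
  assumes "residual Q" "feasible Q p" "\<And>v. v < n \<Longrightarrow> excess Q v = 0"
  shows "bal (G - (G - Q))" "F \<subseteq> G \<Longrightarrow> bal (G - F) \<Longrightarrow> card (G - Q) \<le> card F"
proof -
  have "excess Q v = 0" for v
  proof (cases "v < n")
    case False
    then have "(G \<inter> Q) `` {v} = {}" "(G \<inter> Q)\<inverse> `` {v} = {}" using G_verts by auto
    then show ?thesis by (simp add: excess_def)
  qed (simp add: assms(3))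
  moreover have "G - (G - Q) = G \<inter> Q" by blast
  ultimately show "bal (G - (G - Q))" by (auto simp: bal_def excess_def)
  have "dual Q p = int (card (G - Q))" using assms(3) by (simp add: dual_def)
  then show "card (G - Q) \<le> card F" if "F \<subseteq> G" "bal (G - F)"
    using dual_le[OF assms(1,2) that] by simp
qed

section \<open>Flips of tight arcs and raises of the potential\<close>

lemma sum_excess_zero: "(\<Sum>v<n. excess Q v) = 0"
  using sum_excess[of "G \<inter> Q" "\<lambda>_. 1"] by (simp add: excess_def)

lemma tight_verts:
  assumes "tight Q p u v"
  shows "u < n" "v < n" "u \<noteq> v"
  using assms G_verts G_antisym by (auto simp: tight_def)

text \<open>Reversing a residual arc moves one unit of excess along it, both when an arc of
  \<open>G\<close> is deleted and when a deleted one is restored.\<close>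

lemma excess_flip:
  assumes res: "residual Q" and t: "tight Q p u v"
  shows "excess (flip u v Q) x = excess Q x - of_bool (x = u) + of_bool (x = v)"
proof -
  have uv: "u \<noteq> v" "(u, v) \<in> Q" using tight_verts[OF t] t by (auto simp: tight_def)
  have fin: "finite ((G \<inter> Q) `` X)" "finite ((G \<inter> Q)\<inverse> `` X)" for X
    using finite_G by (auto intro: finite_subset[of _ "snd ` G"] finite_subset[of _ "fst ` G"] rev_image_eqI)
  consider "(u, v) \<in> G" "(v, u) \<notin> G" | "(v, u) \<in> G" "(u, v) \<notin> G" using t G_antisym by (auto simp: tight_def)
  then show ?thesis
  proof cases
    case 1
    then have eq: "G \<inter> flip u v Q = (G \<inter> Q) - {(u, v)}" by (auto simp: flip_def)
    have "(G \<inter> flip u v Q) `` {x} = (G \<inter> Q) `` {x} - (if x = u then {v} else {})"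
      "(G \<inter> flip u v Q)\<inverse> `` {x} = (G \<inter> Q)\<inverse> `` {x} - (if x = v then {u} else {})"
      unfolding eq by auto
    moreover have "v \<in> (G \<inter> Q) `` {u}" "u \<in> (G \<inter> Q)\<inverse> `` {v}" using 1 uv by auto
    moreover have "0 < card ((G \<inter> Q) `` {u})" "0 < card ((G \<inter> Q)\<inverse> `` {v})"
      using calculation fin card_gt_0_iff by blast+
    ultimately show ?thesis using uv fin by (auto simp: excess_def card_Diff_singleton of_nat_diff)
  next
    case 2
    then have "(v, u) \<notin> Q" using res uv by (auto simp: residual_def)
    have eq: "G \<inter> flip u v Q = insert (v, u) (G \<inter> Q)" using 2 by (auto simp: flip_def)
    have "(G \<inter> flip u v Q) `` {x} = (G \<inter> Q) `` {x} \<union> (if x = v then {u} else {})"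
      "(G \<inter> flip u v Q)\<inverse> `` {x} = (G \<inter> Q)\<inverse> `` {x} \<union> (if x = u then {v} else {})"
      unfolding eq by auto
    moreover have "u \<notin> (G \<inter> Q) `` {v}" "v \<notin> (G \<inter> Q)\<inverse> `` {u}" using \<open>(v, u) \<notin> Q\<close> by auto
    ultimately show ?thesis using uv fin by (auto simp: excess_def)
  qed
qed

text \<open>The reverse of a tight arc again has reduced cost 0, which preserves feasibility. In the
  dual value the change of the number of deleted arcs cancels against the price of the moved
  excess.\<close>

lemma flip_props:
  assumes res: "residual Q" and fea: "feasible Q p" and t: "tight Q p u v"
  shows "residual (flip u v Q)" "feasible (flip u v Q) p" "dual (flip u v Q) p = dual Q p"
proof -
  have uv: "u < n" "v < n" "u \<noteq> v" and Q: "(u, v) \<in> Q" using tight_verts[OF t] t by (auto simp: tight_def)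
  then have nQ: "(v, u) \<notin> Q" using res t by (auto simp: residual_def tight_def)
  show "residual (flip u v Q)"
    using res Q nQ uv t G_antisym by (auto simp: residual_def flip_def tight_def)
  show "feasible (flip u v Q) p"
    using fea t G_antisym by (auto simp: feasible_def flip_def tight_def)
  have "(\<Sum>x<n. excess (flip u v Q) x * int (p x)) =
      (\<Sum>x<n. excess Q x * int (p x)) - (\<Sum>x<n. of_bool (x = u) * int (p x)) + (\<Sum>x<n. of_bool (x = v) * int (p x))"
    by (simp add: excess_flip[OF res t] algebra_simps sum.distrib sum_subtractf)
  also have "\<dots> = (\<Sum>x<n. excess Q x * int (p x)) - int (p u) + int (p v)"
    using uv by (simp add: of_bool_def if_distrib[of "\<lambda>a. a * _"] sum.delta cong: if_cong)
  finally have s: "(\<Sum>x<n. excess (flip u v Q) x * int (p x)) = (\<Sum>x<n. excess Q x * int (p x)) - int (p u) + int (p v)" .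
  show "dual (flip u v Q) p = dual Q p"
  proof (cases "(u, v) \<in> G")
    case True
    then have "p v = p u + 1" using t G_antisym by (auto simp: tight_def)
    moreover have "G - flip u v Q = insert (u, v) (G - Q)" using True uv G_antisym by (auto simp: flip_def)
    then have "card (G - flip u v Q) = card (G - Q) + 1" using Q finite_G by simp
    ultimately show ?thesis by (simp add: dual_def s)
  next
    case False
    then have vu: "(v, u) \<in> G" "p v + 1 = p u" using t by (auto simp: tight_def)
    have "G - Q = insert (v, u) (G - flip u v Q)" "(v, u) \<notin> G - flip u v Q"
      using vu nQ False by (auto simp: flip_def)
    then have "card (G - Q) = card (G - flip u v Q) + 1" using finite_G
      by (metis Suc_eq_plus1 card_insert_disjoint finite_Diff)
    then show ?thesis using vu(2) by (simp add: dual_def s)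
  qed
qed

lemma start_props: "residual G" "total G \<le> int (card G)"
proof -
  show "residual G" using G_antisym by (auto simp: residual_def)
  have "total G \<le> (\<Sum>v<n. int (card (G `` {v})))"
    unfolding total_def by (rule sum_mono) (simp add: excess_def)
  also have "\<dots> = int (card {e \<in> G. fst e \<in> {..<n}})"
    using card_eq_sum_Image[OF finite_G, of "{..<n}"] by simp
  also have "{e \<in> G. fst e \<in> {..<n}} = G" using G_subset by auto
  finally show "total G \<le> int (card G)" .
qed

text \<open>\<open>S\<close> will be the set of vertices from which a deficit is reachable along
  tight arcs. No tight arc enters \<open>S\<close> from outside and reduced costs are integers, so
  raising \<open>S\<close> by 1 keeps them nonnegative. All deficits are raised and no positive
  excess is, so the dual value grows.\<close>

lemma raise_props:
  assumes res: "residual Q" and fea: "feasible Q p"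
    and closed: "\<And>u v. tight Q p u v \<Longrightarrow> v \<in> S \<Longrightarrow> u \<in> S"
    and deficit: "\<And>v. v < n \<Longrightarrow> excess Q v < 0 \<Longrightarrow> v \<in> S"
    and no_excess: "\<And>v. v \<in> S \<Longrightarrow> excess Q v \<le> 0"
    and p': "\<And>v. v < n \<Longrightarrow> p' v = p v + of_bool (v \<in> S)"
  shows "feasible Q p'" "0 < total Q \<Longrightarrow> dual Q p < dual Q p'"
proof -
  have verts: "(u, v) \<in> Q \<Longrightarrow> u < n \<and> v < n" for u v using res G_verts by (auto simp: residual_def)
  show "feasible Q p'"
    unfolding feasible_def
  proof (intro ballI, clarify, intro conjI impI)
    fix u v assume uv: "(u, v) \<in> Q"
    { assume G: "(u, v) \<in> G"
      then have "p v \<le> p u + 1" using fea uv by (auto simp: feasible_def)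
      moreover have "v \<in> S \<Longrightarrow> u \<notin> S \<Longrightarrow> p v \<noteq> p u + 1" using closed[of u v] uv G by (auto simp: tight_def)
      ultimately show "p' v \<le> p' u + 1" using p' verts[OF uv] by (cases "v \<in> S"; cases "u \<in> S") auto }
    { assume G: "(v, u) \<in> G"
      then have "p v + 1 \<le> p u" using fea uv by (auto simp: feasible_def)
      moreover have "v \<in> S \<Longrightarrow> u \<notin> S \<Longrightarrow> p v + 1 \<noteq> p u" using closed[of u v] uv G by (auto simp: tight_def)
      ultimately show "p' v + 1 \<le> p' u" using p' verts[OF uv] by (cases "v \<in> S"; cases "u \<in> S") auto }
  qed
  assume pos: "0 < total Q"
  have "\<exists>v<n. excess Q v < 0"
  proof (rule ccontr)
    assume "\<not> ?thesis"
    then have "\<forall>v\<in>{..<n}. 0 \<le> excess Q v" by (meson lessThan_iff linorder_not_less)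
    then have "\<forall>v\<in>{..<n}. excess Q v = 0"
      using sum_nonneg_eq_0_iff[of "{..<n}" "excess Q"] sum_excess_zero by auto
    then have "total Q = 0" by (simp add: total_def)
    then show False using pos by simp
  qed
  then obtain v where v: "v < n" "excess Q v < 0" by blast
  have "(\<Sum>x<n. excess Q x * int (p' x)) = (\<Sum>x<n. excess Q x * int (p x)) + (\<Sum>x<n. excess Q x * of_bool (x \<in> S))"
    unfolding sum.distrib[symmetric] by (rule sum.cong) (simp_all add: p' algebra_simps)
  moreover have "(\<Sum>x<n. excess Q x * of_bool (x \<in> S)) < 0"
  proof -
    have "(\<Sum>x<n. excess Q x * of_bool (x \<in> S)) < (\<Sum>x<n. 0)"
      using v deficit no_excess by (intro sum_strict_mono_ex1) auto
    then show ?thesis by simp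
  qed
  ultimately show "dual Q p < dual Q p'" by (simp add: dual_def)
qed

text \<open>
  A walk along tight arcs with increasing ages: reversing the arcs behind it does not affect the
  arcs in front of it.
\<close>

definition walk_invariant ::
    "(nat \<times> nat) set \<Rightarrow> (nat \<Rightarrow> nat) \<Rightarrow> (nat \<Rightarrow> nat) \<Rightarrow> nat \<Rightarrow> (nat \<times> nat) set \<Rightarrow> nat \<Rightarrow> bool" where
  "walk_invariant Q p h s Q' c \<longleftrightarrow> residual Q' \<and> feasible Q' p \<and> dual Q' p = dual Q p \<and> c < n \<and> 0 < h c \<and>
     (\<forall>x. excess Q' x = excess Q x - of_bool (x = s) + of_bool (x = c)) \<and>
     (\<forall>u v. h c \<le> h u \<longrightarrow> h u < h v \<longrightarrow> (u, v) \<in> Q \<longrightarrow> (u, v) \<in> Q')"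

lemma walk_start:
  "residual Q \<Longrightarrow> feasible Q p \<Longrightarrow> s < n \<Longrightarrow> 0 < h s \<Longrightarrow> walk_invariant Q p h s Q s"
  by (simp add: walk_invariant_def)

lemma walk_step:
  assumes inv: "walk_invariant Q p h s Q' c" and t: "tight Q p c w" "h c < h w"
  shows "walk_invariant Q p h s (flip c w Q') w"
proof -
  have t': "tight Q' p c w" using inv t by (auto simp: walk_invariant_def tight_def)
  have i: "residual Q'" "feasible Q' p" "dual Q' p = dual Q p"
    "\<And>x. excess Q' x = excess Q x - of_bool (x = s) + of_bool (x = c)"
    "\<And>u v. h c \<le> h u \<Longrightarrow> h u < h v \<Longrightarrow> (u, v) \<in> Q \<Longrightarrow> (u, v) \<in> Q'"
    using inv by (auto simp: walk_invariant_def)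
  have "excess (flip c w Q') x = excess Q x - of_bool (x = s) + of_bool (x = w)" for x
    unfolding excess_flip[OF i(1) t'] i(4) using tight_verts[OF t'] by (auto simp: of_bool_def)
  \<comment> \<open>The flip removes only an arc that leaves \<open>c\<close>, and the age of
    \<open>c\<close> is smaller than all ages considered from now on.\<close>
  moreover have "(u, v) \<in> flip c w Q'" if "h w \<le> h u" "h u < h v" "(u, v) \<in> Q" for u v
    using i(5)[of u v] that t(2) by (auto simp: flip_def)
  ultimately show ?thesis
    using flip_props[OF i(1,2) t'] tight_verts[OF t'] t(2) i(3) by (simp add: walk_invariant_def)
qed

text \<open>The unit leaves a vertex of positive excess and ends at a deficit, where the positive
  part of the excess remains 0.\<close>

lemma walk_end:
  assumes "walk_invariant Q p h s Q' c" "excess Q c < 0" "0 < excess Q s" "s < n"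
  shows "total Q' < total Q"
proof -
  have "c < n" and ex: "excess Q' x = excess Q x - of_bool (x = s) + of_bool (x = c)" for x
    using assms(1) by (auto simp: walk_invariant_def)
  have "s \<noteq> c" using assms by auto
  have "(\<Sum>v<n. max 0 (excess Q' v)) < (\<Sum>v<n. max 0 (excess Q v))"
  proof (rule sum_strict_mono_ex1)
    show "\<forall>x\<in>{..<n}. max 0 (excess Q' x) \<le> max 0 (excess Q x)"
      using assms(2) by (auto simp: ex of_bool_def)
    show "\<exists>x\<in>{..<n}. max 0 (excess Q' x) < max 0 (excess Q x)"
      using assms(3,4) \<open>s \<noteq> c\<close> by (intro bexI[of _ s]) (auto simp: ex)
  qed simp
  then show ?thesis by (simp add: total_def)
qed

end

section \<open>The kernelization program\<close>

text \<open>Vectors occupy row 0 and scalars entry (0, 0). As \<open>upd\<close> fills whole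
  matrices, the functions that compute vectors and scalars mostly ignore the respective
  indices.\<close>

abbreviation vec :: "memory \<Rightarrow> nat \<Rightarrow> nat \<Rightarrow> nat" where
  "vec m a \<equiv> mat m a 0"

abbreviation scal :: "memory \<Rightarrow> nat \<Rightarrow> nat" where
  "scal m a \<equiv> mat m a 0 0"

text \<open>The search is a sum with at most one nonzero term, so \<open>computable_sum\<close>
  applies to it. Without a witness the value is 0.\<close>

definition least_below :: "nat \<Rightarrow> (nat \<Rightarrow> bool) \<Rightarrow> nat" where
  "least_below L P = (\<Sum>v<L. if P v \<and> (\<forall>u<L. u < v \<longrightarrow> \<not> P u) then v else 0)"

lemma least_below:
  assumes "\<exists>v<L. P v"
  shows "P (least_below L P)" "least_below L P < L"
proof -
  define l where "l = (LEAST v. P v)"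
  obtain v where v: "v < L" "P v" using assms by blast
  have "P l" unfolding l_def using v(2) by (rule LeastI)
  moreover have "l < L" unfolding l_def using Least_le[of P v, OF v(2)] v(1) by (rule le_less_trans)
  ultimately have l: "P l" "l < L" by simp_all
  have below: "\<not> P u" if "u < l" for u using that unfolding l_def by (rule not_less_Least)
  have eq: "P v \<and> (\<forall>u<L. u < v \<longrightarrow> \<not> P u) \<longleftrightarrow> v = l" if "v < L" for v
  proof
    assume v: "P v \<and> (\<forall>u<L. u < v \<longrightarrow> \<not> P u)"
    then have "\<not> v < l" using below by blast
    moreover have "\<not> l < v" using v l by blast
    ultimately show "v = l" by simp
  next
    assume "v = l"
    then show "P v \<and> (\<forall>u<L. u < v \<longrightarrow> \<not> P u)" using l(1) below by simp
  qed
  have "least_below L P = (\<Sum>v<L. if v = l then v else 0)"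
    unfolding least_below_def by (rule sum.cong) (simp_all only: lessThan_iff eq)
  also have "\<dots> = l" using l by (simp add: sum.delta)
  finally show "P (least_below L P)" "least_below L P < L" using l by auto
qed

text \<open>
  Banks 10 to 19 hold the number of vertices, the parameter (cut off at the square of the former),
  the adjacency matrix, out-degrees, valid thresholds, pieces, the arcs within pieces, unbalanced
  vertices, kept vertices and the arcs within pieces that are not kept. Banks 20 to 27 hold the
  residual graph, the potential, tight arcs, deficit and excess vertices, ages, successors along
  the walk and its current vertex. Banks 30 to 32 hold the number of arcs deleted outside the
  kernel, the number of kept vertices and their ranks.
\<close>

definition g_n :: "memory \<Rightarrow> nat \<Rightarrow> nat \<Rightarrow> nat" where
  "g_n m i j = (\<Sum>w<cap m. of_bool (mulc m (Suc w) (Suc w) \<le> m 0 0))"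

definition g_k :: "memory \<Rightarrow> nat \<Rightarrow> nat \<Rightarrow> nat" where
  "g_k m i j = (if m 0 1 \<le> m 0 0 then m 0 1 else m 0 0)"

definition g_T :: "memory \<Rightarrow> nat \<Rightarrow> nat \<Rightarrow> nat" where
  "g_T m i j = of_bool (i < scal m 10 \<and> j < scal m 10 \<and> m 1 (mulc m i (scal m 10) + j) \<noteq> 0)"

definition g_deg :: "memory \<Rightarrow> nat \<Rightarrow> nat \<Rightarrow> nat" where
  "g_deg m i j = (\<Sum>w<cap m. of_bool (mat m 12 j w \<noteq> 0))"

definition g_valid :: "memory \<Rightarrow> nat \<Rightarrow> nat \<Rightarrow> nat" where
  "g_valid m i j = of_bool (\<forall>w<cap m. \<forall>u<cap m. mat m 12 w u \<noteq> 0 \<and> vec m 13 w < j \<and> j \<le> vec m 13 u \<longrightarrow>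
     vec m 13 w + scal m 11 < vec m 13 u)"

definition g_piece :: "memory \<Rightarrow> nat \<Rightarrow> nat \<Rightarrow> nat" where
  "g_piece m i j = (\<Sum>t<cap m. of_bool (0 < t \<and> t \<le> vec m 13 j \<and> vec m 14 t \<noteq> 0))"

definition g_I :: "memory \<Rightarrow> nat \<Rightarrow> nat \<Rightarrow> nat" where
  "g_I m i j = of_bool (mat m 12 i j \<noteq> 0 \<and> vec m 15 i = vec m 15 j)"

definition g_unbalanced :: "memory \<Rightarrow> nat \<Rightarrow> nat \<Rightarrow> nat" where
  "g_unbalanced m i j = of_bool ((\<Sum>w<cap m. of_bool (mat m 16 j w \<noteq> 0)) \<noteq> (\<Sum>w<cap m. of_bool (mat m 16 w j \<noteq> 0) :: nat))"

definition member :: "memory \<Rightarrow> nat \<Rightarrow> nat \<Rightarrow> bool" where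
  "member m v u \<longleftrightarrow> u < scal m 10 \<and> vec m 15 u = vec m 15 v"

definition g_keep :: "memory \<Rightarrow> nat \<Rightarrow> nat \<Rightarrow> nat" where
  "g_keep m i j = of_bool (j < scal m 10 \<and> (\<exists>u<cap m. member m j u \<and> vec m 17 u \<noteq> 0) \<and>
     (\<exists>x<cap m. member m j x \<and> (\<exists>y<cap m. member m j y \<and>
       (\<Sum>u<cap m. of_bool (member m j u)) + (vec m 13 y + vec m 13 y) \<le>
         vec m 13 x + vec m 13 x + (scal m 11 + scal m 11 + scal m 11 + scal m 11))))"

definition g_G :: "memory \<Rightarrow> nat \<Rightarrow> nat \<Rightarrow> nat" where
  "g_G m i j = of_bool (mat m 16 i j \<noteq> 0 \<and> vec m 18 i = 0)"

definition prepare :: "memory \<Rightarrow> memory" where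
  "prepare m = upd 19 g_G (upd 18 g_keep (upd 17 g_unbalanced (upd 16 g_I (upd 15 g_piece
     (upd 14 g_valid (upd 13 g_deg (upd 12 g_T (upd 11 g_k (upd 10 g_n m)))))))))"

definition g_tight :: "memory \<Rightarrow> nat \<Rightarrow> nat \<Rightarrow> nat" where
  "g_tight m i j = of_bool (mat m 20 i j \<noteq> 0 \<and>
     (mat m 19 i j \<noteq> 0 \<and> vec m 21 j = vec m 21 i + 1 \<or> mat m 19 j i \<noteq> 0 \<and> vec m 21 j + 1 = vec m 21 i))"

definition out_count :: "memory \<Rightarrow> nat \<Rightarrow> nat" where
  "out_count m v = (\<Sum>w<cap m. of_bool (mat m 19 v w \<noteq> 0 \<and> mat m 20 v w \<noteq> 0))"

definition in_count :: "memory \<Rightarrow> nat \<Rightarrow> nat" where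
  "in_count m v = (\<Sum>w<cap m. of_bool (mat m 19 w v \<noteq> 0 \<and> mat m 20 w v \<noteq> 0))"

definition g_deficit :: "memory \<Rightarrow> nat \<Rightarrow> nat \<Rightarrow> nat" where
  "g_deficit m i j = of_bool (j < scal m 10 \<and> out_count m j < in_count m j)"

definition g_excess :: "memory \<Rightarrow> nat \<Rightarrow> nat \<Rightarrow> nat" where
  "g_excess m i j = of_bool (j < scal m 10 \<and> in_count m j < out_count m j)"

definition g_age :: "memory \<Rightarrow> nat \<Rightarrow> nat \<Rightarrow> nat" where
  "g_age m i j = vec m 25 j + of_bool (j < scal m 10 \<and>
     (vec m 23 j \<noteq> 0 \<or> (\<exists>w<cap m. w < scal m 10 \<and> mat m 22 j w \<noteq> 0 \<and> 0 < vec m 25 w)))"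

definition g_next :: "memory \<Rightarrow> nat \<Rightarrow> nat \<Rightarrow> nat" where
  "g_next m i j = least_below (cap m) (\<lambda>w. mat m 22 j w \<noteq> 0 \<and> vec m 25 j < vec m 25 w)"

definition g_cur :: "memory \<Rightarrow> nat \<Rightarrow> nat \<Rightarrow> nat" where
  "g_cur m i j = least_below (cap m) (\<lambda>v. vec m 24 v \<noteq> 0 \<and> 0 < vec m 25 v)"

text \<open>At a deficit vertex the walk rests, here and in \<open>g_move\<close>, so that a fixed
  number of rounds can be executed. Elsewhere the arc to the chosen successor is flipped.\<close>

definition g_walk :: "memory \<Rightarrow> nat \<Rightarrow> nat \<Rightarrow> nat" where
  "g_walk m i j = (if vec m 23 (scal m 27) \<noteq> 0 then mat m 20 i j
     else if i = scal m 27 \<and> j = vec m 26 (scal m 27) then 0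
     else if j = scal m 27 \<and> i = vec m 26 (scal m 27) then 1 else mat m 20 i j)"

definition g_move :: "memory \<Rightarrow> nat \<Rightarrow> nat \<Rightarrow> nat" where
  "g_move m i j = (if vec m 23 (scal m 27) \<noteq> 0 then scal m 27 else vec m 26 (scal m 27))"

definition g_raise :: "memory \<Rightarrow> nat \<Rightarrow> nat \<Rightarrow> nat" where
  "g_raise m i j = vec m 21 j + of_bool (0 < vec m 25 j)"

definition ages :: "memory \<Rightarrow> memory" where
  "ages m = (upd 25 g_age ^^ cap m) m"

definition search :: "memory \<Rightarrow> memory" where
  "search m = upd 27 g_cur (upd 26 g_next (ages (upd 25 (\<lambda>m i j. 0) (upd 24 g_excess
     (upd 23 g_deficit (upd 22 g_tight m))))))"

definition walk :: "memory \<Rightarrow> memory" where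
  "walk m = ((\<lambda>m. upd 27 g_move (upd 20 g_walk m)) ^^ cap m) m"

definition phase :: "memory \<Rightarrow> memory" where
  "phase m = (let m' = search m in
     if \<exists>v<cap m'. vec m' 24 v \<noteq> 0 \<and> 0 < vec m' 25 v then walk m' else upd 21 g_raise m')"

text \<open>Initially no arc is deleted and all prices are 0. As long as excess remains, each phase
  lowers \<open>potential\<close>, which starts at no more than twice the number of arcs; the
  capacity is chosen accordingly.\<close>

definition solve :: "memory \<Rightarrow> memory" where
  "solve m = (let m' = upd 21 (\<lambda>m i j. 0) (upd 20 (\<lambda>m. mat m 19) m) in (phase ^^ cap m') m')"

definition g_cost :: "memory \<Rightarrow> nat \<Rightarrow> nat \<Rightarrow> nat" where
  "g_cost m i j = (\<Sum>u<cap m. \<Sum>v<cap m. of_bool (mat m 12 u v \<noteq> 0 \<and> vec m 15 u < vec m 15 v)) +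
     (\<Sum>u<cap m. \<Sum>v<cap m. of_bool (mat m 19 u v \<noteq> 0 \<and> mat m 20 u v = 0))"

definition g_count :: "memory \<Rightarrow> nat \<Rightarrow> nat \<Rightarrow> nat" where
  "g_count m i j = (\<Sum>v<cap m. of_bool (vec m 18 v \<noteq> 0))"

definition g_rank :: "memory \<Rightarrow> nat \<Rightarrow> nat \<Rightarrow> nat" where
  "g_rank m i j = (\<Sum>v<cap m. of_bool (v < j \<and> vec m 18 v \<noteq> 0))"

definition quadruple :: "nat \<Rightarrow> nat" where
  "quadruple x = x + x + (x + x)"

definition small :: "memory \<Rightarrow> bool" where
  "small m \<longleftrightarrow> scal m 30 \<le> scal m 11 \<and>
     scal m 31 \<le> quadruple (mulc m (scal m 11) (quadruple (scal m 11) + 2))"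

text \<open>When the bounds are exceeded, the output is the matrix of \<open>no_instance\<close>:
  with rows of length 4 its arcs have positions 1, 2, 6, 7, 11 and 12.\<close>

definition g_bits :: "memory \<Rightarrow> nat \<Rightarrow> nat \<Rightarrow> nat" where
  "g_bits m i j = of_bool (if small m then
       \<exists>u<cap m. \<exists>v<cap m. vec m 18 u \<noteq> 0 \<and> vec m 18 v \<noteq> 0 \<and>
         (mat m 16 u v \<noteq> 0 \<or> vec m 15 v < vec m 15 u) \<and>
         mulc m (vec m 32 u) (scal m 31) + vec m 32 v = j
     else j = 1 \<or> j = 2 \<or> j = 6 \<or> j = 7 \<or> j = 11 \<or> j = 12)"

definition g_header :: "memory \<Rightarrow> nat \<Rightarrow> nat \<Rightarrow> nat" where
  "g_header m i j = (if j = 0 then if small m then mulc m (scal m 31) (scal m 31) else 16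
     else if small m then scal m 11 - scal m 30 else 0)"

definition emit :: "memory \<Rightarrow> memory" where
  "emit m = upd 0 g_header (upd 1 g_bits (upd 32 g_rank (upd 31 g_count (upd 30 g_cost m))))"

definition kernel_program :: "memory \<Rightarrow> memory" where
  "kernel_program m = emit (solve (prepare m))"

section \<open>The kernelization program is a command\<close>

lemma decidable_if:
  assumes "decidable xs P" "decidable xs Q" "decidable xs R"
  shows "decidable xs (\<lambda>m e. if P m e then Q m e else R m e)"
proof -
  have "(\<lambda>m e. if P m e then Q m e else R m e) = (\<lambda>m e. P m e \<and> Q m e \<or> \<not> P m e \<and> R m e)"
    by (intro ext) simp
  then show ?thesis by (simp only:) (intro decidable_disj decidable_conj decidable_not assms)
qed

lemmas computable_intros = computable_rules decidable_if

lemmas g_defs = g_n_def g_k_def g_T_def g_deg_def g_valid_def g_piece_def g_I_def g_unbalanced_def g_keep_def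
  g_G_def g_tight_def g_deficit_def g_excess_def g_age_def g_next_def g_cur_def g_walk_def g_move_def
  g_raise_def g_cost_def g_count_def g_rank_def g_bits_def g_header_def
  least_below_def mulc_def member_def in_count_def out_count_def small_def quadruple_def


lemma cmd_skip: "cmd (\<lambda>m. m)"
proof (rule cmdI[where c = "\<lambda>d. Skip" and T = "\<lambda>_. 1"])
  show "\<exists>t s'. runs Skip s t s' \<and> t \<le> 1 \<and> agree s' m \<and> cap m = cap m \<and> (\<forall>i<d. s' 4 i = s 4 i)"
    if "agree s m" for d m s
    by (rule exI[of _ 1], rule exI[of _ s], intro conjI runs.Skip) (use that in simp_all)
qed (rule poly_bounded_const)

lemma cmd_upd_comp:
  assumes "cmd (upd a g)" "cmd F"
  shows "cmd (\<lambda>m. upd a g (F m))"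
  using assms(2,1) by (rule cmd_comp)

text \<open>The time bound follows from the form of the definitions alone: all right-hand sides are
  built from operations covered by \<open>computable_intros\<close>.\<close>

lemma cmd_g:
  assumes "a \<notin> {2, 3, 4, 5}"
  shows "cmd (upd a g_n)" "cmd (upd a g_k)" "cmd (upd a g_T)" "cmd (upd a g_deg)"
    "cmd (upd a g_valid)" "cmd (upd a g_piece)" "cmd (upd a g_I)" "cmd (upd a g_unbalanced)"
    "cmd (upd a g_keep)" "cmd (upd a g_G)" "cmd (upd a g_tight)" "cmd (upd a g_deficit)"
    "cmd (upd a g_excess)" "cmd (upd a g_age)" "cmd (upd a g_next)" "cmd (upd a g_cur)"
    "cmd (upd a g_walk)" "cmd (upd a g_move)" "cmd (upd a g_raise)" "cmd (upd a g_cost)"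
    "cmd (upd a g_count)" "cmd (upd a g_rank)" "cmd (upd a g_bits)" "cmd (upd a g_header)"
    "cmd (upd a (\<lambda>m i j. 0))" "cmd (upd a (\<lambda>m. mat m 19))"
  unfolding g_defs[abs_def]
  by (rule cmd_upd[OF _ assms]; (rule computable_intros | (rule computable_var, simp; fail) | (simp; fail))+)+

lemma cmd_phase: "cmd phase"
proof -
  have ages: "cmd ages" unfolding ages_def[abs_def] by (intro cmd_repeat cmd_g) simp
  have search: "cmd search"
    unfolding search_def[abs_def]
    by (rule cmd_upd_comp, (rule cmd_g; simp))+ (rule cmd_comp[OF _ ages], (rule cmd_upd_comp, (rule cmd_g; simp))+, rule cmd_skip)
  have w: "cmd walk"
    unfolding walk_def[abs_def] by (rule cmd_repeat, (rule cmd_upd_comp, (rule cmd_g; simp))+, rule cmd_skip)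
  have d: "decidable [] (\<lambda>m e. \<exists>v<cap m. vec m 24 v \<noteq> 0 \<and> 0 < vec m 25 v)"
    by (rule computable_intros | (rule computable_var, simp; fail) | (simp; fail))+
  have r: "cmd (upd 21 g_raise)" by (rule cmd_g) simp
  have "cmd (\<lambda>m. if \<exists>v<cap m. vec m 24 v \<noteq> 0 \<and> 0 < vec m 25 v then walk m else upd 21 g_raise m)"
    using d w r by (rule cmd_if)
  from cmd_comp[OF search this] show ?thesis by (simp only: phase_def[abs_def] Let_def)
qed

lemma cmd_kernel_program: "cmd kernel_program"
proof -
  have "cmd prepare"
    unfolding prepare_def[abs_def] by ((rule cmd_upd_comp, (rule cmd_g; simp))+, rule cmd_skip)
  moreover have "cmd solve"
    unfolding solve_def[abs_def] Let_def
    by (rule cmd_comp[OF _ cmd_repeat[OF cmd_phase]], (rule cmd_upd_comp, (rule cmd_g; simp))+, rule cmd_skip)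
  moreover have "cmd emit"
    unfolding emit_def[abs_def] by ((rule cmd_upd_comp, (rule cmd_g; simp))+, rule cmd_skip)
  ultimately have "cmd (\<lambda>m. emit (solve (prepare m)))"
    using cmd_comp[of "\<lambda>m. solve (prepare m)" emit] cmd_comp[of prepare solve] by (simp only: simp_thms)
  then show ?thesis by (simp only: kernel_program_def[abs_def])
qed

section \<open>Contents of the prepared banks\<close>

lemma mat_upd_same [simp]: "a \<noteq> 2 \<Longrightarrow> i < cap m \<Longrightarrow> j < cap m \<Longrightarrow> mat (upd a g m) a i j = g m i j"
  by (simp add: mat_upd)

lemma mat_upd_other [simp]: "b \<noteq> a \<Longrightarrow> a \<noteq> 2 \<Longrightarrow> mat (upd a g m) b = mat m b"
  by (simp add: mat_def fun_eq_iff upd_other)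

declare upd_other [simp]

lemma sum_of_bool_card:
  fixes L :: nat
  assumes "\<And>w. P w \<Longrightarrow> w < L"
  shows "(\<Sum>w<L. of_bool (P w)) = card {w. P w}"
proof -
  have "{..<L} \<inter> Collect P = {w. P w}" using assms by auto
  then show ?thesis by simp
qed

lemma sum_cong_lessThan: "(\<And>w. w < L \<Longrightarrow> f w = g w) \<Longrightarrow> (\<Sum>w<L. f w) = (\<Sum>w<(L::nat). g w)"
  by (rule sum.cong) simp_all

lemma sum_of_bool_card2:
  fixes L :: nat
  assumes "R \<subseteq> {..<L} \<times> {..<L}"
  shows "(\<Sum>u<L. \<Sum>v<L. of_bool ((u, v) \<in> R)) = card R"
proof -
  have fin: "finite R" using assms finite_subset by blast
  have "(\<Sum>u<L. \<Sum>v<L. of_bool ((u, v) \<in> R)) = (\<Sum>u<L. card (R `` {u}))"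
  proof (rule sum_cong_lessThan)
    fix u
    have "(\<Sum>v<L. of_bool ((u, v) \<in> R)) = card {v. (u, v) \<in> R}"
      using assms by (intro sum_of_bool_card) auto
    then show "(\<Sum>v<L. of_bool ((u, v) \<in> R)) = card (R `` {u})" by (simp add: Image_singleton)
  qed
  also have "\<dots> = card {e \<in> R. fst e \<in> {..<L}}" using fin by (rule card_eq_sum_Image[symmetric]) simp
  also have "{e \<in> R. fst e \<in> {..<L}} = R" using assms by auto
  finally show ?thesis .
qed

text \<open>The number of vertices is recovered as the square root of the input length: the square
  of \<open>w + 1\<close> is at most \<open>n * n\<close> for exactly \<open>n\<close> values of
  \<open>w\<close>.\<close>

lemma g_n:
  assumes "m 0 0 = n * n" "n < cap m"
  shows "g_n m i j = n"
proof -
  have "g_n m i j = (\<Sum>w<cap m. of_bool (w < n))"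
    unfolding g_n_def assms(1)
  proof (rule sum_cong_lessThan)
    fix w assume "w < cap m"
    then have "mulc m (Suc w) (Suc w) = Suc w * Suc w" by (intro mulc) simp
    moreover have "Suc w * Suc w \<le> n * n \<longleftrightarrow> w < n"
      using power2_nat_le_eq_le[of "Suc w" n] by (simp only: power2_eq_square Suc_le_eq)
    ultimately show "of_bool (mulc m (Suc w) (Suc w) \<le> n * n) = (of_bool (w < n) :: nat)" by simp
  qed
  also have "\<dots> = card {w. w < n}" using assms(2) by (intro sum_of_bool_card) simp
  finally show ?thesis by simp
qed

text \<open>The function that fills a bank reads only banks of smaller number, so later updates do
  not change its value. This lets \<open>prepare_fix\<close> describe every bank in terms of the
  final memory, without the intermediate states.\<close>

lemma g_cong:
  assumes "\<And>b. b < a \<Longrightarrow> m b = m' b"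
  shows "10 = a \<Longrightarrow> g_n m = g_n m'"
    "11 = a \<Longrightarrow> g_k m = g_k m'"
    "12 = a \<Longrightarrow> g_T m = g_T m'"
    "13 = a \<Longrightarrow> g_deg m = g_deg m'"
    "14 = a \<Longrightarrow> g_valid m = g_valid m'"
    "15 = a \<Longrightarrow> g_piece m = g_piece m'"
    "16 = a \<Longrightarrow> g_I m = g_I m'"
    "17 = a \<Longrightarrow> g_unbalanced m = g_unbalanced m'"
    "18 = a \<Longrightarrow> g_keep m = g_keep m'"
    "19 = a \<Longrightarrow> g_G m = g_G m'"
  using assms
  by (simp_all add: fun_eq_iff g_n_def g_k_def g_T_def g_deg_def g_valid_def g_piece_def g_I_def
      g_unbalanced_def g_keep_def g_G_def mulc_def member_def mat_def cap_def)

lemma prepare_fix: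
  assumes "i < cap m" "j < cap m"
  shows "mat (prepare m) 10 i j = g_n (prepare m) i j"
    "mat (prepare m) 11 i j = g_k (prepare m) i j"
    "mat (prepare m) 12 i j = g_T (prepare m) i j"
    "mat (prepare m) 13 i j = g_deg (prepare m) i j"
    "mat (prepare m) 14 i j = g_valid (prepare m) i j"
    "mat (prepare m) 15 i j = g_piece (prepare m) i j"
    "mat (prepare m) 16 i j = g_I (prepare m) i j"
    "mat (prepare m) 17 i j = g_unbalanced (prepare m) i j"
    "mat (prepare m) 18 i j = g_keep (prepare m) i j"
    "mat (prepare m) 19 i j = g_G (prepare m) i j"
proof -
  have "g_n (m) = g_n (prepare m)"
    by (rule g_cong(1)[OF _ refl]) (simp add: prepare_def)
  then show "mat (prepare m) 10 i j = g_n (prepare m) i j"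
    using assms by (simp add: prepare_def)
  have "g_k (upd 10 g_n m) = g_k (prepare m)"
    by (rule g_cong(2)[OF _ refl]) (simp add: prepare_def)
  then show "mat (prepare m) 11 i j = g_k (prepare m) i j"
    using assms by (simp add: prepare_def)
  have "g_T (upd 11 g_k (upd 10 g_n m)) = g_T (prepare m)"
    by (rule g_cong(3)[OF _ refl]) (simp add: prepare_def)
  then show "mat (prepare m) 12 i j = g_T (prepare m) i j"
    using assms by (simp add: prepare_def)
  have "g_deg (upd 12 g_T (upd 11 g_k (upd 10 g_n m))) = g_deg (prepare m)"
    by (rule g_cong(4)[OF _ refl]) (simp add: prepare_def)
  then show "mat (prepare m) 13 i j = g_deg (prepare m) i j"
    using assms by (simp add: prepare_def)
  have "g_valid (upd 13 g_deg (upd 12 g_T (upd 11 g_k (upd 10 g_n m)))) = g_valid (prepare m)"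
    by (rule g_cong(5)[OF _ refl]) (simp add: prepare_def)
  then show "mat (prepare m) 14 i j = g_valid (prepare m) i j"
    using assms by (simp add: prepare_def)
  have "g_piece (upd 14 g_valid (upd 13 g_deg (upd 12 g_T (upd 11 g_k (upd 10 g_n m))))) = g_piece (prepare m)"
    by (rule g_cong(6)[OF _ refl]) (simp add: prepare_def)
  then show "mat (prepare m) 15 i j = g_piece (prepare m) i j"
    using assms by (simp add: prepare_def)
  have "g_I (upd 15 g_piece (upd 14 g_valid (upd 13 g_deg (upd 12 g_T (upd 11 g_k (upd 10 g_n m)))))) = g_I (prepare m)"
    by (rule g_cong(7)[OF _ refl]) (simp add: prepare_def)
  then show "mat (prepare m) 16 i j = g_I (prepare m) i j"
    using assms by (simp add: prepare_def)
  have "g_unbalanced (upd 16 g_I (upd 15 g_piece (upd 14 g_valid (upd 13 g_deg (upd 12 g_T (upd 11 g_k (upd 10 g_n m))))))) = g_unbalanced (prepare m)"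
    by (rule g_cong(8)[OF _ refl]) (simp add: prepare_def)
  then show "mat (prepare m) 17 i j = g_unbalanced (prepare m) i j"
    using assms by (simp add: prepare_def)
  have "g_keep (upd 17 g_unbalanced (upd 16 g_I (upd 15 g_piece (upd 14 g_valid (upd 13 g_deg (upd 12 g_T (upd 11 g_k (upd 10 g_n m)))))))) = g_keep (prepare m)"
    by (rule g_cong(9)[OF _ refl]) (simp add: prepare_def)
  then show "mat (prepare m) 18 i j = g_keep (prepare m) i j"
    using assms by (simp add: prepare_def)
  have "g_G (upd 18 g_keep (upd 17 g_unbalanced (upd 16 g_I (upd 15 g_piece (upd 14 g_valid (upd 13 g_deg (upd 12 g_T (upd 11 g_k (upd 10 g_n m))))))))) = g_G (prepare m)"
    by (rule g_cong(10)[OF _ refl]) (simp add: prepare_def)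
  then show "mat (prepare m) 19 i j = g_G (prepare m) i j"
    using assms by (simp add: prepare_def)
qed

lemma prepare_frame: "cap (prepare m) = cap m" "b < 10 \<Longrightarrow> prepare m b = m b"
  by (simp_all add: prepare_def)

text \<open>The capacity exceeds the number of vertices and the truncated parameter, grants
  \<open>solve\<close> at least two rounds per arc, and leaves room for the 16 entries of the fixed
  no-instance.\<close>

definition represents :: "memory \<Rightarrow> nat \<Rightarrow> (nat \<times> nat) set \<Rightarrow> nat \<Rightarrow> bool" where
  "represents m n T k \<longleftrightarrow> m 0 0 = n * n \<and> m 0 1 = k \<and> cap m = 2 * (n * n) + 20 \<and>
     (\<forall>i<n. \<forall>j<n. m 1 (i * n + j) \<noteq> 0 \<longleftrightarrow> (i, j) \<in> T)"

context tournament_parameter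
begin

definition prepared :: "memory \<Rightarrow> bool" where
  "prepared M \<longleftrightarrow> cap M = 2 * (n * n) + 20 \<and> scal M 10 = n \<and> scal M 11 = k \<and>
     (\<forall>i<cap M. \<forall>j<cap M. mat M 12 i j = of_bool ((i, j) \<in> T)) \<and>
     (\<forall>v<cap M. vec M 15 v = piece v) \<and>
     (\<forall>i<cap M. \<forall>j<cap M. mat M 16 i j = of_bool ((i, j) \<in> I)) \<and>
     (\<forall>v<cap M. vec M 18 v = of_bool (keep v)) \<and>
     (\<forall>i<cap M. \<forall>j<cap M. mat M 19 i j = of_bool ((i, j) \<in> I_solved))"

lemma deg_le: "deg v \<le> n"
proof -
  have "deg v \<le> card {..<n}" unfolding deg_def by (rule card_mono) (use T_verts in auto)
  then show ?thesis by simp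
qed

lemma prepared_prepare:
  assumes rep: "represents m n T k'" and k: "k = min k' (n * n)"
  shows "prepared (prepare m)"
proof -
  define M where "M = prepare m"
  define L where "L = cap M"
  have L: "L = 2 * (n * n) + 20" "cap M = L" "cap m = L"
    using rep by (simp_all add: L_def M_def prepare_frame represents_def)
  have nL: "n < L"
    by (cases n) (auto simp: L)
  have M01: "M 0 = m 0" "M (Suc 0) = m (Suc 0)" by (simp_all add: M_def prepare_frame)
  note fix' = prepare_fix[of _ m, folded M_def, unfolded L(3)]
  have L0: "0 < L" using nL by simp
  have n: "scal M 10 = n" using rep nL L0 by (simp add: fix'(1) g_n M01 L represents_def)
  have k': "scal M 11 = k" using rep L0 by (simp add: fix'(2) g_k_def M01 k represents_def min_def)
  have T: "mat M 12 i j = of_bool ((i, j) \<in> T)" if "i < L" "j < L" for i j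
  proof -
    have "mulc M i n = i * n" using that by (intro mulc) (simp add: L)
    then show ?thesis using that rep T_verts by (auto simp: fix'(3) g_T_def n M01 represents_def)
  qed
  have deg: "vec M 13 v = deg v" if "v < L" for v
  proof -
    have "vec M 13 v = (\<Sum>w<L. of_bool ((v, w) \<in> T))"
      using that L0 by (simp add: fix'(4) g_deg_def L T cong: sum.cong_simp)
    also have "\<dots> = card {w. (v, w) \<in> T}" using T_verts nL by (intro sum_of_bool_card) force
    finally show ?thesis by (simp add: deg_def Image_singleton)
  qed
  have valid: "vec M 14 t = of_bool (valid t)" if "t < L" for t
  proof -
    have "vec M 14 t = of_bool (\<forall>w<L. \<forall>u<L. (w, u) \<in> T \<and> deg w < t \<and> t \<le> deg u \<longrightarrow> deg w + k < deg u)"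
      using that L0 by (simp add: fix'(5) g_valid_def L T deg k' cong: conj_cong)
    moreover have "w < L \<and> u < L" if "(w, u) \<in> T" for w u using T_verts[OF that] nL by auto
    ultimately show ?thesis unfolding valid_def by (auto simp: of_bool_def)
  qed
  have piece: "vec M 15 v = piece v" if "v < L" for v
  proof -
    have "vec M 15 v = (\<Sum>t<L. of_bool (0 < t \<and> t \<le> deg v \<and> valid t))"
      using that L0 by (simp add: fix'(6) g_piece_def L deg valid cong: sum.cong_simp)
    also have "\<dots> = card {t. 0 < t \<and> t \<le> deg v \<and> valid t}"
      using deg_le[of v] nL by (intro sum_of_bool_card) simp
    finally show ?thesis by (simp add: piece_def cuts_def)
  qed
  have I: "mat M 16 i j = of_bool ((i, j) \<in> I)" if "i < L" "j < L" for i j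
    using that by (simp add: fix'(7) g_I_def T piece I_def)
  have unb: "vec M 17 v = of_bool (\<not> balanced_at v)" if "v < L" for v
  proof -
    have Iv: "u < L \<and> w < L" if "(u, w) \<in> I" for u w using that T_verts nL by (force simp: I_def)
    have "(\<Sum>w<L. of_bool ((v, w) \<in> I)) = card {w. (v, w) \<in> I}" using Iv by (intro sum_of_bool_card) auto
    moreover have "(\<Sum>w<L. of_bool ((w, v) \<in> I)) = card {w. (w, v) \<in> I}" using Iv by (intro sum_of_bool_card) auto
    moreover have "vec M 17 v = of_bool ((\<Sum>w<L. of_bool ((v, w) \<in> I)) \<noteq> (\<Sum>w<L. of_bool ((w, v) \<in> I) :: nat))"
      using that L0 by (simp add: fix'(8) g_unbalanced_def L I cong: sum.cong_simp)
    ultimately show ?thesis by (simp add: balanced_at_def Image_singleton converse_unfold)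
  qed
  have mem: "member M v u \<longleftrightarrow> u \<in> members v" if "v < L" "u < L" for u v
    using that by (simp add: member_def members_def n piece)
  have memL: "u < L" if "u \<in> members v" for u v using that nL by (simp add: members_def)
  have keep: "vec M 18 v = of_bool (keep v)" if v: "v < L" for v
  proof -
    have "(\<Sum>u<L. of_bool (member M v u)) = (\<Sum>u<L. of_bool (u \<in> members v))"
      using v mem by (intro sum_cong_lessThan) simp
    also have "\<dots> = card {u. u \<in> members v}" using memL by (intro sum_of_bool_card)
    finally have c: "(\<Sum>u<L. of_bool (member M v u)) = card (members v)" by simp
    have ex: "(\<exists>x<L. member M v x \<and> P x) \<longleftrightarrow> (\<exists>x\<in>members v. P x)" for P
      using mem[OF v] memL by blast
    have 1: "(\<exists>u<L. member M v u \<and> vec M 17 u \<noteq> 0) \<longleftrightarrow> (\<exists>u\<in>members v. \<not> balanced_at u)"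
      unfolding ex using unb memL by (intro bex_cong) auto
    have 2: "(\<exists>x<L. member M v x \<and> (\<exists>y<L. member M v y \<and>
       card (members v) + (vec M 13 y + vec M 13 y) \<le> vec M 13 x + vec M 13 x + (k + k + k + k))) \<longleftrightarrow>
       (\<exists>x\<in>members v. \<exists>y\<in>members v. card (members v) + 2 * deg y \<le> 2 * deg x + 4 * k)"
      unfolding ex using deg memL by (intro bex_cong) auto
    have "vec M 18 v = of_bool (v < n \<and> (\<exists>u<L. member M v u \<and> vec M 17 u \<noteq> 0) \<and>
      (\<exists>x<L. member M v x \<and> (\<exists>y<L. member M v y \<and>
       card (members v) + (vec M 13 y + vec M 13 y) \<le> vec M 13 x + vec M 13 x + (k + k + k + k))))"
      using v L0 by (simp only: fix'(9) g_keep_def L(2) n k' c)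
    then show ?thesis unfolding 1 2 keep_def .
  qed
  have "mat M 19 i j = of_bool ((i, j) \<in> I_solved)" if "i < L" "j < L" for i j
    using that by (simp add: fix'(10) g_G_def I keep I_solved_def)
  then show ?thesis
    unfolding prepared_def M_def[symmetric] using L n k' T piece I keep by simp
qed

end

section \<open>Correctness of the kernelization program\<close>

lemma funpow_upd_frame: "b \<noteq> a \<Longrightarrow> (upd a g ^^ t) m b = m b"
  by (induction t) auto

lemma funpow_upd_cap: "a \<noteq> 2 \<Longrightarrow> cap ((upd a g ^^ t) m) = cap m"
  by (induction t) auto

lemma ages_frame: "b \<noteq> 25 \<Longrightarrow> ages m b = m b" "cap (ages m) = cap m"
  by (simp_all add: ages_def funpow_upd_frame funpow_upd_cap)

lemma mat_cong: "m a = m' a \<Longrightarrow> cap m = cap m' \<Longrightarrow> mat m a = mat m' a"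
  by (simp add: mat_def fun_eq_iff)

lemma search_frame:
  "b < 22 \<Longrightarrow> search m b = m b" "cap (search m) = cap m"
  by (simp_all add: search_def ages_frame)

lemma mat_search_frame: "b < 22 \<Longrightarrow> mat (search m) b = mat m b"
  by (intro mat_cong search_frame)

section \<open>Phases of the primal-dual method in memory\<close>

context oriented_graph
begin

definition base :: "memory \<Rightarrow> bool" where
  "base m \<longleftrightarrow> n < cap m \<and> 2 * card G \<le> cap m \<and> scal m 10 = n \<and>
     (\<forall>i<cap m. \<forall>j<cap m. mat m 19 i j = of_bool ((i, j) \<in> G))"

definition Q_of :: "memory \<Rightarrow> (nat \<times> nat) set" where
  "Q_of m = {(i, j). i < n \<and> j < n \<and> mat m 20 i j \<noteq> 0}"

lemma Q_of_cong: "mat m 20 = mat m' 20 \<Longrightarrow> Q_of m = Q_of m'"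
  by (simp add: Q_of_def)

lemma base_cong:
  assumes "\<And>b. b < 20 \<Longrightarrow> m' b = m b"
  shows "base m' \<longleftrightarrow> base m"
proof -
  have c: "cap m' = cap m" using assms[of 2] by (simp add: cap_def)
  then have "mat m' b = mat m b" if "b < 20" for b using that assms by (intro mat_cong) auto
  then show ?thesis by (simp add: base_def c)
qed

abbreviation deficit :: "(nat \<times> nat) set \<Rightarrow> nat \<Rightarrow> bool" where
  "deficit Q v \<equiv> v < n \<and> excess Q v < 0"

abbreviation ages_of :: "memory \<Rightarrow> nat \<Rightarrow> nat" where
  "ages_of m \<equiv> age n (deficit (Q_of m)) (tight (Q_of m) (vec m 21)) (cap m)"

text \<open>Each bank is computed from banks that are already final, so its value can be determined
  in the state right after its own update. Only bank 25 is iterated, and it follows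
  \<open>age\<close> round by round.\<close>

lemma search_spec:
  assumes base: "base m"
  shows "v < cap m \<Longrightarrow> vec (search m) 23 v = of_bool (deficit (Q_of m) v)"
    and "v < cap m \<Longrightarrow> vec (search m) 24 v = of_bool (v < n \<and> 0 < excess (Q_of m) v)"
    and "v < cap m \<Longrightarrow> vec (search m) 25 v = ages_of m v"
    and "v < cap m \<Longrightarrow> vec (search m) 26 v =
       least_below (cap m) (\<lambda>w. w < cap m \<and> tight (Q_of m) (vec m 21) v w \<and> ages_of m v < ages_of m w)"
    and "scal (search m) 27 = least_below (cap m) (\<lambda>v. v < n \<and> 0 < excess (Q_of m) v \<and> 0 < ages_of m v)"
proof -
  let ?L = "cap m" and ?Q = "Q_of m" and ?p = "vec m 21"
  have nL: "n < ?L" and n: "scal m 10 = n"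
    and G: "\<And>i j. i < ?L \<Longrightarrow> j < ?L \<Longrightarrow> mat m 19 i j = of_bool ((i, j) \<in> G)"
    using base by (auto simp: base_def)
  have GL: "i < ?L \<and> j < ?L" if "(i, j) \<in> G" for i j using G_verts[OF that] nL by simp
  have GQ: "mat m 19 i j \<noteq> 0 \<and> mat m 20 i j \<noteq> 0 \<longleftrightarrow> (i, j) \<in> G \<inter> ?Q" if "i < ?L" "j < ?L" for i j
    using G[OF that] G_verts by (auto simp: Q_of_def)
  define m1 where "m1 = upd 22 g_tight m"
  define m2 where "m2 = upd 23 g_deficit m1"
  define m3 where "m3 = upd 24 g_excess m2"
  define m4 where "m4 = upd 25 (\<lambda>m i j. 0) m3"
  define m5 where "m5 = ages m4"
  define m6 where "m6 = upd 26 g_next m5"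
  have m7: "search m = upd 27 g_cur m6" by (simp add: search_def m1_def m2_def m3_def m4_def m5_def m6_def)
  have c: "cap m1 = ?L" "cap m2 = ?L" "cap m3 = ?L" "cap m4 = ?L" "cap m5 = ?L" "cap m6 = ?L"
    by (simp_all add: m1_def m2_def m3_def m4_def m5_def m6_def ages_frame)
  have mats: "mat m2 b = mat m1 b" "mat m1 b = mat m b" if "b < 22" for b
    using that by (simp_all add: m1_def m2_def)
  have out: "out_count m1 v = card ((G \<inter> ?Q) `` {v})" "out_count m2 v = card ((G \<inter> ?Q) `` {v})"
    and inn: "in_count m1 v = card ((G \<inter> ?Q)\<inverse> `` {v})" "in_count m2 v = card ((G \<inter> ?Q)\<inverse> `` {v})" if v: "v < ?L" for v
  proof -
    have "out_count m1 v = (\<Sum>w<?L. of_bool ((v, w) \<in> G \<inter> ?Q))"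
      unfolding out_count_def c mats[of 19, simplified] mats[of 20, simplified] using GQ v by (intro sum_cong_lessThan) simp
    also have "\<dots> = card {w. (v, w) \<in> G \<inter> ?Q}" using GL by (intro sum_of_bool_card) auto
    finally show 1: "out_count m1 v = card ((G \<inter> ?Q) `` {v})" by (simp add: Image_singleton)
    have "in_count m1 v = (\<Sum>w<?L. of_bool ((w, v) \<in> G \<inter> ?Q))"
      unfolding in_count_def c mats[of 19, simplified] mats[of 20, simplified] using GQ v by (intro sum_cong_lessThan) simp
    also have "\<dots> = card {w. (w, v) \<in> G \<inter> ?Q}" using GL by (intro sum_of_bool_card) auto
    finally show 2: "in_count m1 v = card ((G \<inter> ?Q)\<inverse> `` {v})" by (simp add: Image_singleton converse_unfold)
    have "out_count m2 v = out_count m1 v" "in_count m2 v = in_count m1 v"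
      unfolding out_count_def in_count_def c by (simp_all add: mats)
    then show "out_count m2 v = card ((G \<inter> ?Q) `` {v})" "in_count m2 v = card ((G \<inter> ?Q)\<inverse> `` {v})"
      using 1 2 by simp_all
  qed
  have t1: "mat m1 22 u v = of_bool (tight ?Q ?p u v)" if "u < ?L" "v < ?L" for u v
    using that G G_verts by (auto simp: m1_def g_tight_def tight_def Q_of_def)
  have d2: "vec m2 23 v = of_bool (deficit ?Q v)" if "v < ?L" for v
    using that out(1)[OF that] inn(1)[OF that] by (auto simp: m2_def c g_deficit_def mats n excess_def)
  have e3: "vec m3 24 v = of_bool (v < n \<and> 0 < excess ?Q v)" if "v < ?L" for v
    using that out(2)[OF that] inn(2)[OF that] by (auto simp: m3_def c g_excess_def mats n excess_def)
  have m4: "mat m4 22 = mat m1 22" "mat m4 23 = mat m2 23" "mat m4 24 = mat m3 24" "scal m4 10 = n"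
    by (simp_all add: m4_def m3_def m2_def m1_def n)
  have age: "vec ((upd 25 g_age ^^ t) m4) 25 v = age n (deficit ?Q) (tight ?Q ?p) t v" if "v < ?L" for v t
    using that
  proof (induction t arbitrary: v)
    case 0
    then show ?case by (simp add: m4_def c)
  next
    case (Suc t)
    let ?a = "(upd 25 g_age ^^ t) m4"
    have ca: "cap ?a = ?L" by (simp add: funpow_upd_cap c)
    have fr: "mat ?a b = mat m4 b" if "b \<noteq> 25" for b
      using that by (intro mat_cong) (simp_all add: funpow_upd_frame funpow_upd_cap)
    have ex: "(\<exists>w<?L. w < n \<and> mat ?a 22 v w \<noteq> 0 \<and> 0 < vec ?a 25 w) \<longleftrightarrow>
        (\<exists>w<n. tight ?Q ?p v w \<and> 0 < age n (deficit ?Q) (tight ?Q ?p) t w)"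
      using Suc.IH t1 nL Suc.prems by (auto simp: fr m4 intro: less_trans)
    have "vec ((upd 25 g_age ^^ Suc t) m4) 25 v = g_age ?a 0 v" using Suc.prems nL by (simp add: ca)
    also have "\<dots> = age n (deficit ?Q) (tight ?Q ?p) (Suc t) v"
      unfolding g_age_def[of ?a] ca ex[folded fr[of 22, simplified]] fr[of 23, simplified] fr[of 10, simplified] m4 Suc.IH[OF Suc.prems]
      using Suc.prems ex by (simp add: d2 age_Suc fr m4)
    finally show ?case .
  qed
  have age5: "vec m5 25 v = ages_of m v" if "v < ?L" for v
    using age[OF that, of ?L] by (simp add: m5_def ages_def c)
  have m5: "mat m5 22 = mat m1 22" "mat m5 23 = mat m2 23" "mat m5 24 = mat m3 24"
    using m4 by (simp_all add: m5_def mat_cong[OF ages_frame(1)] ages_frame(2))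
  show "v < ?L \<Longrightarrow> vec (search m) 23 v = of_bool (deficit ?Q v)"
    by (simp add: m7 m6_def m5 d2)
  show "v < ?L \<Longrightarrow> vec (search m) 24 v = of_bool (v < n \<and> 0 < excess ?Q v)"
    by (simp add: m7 m6_def m5 e3)
  show "v < ?L \<Longrightarrow> vec (search m) 25 v = ages_of m v"
    by (simp add: m7 m6_def age5)
  have least_cong: "least_below L P = least_below L P'" if "\<And>w. w < L \<Longrightarrow> P w \<longleftrightarrow> P' w" for L P P'
    unfolding least_below_def using that by (intro sum_cong_lessThan) (simp cong: conj_cong)
  show "vec (search m) 26 v = least_below ?L (\<lambda>w. w < ?L \<and> tight ?Q ?p v w \<and> ages_of m v < ages_of m w)"
    if "v < ?L"
  proof -
    have "vec (search m) 26 v = g_next m5 0 v" using that nL by (simp add: m7 m6_def c)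
    also have "\<dots> = least_below ?L (\<lambda>w. w < ?L \<and> tight ?Q ?p v w \<and> ages_of m v < ages_of m w)"
      unfolding g_next_def c by (rule least_cong) (use that in \<open>simp add: m5 t1 age5\<close>)
    finally show ?thesis .
  qed
  have "scal (search m) 27 = g_cur m6 0 0" using nL by (simp add: m7 c)
  also have "\<dots> = least_below ?L (\<lambda>v. v < n \<and> 0 < excess ?Q v \<and> 0 < ages_of m v)"
    unfolding g_cur_def c by (rule least_cong) (simp add: m6_def m5 e3 age5)
  finally show "scal (search m) 27 = least_below ?L (\<lambda>v. v < n \<and> 0 < excess ?Q v \<and> 0 < ages_of m v)" .
qed


lemma walk_frame:
  "b \<noteq> 20 \<Longrightarrow> b \<noteq> 27 \<Longrightarrow> ((\<lambda>m. upd 27 g_move (upd 20 g_walk m)) ^^ t) m b = m b"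
  "cap (((\<lambda>m. upd 27 g_move (upd 20 g_walk m)) ^^ t) m) = cap m"
  by (induction t) auto

text \<open>After \<open>t\<close> rounds the walk has arrived at a deficit or stands at a vertex of
  age greater than \<open>t\<close>. Ages do not exceed \<open>cap m\<close>, so
  \<open>cap m\<close> rounds lead to a deficit.\<close>

lemma walk_spec:
  assumes base: "base m" and res: "residual (Q_of m)" and fea: "feasible (Q_of m) (vec m 21)"
    and ex: "\<exists>v<n. 0 < excess (Q_of m) v \<and> 0 < ages_of m v"
  defines "m' \<equiv> walk (search m)"
  shows "residual (Q_of m')" "feasible (Q_of m') (vec m 21)" "dual (Q_of m') (vec m 21) = dual (Q_of m) (vec m 21)"
    "total (Q_of m') < total (Q_of m)"
proof -
  define L Q p h where "L = cap m" and "Q = Q_of m" and "p = vec m 21" and "h = ages_of m"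
  define M where "M t = ((\<lambda>m. upd 27 g_move (upd 20 g_walk m)) ^^ t) (search m)" for t
  have nL: "n < L" using base by (simp add: base_def L_def)
  have h: "h = age n (deficit Q) (tight Q p) L" by (simp add: h_def Q_def p_def L_def)
  have cap: "cap (M t) = L" for t by (simp add: M_def walk_frame search_frame L_def)
  have fr: "mat (M t) b = mat (search m) b" if "b \<noteq> 20" "b \<noteq> 27" for t b
    using that by (intro mat_cong) (simp_all add: M_def walk_frame)
  define s where "s = scal (search m) 27"
  have "\<exists>v<L. v < n \<and> 0 < excess Q v \<and> 0 < h v"
    using ex nL by (auto simp: Q_def h_def L_def intro: less_trans)
  from least_below(1)[OF this] have s: "s < n" "0 < excess Q s" "0 < h s"
    using search_spec(5)[OF base] by (auto simp: s_def Q_def h_def L_def)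
  have main: "walk_invariant Q p h s (Q_of (M t)) (scal (M t) 27) \<and> (excess Q (scal (M t) 27) < 0 \<or> t < h (scal (M t) 27))" for t
  proof (induction t)
    case 0
    have "Q_of (M 0) = Q"
      by (simp add: M_def Q_def Q_of_def mat_search_frame)
    then show ?case
      using walk_start[of Q p s h] res fea s by (simp add: M_def Q_def p_def flip: s_def)
  next
    case (Suc t)
    define c where "c = scal (M t) 27"
    have inv: "walk_invariant Q p h s (Q_of (M t)) c" and prog: "excess Q c < 0 \<or> t < h c"
      using Suc by (simp_all add: c_def)
    have c: "c < n" "0 < h c" using inv by (auto simp: walk_invariant_def)
    have MS: "M (Suc t) = upd 27 g_move (upd 20 g_walk (M t))" by (simp add: M_def)
    have d: "vec (M t) 23 c = of_bool (deficit Q c)"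
      using c nL search_spec(1)[OF base, of c] by (simp add: fr Q_def L_def)
    have cur: "scal (M (Suc t)) 27 = g_move (M t) 0 0"
      unfolding MS using nL by (simp add: cap g_move_def)
    have Q': "Q_of (M (Suc t)) = {(i, j). i < n \<and> j < n \<and> g_walk (M t) i j \<noteq> 0}"
      unfolding MS Q_of_def using nL by (auto simp: cap)
    show ?case
    proof (cases "excess Q c < 0")
      case True
      then have "vec (M t) 23 c \<noteq> 0" using d c by simp
      then have "scal (M (Suc t)) 27 = c" "Q_of (M (Suc t)) = Q_of (M t)"
        unfolding cur Q' g_move_def g_walk_def c_def[symmetric] by (simp_all add: Q_of_def)
      then show ?thesis using inv True by simp
    next
      case False
      then have d0: "vec (M t) 23 c = 0" using d by simp
      define w where "w = vec (M t) 26 c"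
      have "\<exists>w<n. tight Q p c w \<and> h c < h w"
        unfolding h by (rule age_next) (use c False h in auto)
      then have "\<exists>w<L. w < L \<and> tight Q p c w \<and> h c < h w" using nL by (meson less_trans)
      from least_below(1)[OF this] have w: "tight Q p c w" "h c < h w"
        using search_spec(4)[OF base, of c] c nL by (auto simp: w_def fr Q_def p_def h_def L_def)
      have wn: "w < n" "c \<noteq> w" using tight_verts[OF w(1)] by auto
      have "scal (M (Suc t)) 27 = w"
        unfolding cur g_move_def c_def[symmetric] d0 w_def by simp
      moreover have "{(i, j). i < n \<and> j < n \<and> g_walk (M t) i j \<noteq> 0} = flip c w (Q_of (M t))"
        unfolding g_walk_def c_def[symmetric] d0 w_def[symmetric] flip_def Q_of_def using c wn by auto
      then have "Q_of (M (Suc t)) = flip c w (Q_of (M t))" by (simp only: Q')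
      ultimately show ?thesis
        using walk_step[OF inv w] w(2) prog False by simp
    qed
  qed
  define c where "c = scal (M L) 27"
  have m': "m' = M L" by (simp add: m'_def walk_def M_def search_frame L_def)
  have inv: "walk_invariant Q p h s (Q_of m') c" and "excess Q c < 0 \<or> L < h c"
    using main[of L] by (simp_all add: c_def m')
  moreover have "h c \<le> L" unfolding h by (rule age_le)
  ultimately have "excess Q c < 0" by simp
  then show "total (Q_of m') < total (Q_of m)"
    using walk_end[OF inv _ s(2,1)] by (simp add: Q_def)
  show "residual (Q_of m')" "feasible (Q_of m') (vec m 21)" "dual (Q_of m') (vec m 21) = dual (Q_of m) (vec m 21)"
    using inv by (auto simp: walk_invariant_def Q_def p_def)
qed

text \<open>The distance of the dual value from its upper bound \<open>card G\<close>, plus the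
  excess left. A walk lowers the second summand at constant dual value; a raise lowers the first one
  and keeps the residual graph.\<close>

definition potential :: "memory \<Rightarrow> nat" where
  "potential m = nat (int (card G) - dual (Q_of m) (vec m 21)) + nat (total (Q_of m))"

definition state_ok :: "memory \<Rightarrow> bool" where
  "state_ok m \<longleftrightarrow> base m \<and> residual (Q_of m) \<and> feasible (Q_of m) (vec m 21)"

lemma dual_le_card: "state_ok m \<Longrightarrow> dual (Q_of m) (vec m 21) \<le> int (card G)"
  using dual_le[of "Q_of m" "vec m 21" G] by (simp add: state_ok_def)

lemma total_nonneg: "0 \<le> total Q"
  by (simp add: total_def sum_nonneg)

lemma phase_frame: "b < 20 \<Longrightarrow> phase m b = m b"
  by (simp add: phase_def Let_def walk_def walk_frame search_frame)

lemma phase_spec: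
  assumes ok: "state_ok m"
  shows "state_ok (phase m)" "0 < total (Q_of m) \<Longrightarrow> potential (phase m) < potential m"
    "total (Q_of m) = 0 \<Longrightarrow> total (Q_of (phase m)) = 0"
proof -
  have base: "base m" and res: "residual (Q_of m)" and fea: "feasible (Q_of m) (vec m 21)"
    using ok by (auto simp: state_ok_def)
  have nL: "n < cap m" using base by (simp add: base_def)
  have base': "base (phase m)" using base base_cong[of "phase m" m] phase_frame by blast
  let ?ex = "\<exists>v<n. 0 < excess (Q_of m) v \<and> 0 < ages_of m v"
  have test: "(\<exists>v<cap (search m). vec (search m) 24 v \<noteq> 0 \<and> 0 < vec (search m) 25 v) \<longleftrightarrow> ?ex"
  proof -
    have "vec (search m) 24 v \<noteq> 0 \<and> 0 < vec (search m) 25 v \<longleftrightarrow> v < n \<and> 0 < excess (Q_of m) v \<and> 0 < ages_of m v"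
      if "v < cap m" for v using search_spec(2,3)[OF base that] by auto
    then show ?thesis using nL unfolding search_frame by (meson less_trans)
  qed
  have "state_ok (phase m) \<and> (0 < total (Q_of m) \<longrightarrow> potential (phase m) < potential m) \<and>
    (total (Q_of m) = 0 \<longrightarrow> total (Q_of (phase m)) = 0)"
  proof (cases ?ex)
    case True
    then have ph: "phase m = walk (search m)" unfolding phase_def Let_def test by (rule if_P)
    note w = walk_spec[OF base res fea True, folded ph]
    have "mat (phase m) 21 = mat (search m) 21"
      unfolding ph walk_def by (rule mat_cong) (simp_all add: walk_frame)
    then have p: "vec (phase m) 21 = vec m 21" by (simp add: mat_search_frame)
    show ?thesis
      using w base' total_nonneg[of "Q_of (phase m)"] by (simp add: state_ok_def potential_def p)
  next
    case False
    then have ph: "phase m = upd 21 g_raise (search m)" unfolding phase_def Let_def test by (rule if_not_P)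
    have Q: "Q_of (phase m) = Q_of m" unfolding ph by (rule Q_of_cong) (simp add: mat_search_frame)
    let ?S = "{v. 0 < ages_of m v}"
    have p: "vec (phase m) 21 v = vec m 21 v + of_bool (v \<in> ?S)" if "v < n" for v
      using that nL search_spec(3)[OF base, of v] unfolding ph
      by (simp add: search_frame g_raise_def mat_search_frame)
    have closed: "u \<in> ?S" if "tight (Q_of m) (vec m 21) u v" "v \<in> ?S" for u v
      using age_pos_closed[of n "cap m" u "deficit (Q_of m)" "tight (Q_of m) (vec m 21)"] nL tight_verts[OF that(1)] that
      by auto
    have def: "v \<in> ?S" if "v < n" "excess (Q_of m) v < 0" for v
      using age_pos_closed[of n "cap m" v "deficit (Q_of m)" "tight (Q_of m) (vec m 21)"] nL that by auto
    have noex: "excess (Q_of m) v \<le> 0" if "v \<in> ?S" for v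
      using False that age_pos_supported[of n "deficit (Q_of m)" "tight (Q_of m) (vec m 21)" "cap m" v]
      by (meson linorder_not_less mem_Collect_eq)
    have "feasible (Q_of m) (vec (phase m) 21)"
      by (rule raise_props(1)[OF res fea, of ?S]) (fact closed def noex p)+
    then have ok': "state_ok (phase m)" using base' res by (simp add: state_ok_def Q)
    moreover have "potential (phase m) < potential m" if "0 < total (Q_of m)"
    proof -
      have "dual (Q_of m) (vec m 21) < dual (Q_of m) (vec (phase m) 21)"
        by (rule raise_props(2)[OF res fea, of ?S]) (fact closed def noex p that)+
      then show ?thesis using dual_le_card[OF ok'] by (simp add: potential_def Q)
    qed
    ultimately show ?thesis by (simp add: Q)
  qed
  then show "state_ok (phase m)" "0 < total (Q_of m) \<Longrightarrow> potential (phase m) < potential m"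
    "total (Q_of m) = 0 \<Longrightarrow> total (Q_of (phase m)) = 0" by auto
qed

text \<open>Without positive excess there are no deficits either, since all excesses sum to
  0.\<close>

lemma total_zero: "total Q = 0 \<Longrightarrow> v < n \<Longrightarrow> excess Q v = 0"
proof -
  assume t: "total Q = 0" and v: "v < n"
  have "\<forall>v\<in>{..<n}. max 0 (excess Q v) = 0"
    using t unfolding total_def by (subst (asm) sum_nonneg_eq_0_iff) auto
  then have le: "excess Q v \<le> 0" if "v < n" for v
    using that by (metis lessThan_iff max.cobounded2)
  have "\<forall>v\<in>{..<n}. - excess Q v = 0"
    using sum_nonneg_eq_0_iff[of "{..<n}" "\<lambda>v. - excess Q v"] le sum_excess_zero[of Q] by (simp add: sum_negf)
  then show "excess Q v = 0" using v by simp
qed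

lemma solve_spec:
  assumes "base m"
  shows "\<And>b. b < 20 \<Longrightarrow> solve m b = m b"
    "bal (G - (G - Q_of (solve m)))"
    "F \<subseteq> G \<Longrightarrow> bal (G - F) \<Longrightarrow> card (G - Q_of (solve m)) \<le> card F"
proof -
  define m1 where "m1 = upd 21 (\<lambda>m i j. 0) (upd 20 (\<lambda>m. mat m 19) m)"
  have L: "cap m1 = cap m" "n < cap m" "2 * card G \<le> cap m" using assms by (auto simp: m1_def base_def)
  have fr1: "m1 b = m b" if "b < 20" for b using that by (simp add: m1_def)
  have sol: "solve m = (phase ^^ cap m) m1" by (simp add: solve_def Let_def L flip: m1_def)
  have frt: "(phase ^^ t) m1 b = m b" if "b < 20" for b t
    using that by (induction t) (simp_all add: fr1 phase_frame)
  then show "\<And>b. b < 20 \<Longrightarrow> solve m b = m b" by (simp add: sol)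
  have Q1: "Q_of m1 = G"
  proof -
    have "mat m1 20 i j = of_bool ((i, j) \<in> G)" if "i < n" "j < n" for i j
      using that assms L by (simp add: m1_def base_def)
    then show ?thesis using G_verts by (auto simp: Q_of_def)
  qed
  have p1: "v < n \<Longrightarrow> vec m1 21 v = 0" for v using L by (simp add: m1_def)
  have fea1: "feasible G (vec m1 21)"
    using G_antisym G_verts p1 by (auto simp: feasible_def)
  have dual1: "dual G (vec m1 21) = 0" using p1 by (simp add: dual_def)
  have ok1: "state_ok m1"
    using base_cong[of m1 m] fr1 assms fea1 start_props(1) by (simp add: state_ok_def Q1)
  \<comment> \<open>The dual value starts at 0 and the total excess is at most
    \<open>card G\<close>, so the potential is at most \<open>2 * card G\<close>.\<close>
  have pot1: "potential m1 \<le> cap m"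
    using L(3) start_props(2) total_nonneg[of G] by (simp add: potential_def Q1 dual1)
  have "state_ok ((phase ^^ t) m1) \<and> (total (Q_of ((phase ^^ t) m1)) = 0 \<or> potential ((phase ^^ t) m1) + t \<le> cap m)" for t
  proof (induction t)
    case (Suc t)
    then show ?case
      using phase_spec[of "(phase ^^ t) m1"] total_nonneg[of "Q_of ((phase ^^ t) m1)"] by fastforce
  qed (use ok1 pot1 in simp)
  then have "state_ok (solve m) \<and> (total (Q_of (solve m)) = 0 \<or> potential (solve m) + cap m \<le> cap m)"
    unfolding sol by blast
  then have ok: "state_ok (solve m)" and "total (Q_of (solve m)) = 0 \<or> potential (solve m) = 0" by auto
  then have "total (Q_of (solve m)) = 0" using total_nonneg[of "Q_of (solve m)"] by (auto simp: potential_def)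
  then have e: "v < n \<Longrightarrow> excess (Q_of (solve m)) v = 0" for v by (rule total_zero)
  show "bal (G - (G - Q_of (solve m)))"
    "F \<subseteq> G \<Longrightarrow> bal (G - F) \<Longrightarrow> card (G - Q_of (solve m)) \<le> card F"
    using optimal[of "Q_of (solve m)" "vec (solve m) 21"] ok e by (auto simp: state_ok_def)
qed

end

lemma mult_add_eq_iff:
  fixes a c r x :: nat
  assumes "r < c"
  shows "a * c + r = x \<longleftrightarrow> x div c = a \<and> x mod c = r"
proof
  show "a * c + r = x \<Longrightarrow> x div c = a \<and> x mod c = r" using assms by auto
  show "x div c = a \<and> x mod c = r \<Longrightarrow> a * c + r = x" by (metis div_mult_mod_eq)
qed

section \<open>The kernel written by the program\<close>

context tournament_parameter
begin

definition min_cost :: nat where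
  "min_cost = card B + (LEAST c. \<exists>F\<subseteq>I_solved. bal (I_solved - F) \<and> card F = c)"

definition kept_count :: nat where
  "kept_count = card {v. keep v}"

definition rank :: "nat \<Rightarrow> nat" where
  "rank v = card {u. u < v \<and> keep u}"

text \<open>Across kept pieces every arc points from the larger piece number to the smaller, so arcs
  of \<open>B\<close> are reversed. Their deletion is already charged in \<open>min_cost\<close>;
  reversing them yields a tournament with no cycles across pieces.\<close>

definition kept_arcs :: "(nat \<times> nat) set" where
  "kept_arcs = {(u, v). keep u \<and> keep v \<and> ((u, v) \<in> I \<or> piece v < piece u)}"

definition kernel_arcs :: "(nat \<times> nat) set" where
  "kernel_arcs = map_prod rank rank ` kept_arcs"

lemma finite_keep: "finite {v. keep v}"
  by (rule finite_subset[of _ "{..<n}"]) (auto simp: keep_def)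

lemma kept_count_le: "kept_count \<le> n"
proof -
  have "kept_count \<le> card {..<n}" unfolding kept_count_def by (rule card_mono) (auto simp: keep_def)
  then show ?thesis by simp
qed

lemma rank_less: "keep v \<Longrightarrow> rank v < kept_count"
  unfolding rank_def kept_count_def by (rule psubset_card_mono[OF finite_keep]) auto

lemma rank_strict_mono: "keep u \<Longrightarrow> u < v \<Longrightarrow> rank u < rank v"
  unfolding rank_def by (rule psubset_card_mono) auto

lemma inj_on_rank: "inj_on rank {v. keep v}"
proof (rule inj_onI)
  fix u v assume "u \<in> {v. keep v}" "v \<in> {v. keep v}" "rank u = rank v"
  then show "u = v" using rank_strict_mono[of u v] rank_strict_mono[of v u] by (cases u v rule: linorder_cases) auto
qed

lemma rank_image: "rank ` {v. keep v} = {..<kept_count}"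
proof (rule card_subset_eq)
  show "rank ` {v. keep v} \<subseteq> {..<kept_count}" using rank_less by auto
  show "card (rank ` {v. keep v}) = card {..<kept_count}"
    using card_image[OF inj_on_rank] by (simp add: kept_count_def)
qed simp

lemma min_cost_le:
  assumes "F \<subseteq> I_solved" "bal (I_solved - F)"
  shows "min_cost \<le> card B + card F"
  unfolding min_cost_def by (intro add_left_mono Least_le exI[of _ F] conjI assms refl)

lemma min_cost_attained:
  obtains F where "F \<subseteq> I_solved" "bal (I_solved - F)" "min_cost = card B + card F"
proof -
  have "\<exists>c. \<exists>F\<subseteq>I_solved. bal (I_solved - F) \<and> card F = c"
    by (intro exI[of _ "card I_solved"] exI[of _ I_solved]) simp
  from LeastI_ex[OF this] obtain F where F: "F \<subseteq> I_solved" "bal (I_solved - F)"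
    "card F = (LEAST c. \<exists>F\<subseteq>I_solved. bal (I_solved - F) \<and> card F = c)" by (elim exE conjE)
  show ?thesis by (rule that[OF F(1,2)]) (simp only: min_cost_def F(3))
qed

lemma oriented_I_solved: "oriented_graph n I_solved"
proof
  show "I_solved \<subseteq> {..<n} \<times> {..<n}" using I_subset T_subset by blast
  show "(u, v) \<in> I_solved \<Longrightarrow> (v, u) \<notin> I_solved" for u v using T_antisym I_subset by blast
qed

lemma card_relation_le:
  assumes "R \<subseteq> {..<n} \<times> {..<n}"
  shows "card R \<le> n * n"
  using card_mono[OF _ assms] by simp

definition within_bound :: bool where
  "within_bound \<longleftrightarrow> min_cost \<le> k \<and> kept_count \<le> 4 * k * (4 * k + 2)"

lemma kernel_program_spec:
  assumes rep: "represents m n T k'" and k: "k = min k' (n * n)"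
  defines "m' \<equiv> kernel_program m"
  shows "m' 0 0 = (if within_bound then kept_count * kept_count else 16)"
    "m' 0 1 = (if within_bound then k - min_cost else 0)"
    "within_bound \<Longrightarrow> x < kept_count * kept_count \<Longrightarrow>
       m' 1 x \<noteq> 0 \<longleftrightarrow> (x div kept_count, x mod kept_count) \<in> kernel_arcs"
    "\<not> within_bound \<Longrightarrow> x < 16 \<Longrightarrow> m' 1 x \<noteq> 0 \<longleftrightarrow> x \<in> {1, 2, 6, 7, 11, 12}"
proof -
  interpret G: oriented_graph n I_solved by (rule oriented_I_solved)
  define M where "M = prepare m"
  define S where "S = solve M"
  define L where "L = cap M"
  have prep: "prepared M" unfolding M_def using rep k by (rule prepared_prepare)
  have L: "L = 2 * (n * n) + 20" and n10: "scal M 10 = n" and k11: "scal M 11 = k"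
    and T12: "\<And>i j. i < L \<Longrightarrow> j < L \<Longrightarrow> mat M 12 i j = of_bool ((i, j) \<in> T)"
    and p15: "\<And>v. v < L \<Longrightarrow> vec M 15 v = piece v"
    and I16: "\<And>i j. i < L \<Longrightarrow> j < L \<Longrightarrow> mat M 16 i j = of_bool ((i, j) \<in> I)"
    and k18: "\<And>v. v < L \<Longrightarrow> vec M 18 v = of_bool (keep v)"
    and G19: "\<And>i j. i < L \<Longrightarrow> j < L \<Longrightarrow> mat M 19 i j = of_bool ((i, j) \<in> I_solved)"
    using prep by (auto simp: prepared_def L_def)
  have nn: "n \<le> n * n" by (cases n) auto
  have nL: "n < L" unfolding L using nn by linarith
  have "2 * card I_solved \<le> L" using card_relation_le[OF G.G_subset] by (simp add: L)
  then have base: "G.base M" unfolding G.base_def L_def[symmetric] using nL n10 G19 by blast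
  note sol = G.solve_spec[OF base, folded S_def]
  have capS: "cap S = L" using sol(1)[of 2] by (simp add: cap_def L_def)
  have matS: "mat S b = mat M b" if "b < 20" for b
    using that sol(1) capS by (intro mat_cong) (simp_all add: L_def)
  let ?F = "I_solved - G.Q_of S"
  have cost: "min_cost = card B + card ?F"
  proof (rule antisym)
    show "min_cost \<le> card B + card ?F" using sol(2) by (intro min_cost_le) auto
    obtain F where "F \<subseteq> I_solved" "bal (I_solved - F)" "min_cost = card B + card F" by (rule min_cost_attained)
    then show "card B + card ?F \<le> min_cost" using sol(3) by simp
  qed
  have vL: "u < L" if "u < n" for u using that nL by simp
  have TL: "T \<subseteq> {..<L} \<times> {..<L}" using T_verts vL by auto
  define m1 where "m1 = upd 30 g_cost S"
  define m2 where "m2 = upd 31 g_count m1"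
  define m3 where "m3 = upd 32 g_rank m2"
  define m4 where "m4 = upd 1 g_bits m3"
  have m5: "m' = upd 0 g_header m4"
    by (simp add: m'_def kernel_program_def emit_def m4_def m3_def m2_def m1_def S_def M_def)
  have caps: "cap m1 = L" "cap m2 = L" "cap m3 = L" "cap m4 = L"
    by (simp_all add: m1_def m2_def m3_def m4_def capS)
  have L0: "0 < L" "16 < L" by (simp_all add: L)
  have mats: "mat m1 b = mat M b" "mat m2 b = mat M b" "mat m3 b = mat M b" if "b < 20" for b
    using that by (simp_all add: m1_def m2_def m3_def matS)
  have c30: "scal m1 30 = min_cost"
  proof -
    have "(\<Sum>u<L. \<Sum>v<L. of_bool (mat M 12 u v \<noteq> 0 \<and> vec M 15 u < vec M 15 v) :: nat) =
        (\<Sum>u<L. \<Sum>v<L. of_bool ((u, v) \<in> B))"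
      by (intro sum_cong_lessThan) (simp add: T12 p15 B_def)
    also have "\<dots> = card B" by (rule sum_of_bool_card2) (use I_subset TL in blast)
    finally have 1: "(\<Sum>u<L. \<Sum>v<L. of_bool (mat M 12 u v \<noteq> 0 \<and> vec M 15 u < vec M 15 v)) = card B" .
    have "(\<Sum>u<L. \<Sum>v<L. of_bool (mat M 19 u v \<noteq> 0 \<and> mat S 20 u v = 0) :: nat) =
        (\<Sum>u<L. \<Sum>v<L. of_bool ((u, v) \<in> ?F))"
    proof (intro sum_cong_lessThan)
      fix u v assume "u < L" "v < L"
      moreover have "(u, v) \<in> ?F \<longleftrightarrow> (u, v) \<in> I_solved \<and> mat S 20 u v = 0"
        using G.G_verts[of u v] by (auto simp: G.Q_of_def)
      ultimately show "of_bool (mat M 19 u v \<noteq> 0 \<and> mat S 20 u v = 0) = (of_bool ((u, v) \<in> ?F) :: nat)"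
        by (simp add: G19)
    qed
    also have "\<dots> = card ?F" by (rule sum_of_bool_card2) (use I_subset TL in blast)
    finally have 2: "(\<Sum>u<L. \<Sum>v<L. of_bool (mat M 19 u v \<noteq> 0 \<and> mat S 20 u v = 0)) = card ?F" .
    have "scal m1 30 = g_cost S 0 0" using L0 by (simp add: m1_def capS)
    also have "\<dots> = card B + card ?F" unfolding g_cost_def capS using 1 2 by (simp only: matS[of 12, simplified] matS[of 15, simplified] matS[of 19, simplified])
    finally show ?thesis by (simp add: cost)
  qed
  have c31: "scal m2 31 = kept_count"
  proof -
    have "scal m2 31 = (\<Sum>v<L. of_bool (keep v))"
      using L0 by (simp add: m2_def caps g_count_def mats k18 cong: sum.cong_simp)
    also have "\<dots> = card {v. keep v}" by (rule sum_of_bool_card) (use vL in \<open>auto simp: keep_def\<close>)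
    finally show ?thesis by (simp add: kept_count_def)
  qed
  have r32: "vec m3 32 v = rank v" if "v < L" for v
  proof -
    have "vec m3 32 v = (\<Sum>u<L. of_bool (u < v \<and> keep u))"
      using L0 that by (simp add: m3_def caps g_rank_def mats k18 cong: sum.cong_simp)
    also have "\<dots> = card {u. u < v \<and> keep u}" by (rule sum_of_bool_card) (use that in auto)
    finally show ?thesis by (simp add: rank_def)
  qed
  have s3: "scal m3 30 = min_cost" "scal m3 31 = kept_count" "scal m3 11 = k"
    using c30 c31 k11 mats by (simp_all add: m3_def m2_def)
  have s4: "scal m4 30 = min_cost" "scal m4 31 = kept_count" "scal m4 11 = k"
    using s3 by (simp_all add: m4_def)
  \<comment> \<open>This rests on the cut-off of the parameter at \<open>n * n\<close>;
    \<open>mulc\<close> requires its left factor to be at most the capacity.\<close>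
  have kL: "k \<le> L" using k by (simp add: L)
  have small_eq: "4 * k * (4 * k + 2) = quadruple (k * (quadruple k + 2))"
    by (simp add: quadruple_def algebra_simps)
  have small: "small m3 \<longleftrightarrow> within_bound" "small m4 \<longleftrightarrow> within_bound"
    unfolding small_def within_bound_def s3 s4 small_eq using mulc[of k m3] mulc[of k m4] kL by (simp_all add: caps)
  have cL: "kept_count \<le> L" using kept_count_le nL by simp
  have b1: "m' 1 x = g_bits m3 0 x" if "x < L" for x
  proof -
    have "mat m' 1 0 x = g_bits m3 0 x" using that L0 by (simp add: m5 m4_def caps)
    then show ?thesis by (simp add: mat_def)
  qed
  have h: "m' 0 x = g_header m4 0 x" if "x < L" for x
  proof -
    have "mat m' 0 0 x = g_header m4 0 x" using that L0 by (simp add: m5 caps)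
    then show ?thesis by (simp add: mat_def)
  qed
  show "m' 0 0 = (if within_bound then kept_count * kept_count else 16)"
    unfolding h[OF L0(1)] g_header_def small s4 using mulc[of kept_count m4] cL by (simp add: caps)
  have "1 < L" using L0 by simp
  then show "m' 0 1 = (if within_bound then k - min_cost else 0)"
    unfolding h[OF \<open>1 < L\<close>] g_header_def small s4 by simp
  show "m' 1 x \<noteq> 0 \<longleftrightarrow> x \<in> {1, 2, 6, 7, 11, 12}"
    if w: "\<not> within_bound" and x: "x < 16"
  proof -
    have "x < L" using x L0 by simp
    show ?thesis unfolding b1[OF \<open>x < L\<close>] g_bits_def small if_not_P[OF w] of_bool_eq_0_iff not_not by simp
  qed
  show "m' 1 x \<noteq> 0 \<longleftrightarrow> (x div kept_count, x mod kept_count) \<in> kernel_arcs"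
    if w: "within_bound" and x: "x < kept_count * kept_count"
  proof -
    have c: "kept_count \<le> n" by (rule kept_count_le)
    have "x < L" unfolding L using x mult_le_mono[OF c c] by linarith
    have e: "vec m3 18 u \<noteq> 0 \<and> vec m3 18 v \<noteq> 0 \<and> (mat m3 16 u v \<noteq> 0 \<or> vec m3 15 v < vec m3 15 u) \<and>
         mulc m3 (vec m3 32 u) (scal m3 31) + vec m3 32 v = x \<longleftrightarrow>
         (u, v) \<in> kept_arcs \<and> x div kept_count = rank u \<and> x mod kept_count = rank v" if uv: "u < L" "v < L" for u v
    proof -
      have "mulc m3 (rank u) kept_count = rank u * kept_count" if "keep u"
        using rank_less[OF that] cL by (intro mulc) (simp add: caps)
      moreover have "rank u * kept_count + rank v = x \<longleftrightarrow> x div kept_count = rank u \<and> x mod kept_count = rank v" if "keep v"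
        using rank_less[OF that] by (rule mult_add_eq_iff)
      ultimately show ?thesis using uv unfolding s3 r32[OF uv(1)] r32[OF uv(2)]
        by (auto simp: mats k18 I16 p15 kept_arcs_def)
    qed
    have kL: "u < L \<and> v < L" if "(u, v) \<in> kept_arcs" for u v
      using that vL by (auto simp: kept_arcs_def keep_def)
    have "m' 1 x \<noteq> 0 \<longleftrightarrow> (\<exists>u<L. \<exists>v<L. vec m3 18 u \<noteq> 0 \<and> vec m3 18 v \<noteq> 0 \<and>
         (mat m3 16 u v \<noteq> 0 \<or> vec m3 15 v < vec m3 15 u) \<and>
         mulc m3 (vec m3 32 u) (scal m3 31) + vec m3 32 v = x)"
      unfolding b1[OF \<open>x < L\<close>] g_bits_def small caps if_P[OF w] of_bool_eq_0_iff not_not ..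
    also have "\<dots> \<longleftrightarrow> (\<exists>u<L. \<exists>v<L. (u, v) \<in> kept_arcs \<and> x div kept_count = rank u \<and> x mod kept_count = rank v)"
      by (rule ex_cong1, rule conj_cong, rule refl, rule ex_cong1, rule conj_cong, rule refl, rule e)
    also have "\<dots> \<longleftrightarrow> (x div kept_count, x mod kept_count) \<in> kernel_arcs"
    proof -
      have "(a, b) \<in> kernel_arcs \<longleftrightarrow> (\<exists>u v. (u, v) \<in> kept_arcs \<and> a = rank u \<and> b = rank v)" for a b
        unfolding kernel_arcs_def by force
      then show ?thesis using kL by blast
    qed
    finally show ?thesis .
  qed
qed

end

section \<open>Correctness of the kernel\<close>

text \<open>The minimum is attained because deleting all arcs gives a DESC-set.\<close>

lemma desc_le_iff:
  assumes "pair_digraph D"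
  shows "desc D \<le> k \<longleftrightarrow> (\<exists>A\<subseteq>parcs D. bal (cyc (parcs D - A)) \<and> card A \<le> k)"
proof -
  have ex: "\<exists>m A. DESC_set D A \<and> card A = m"
    by (intro exI[of _ "card (parcs D)"] exI[of _ "parcs D"]) (simp add: DESC_set_iff[OF assms] cyc_def)
  have "desc D \<le> k \<longleftrightarrow> (\<exists>A. DESC_set D A \<and> card A \<le> k)"
  proof
    assume "desc D \<le> k"
    moreover obtain A where "DESC_set D A" "card A = desc D"
    proof -
      from LeastI_ex[OF ex] obtain A where A: "DESC_set D A" "card A = (LEAST m. \<exists>A. DESC_set D A \<and> card A = m)"
        by (elim exE conjE)
      show ?thesis by (rule that[OF A(1)]) (simp only: desc_def A(2))
    qed
    ultimately show "\<exists>A. DESC_set D A \<and> card A \<le> k" by auto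
  next
    assume "\<exists>A. DESC_set D A \<and> card A \<le> k"
    then obtain A where "DESC_set D A" "card A \<le> k" by (elim exE conjE)
    moreover from \<open>DESC_set D A\<close> have "desc D \<le> card A"
      unfolding desc_def by (intro Least_le exI[of _ A]) simp
    ultimately show "desc D \<le> k" by simp
  qed
  then show ?thesis by (auto simp: DESC_set_iff[OF assms])
qed

definition digraph_on :: "nat \<Rightarrow> (nat \<times> nat) set \<Rightarrow> nat pair_pre_digraph" where
  "digraph_on n T = \<lparr>pverts = {..<n}, parcs = T\<rparr>"

lemma digraph_on_simps [simp]: "pverts (digraph_on n T) = {..<n}" "parcs (digraph_on n T) = T"
  by (simp_all add: digraph_on_def)

lemma tournaments_cases:
  assumes "D \<in> tournaments"
  obtains n T where "D = digraph_on n T" "tournament_relation n T"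
proof -
  have t: "tournament D" and "\<exists>n. pverts D = {..<n}" using assms by (simp_all add: tournaments_def)
  then obtain n where n: "pverts D = {..<n}" by (elim exE)
  have tot: "(u, v) \<in> parcs D \<longleftrightarrow> (v, u) \<notin> parcs D" if "u < n" "v < n" "u \<noteq> v" for u v
    using t that unfolding tournament_def n by blast
  interpret D: pair_digraph D using t by (simp only: tournament_def)
  have "tournament_relation n (parcs D)"
  proof (unfold_locales)
    show "parcs D \<subseteq> {..<n} \<times> {..<n}"
    proof
      fix e assume e: "e \<in> parcs D"
      have "fst e \<in> pverts D" "snd e \<in> pverts D"
        using D.arc_fst_in_verts[OF e] D.arc_snd_in_verts[OF e] .
      then show "e \<in> {..<n} \<times> {..<n}" by (cases e) (simp add: n)
    qed
    show "(v, v) \<notin> parcs D" for v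
    proof
      assume "(v, v) \<in> parcs D"
      from D.pair_no_loops[OF this] show False by simp
    qed
  qed (rule tot)
  moreover have "D = digraph_on n (parcs D)" using n by (simp add: digraph_on_def)
  ultimately show ?thesis by (rule that[rotated])
qed

context tournament_relation
begin

lemma pair_digraph_on: "pair_digraph (digraph_on n T)"
proof
  show "e \<in> parcs (digraph_on n T) \<Longrightarrow> fst e \<in> pverts (digraph_on n T)" for e using T_verts by (cases e) auto
  show "e \<in> parcs (digraph_on n T) \<Longrightarrow> snd e \<in> pverts (digraph_on n T)" for e using T_verts by (cases e) auto
  show "e \<in> parcs (digraph_on n T) \<Longrightarrow> fst e \<noteq> snd e" for e using T_irrefl by (cases e) auto
qed (simp_all add: finite_T)

lemma digraph_on_in_tournaments: "digraph_on n T \<in> tournaments"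
proof -
  have "tournament (digraph_on n T)"
    unfolding tournament_def digraph_on_simps lessThan_iff Ball_def
    by (intro conjI pair_digraph_on allI impI T_total)
  then show ?thesis by (auto simp: tournaments_def)
qed

lemma desc_digraph_on_le_iff: "desc (digraph_on n T) \<le> k \<longleftrightarrow> (\<exists>A. tournament_solution n T A k)"
proof -
  have "tournament_solution n T A k \<longleftrightarrow> A \<subseteq> T \<and> bal (cyc (T - A)) \<and> card A \<le> k" for A k
    using tournament_relation_axioms
    by (simp add: tournament_solution_def tournament_solution_axioms_def)
  then show ?thesis unfolding desc_le_iff[OF pair_digraph_on] by auto
qed

text \<open>Because of this bound the parameter can be cut off at \<open>n * n\<close> without
  changing the answer.\<close>

lemma desc_digraph_on_le: "desc (digraph_on n T) \<le> n * n"
proof -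
  have "card T \<le> n * n" using card_mono[OF _ T_subset] by simp
  then show ?thesis unfolding desc_le_iff[OF pair_digraph_on]
    by (intro exI[of _ T]) (simp add: cyc_def)
qed

end

section \<open>Equivalence of the input and its kernel\<close>

context tournament_parameter
begin

lemma kept_arcs_subset: "kept_arcs \<subseteq> {v. keep v} \<times> {v. keep v}"
  by (auto simp: kept_arcs_def)

text \<open>Inside a piece the arcs of \<open>T\<close> decide, across pieces the numbers of the
  pieces; in both cases exactly one direction is present. \<open>rank\<close> transports this to an
  initial segment of the numbers.\<close>

lemma tournament_relation_kernel: "tournament_relation kept_count kernel_arcs"
proof
  show "kernel_arcs \<subseteq> {..<kept_count} \<times> {..<kept_count}"
    using kept_arcs_subset rank_less by (auto simp: kernel_arcs_def)
  have r: "rank u = rank v \<longleftrightarrow> u = v" if "keep u" "keep v" for u v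
    using inj_on_rank that by (auto dest: inj_onD)
  have mem: "(rank u, rank v) \<in> kernel_arcs \<longleftrightarrow> (u, v) \<in> kept_arcs" if "keep u" "keep v" for u v
  proof
    assume "(rank u, rank v) \<in> kernel_arcs"
    then obtain a b where ab: "(a, b) \<in> kept_arcs" "rank u = rank a" "rank v = rank b"
      by (auto simp: kernel_arcs_def)
    then show "(u, v) \<in> kept_arcs" using r[OF that(1), of a] r[OF that(2), of b] kept_arcs_subset by auto
  next
    assume "(u, v) \<in> kept_arcs"
    then have "map_prod rank rank (u, v) \<in> kernel_arcs" unfolding kernel_arcs_def by (rule imageI)
    then show "(rank u, rank v) \<in> kernel_arcs" by simp
  qed
  have tot: "(u, v) \<in> kept_arcs \<longleftrightarrow> (v, u) \<notin> kept_arcs" if "keep u" "keep v" "u \<noteq> v" for u v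
  proof -
    have "u < n" "v < n" using that by (auto simp: keep_def)
    then show ?thesis using that T_total[of u v] by (auto simp: kept_arcs_def I_def)
  qed
  have rep: "\<exists>u. keep u \<and> x = rank u" if "x < kept_count" for x
  proof -
    have "x \<in> rank ` {v. keep v}" unfolding rank_image using that by simp
    then show ?thesis by auto
  qed
  show "(x, x) \<notin> kernel_arcs" for x
  proof
    assume "(x, x) \<in> kernel_arcs"
    then obtain a b where ab: "(a, b) \<in> kept_arcs" "rank a = rank b" by (auto simp: kernel_arcs_def)
    moreover have "keep a" "keep b" using ab(1) kept_arcs_subset by auto
    ultimately have "a = b" using r by simp
    then show False using ab(1) T_irrefl by (simp add: kept_arcs_def I_def)
  qed
  show "(x, y) \<in> kernel_arcs \<longleftrightarrow> (y, x) \<notin> kernel_arcs" 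
    if xy: "x < kept_count" "y < kept_count" "x \<noteq> y" for x y
  proof -
    obtain u where u: "keep u" "x = rank u" using rep[OF xy(1)] by (elim exE conjE)
    obtain v where v: "keep v" "y = rank v" using rep[OF xy(2)] by (elim exE conjE)
    have "u \<noteq> v" using u v xy(3) by blast
    with tot[OF u(1) v(1)] show ?thesis using mem[OF u(1) v(1)] mem[OF v(1) u(1)] u v by simp
  qed
qed

text \<open>Across pieces the piece number strictly falls along \<open>kept_arcs\<close>, so cycles
  use arcs inside pieces only.\<close>

lemma cyc_kept: "cyc (kept_arcs - A) = cyc (I_kept - A)"
proof -
  have "cyc (kept_arcs - A) = cyc {(u, v) \<in> kept_arcs - A. piece u = piece v}"
    by (rule cyc_mono_fun) (auto simp: kept_arcs_def I_def)
  also have "{(u, v) \<in> kept_arcs - A. piece u = piece v} = I_kept - A"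
  proof (intro set_eqI, clarify)
    fix u v
    show "(u, v) \<in> {(u, v) \<in> kept_arcs - A. piece u = piece v} \<longleftrightarrow> (u, v) \<in> I_kept - A"
      using I_keep[of u v] by (auto simp: kept_arcs_def I_kept_def I_def)
  qed
  finally show ?thesis .
qed

lemma bal_cyc_kernel:
  assumes "A \<subseteq> kept_arcs"
  shows "bal (cyc (kernel_arcs - map_prod rank rank ` A)) \<longleftrightarrow> bal (cyc (I_kept - A))"
proof -
  let ?V = "{v. keep v}"
  have inj: "inj_on (map_prod rank rank) (?V \<times> ?V)" by (rule map_prod_inj_on[OF inj_on_rank inj_on_rank])
  have sub: "kept_arcs - A \<subseteq> ?V \<times> ?V" using kept_arcs_subset by blast
  have "map_prod rank rank ` (kept_arcs - A) = kernel_arcs - map_prod rank rank ` A"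
    unfolding kernel_arcs_def
    by (rule inj_on_image_set_diff[OF inj]) (use kept_arcs_subset assms in blast)+
  then have "cyc (kernel_arcs - map_prod rank rank ` A) = map_prod rank rank ` cyc (kept_arcs - A)"
    using cyc_map_prod[OF inj_on_rank sub] by (simp only:)
  moreover have "cyc (kept_arcs - A) \<subseteq> ?V \<times> ?V" using sub unfolding cyc_def by blast
  ultimately show ?thesis using bal_map_prod[OF inj_on_rank, of "cyc (kept_arcs - A)"] by (simp only: cyc_kept)
qed

text \<open>By \<open>solved_part\<close> a solution spends at least \<open>min_cost\<close> outside
  the kept part, so its arcs inside fit into the remaining budget.\<close>

lemma solution_imp_kernel:
  assumes "tournament_solution n T A k"
  shows "within_bound \<and> (\<exists>A'. tournament_solution kept_count kernel_arcs A' (k - min_cost))"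
proof -
  interpret S: tournament_solution n T A k by fact
  obtain F where F: "F \<subseteq> I_solved" "bal (I_solved - F)" "card B + card F + card (A \<inter> I_kept) \<le> k"
    by (rule S.solved_part)
  have cost: "min_cost + card (A \<inter> I_kept) \<le> k" using min_cost_le[OF F(1,2)] F(3) by simp
  have "kept_count \<le> 16 * k * k" unfolding kept_count_def by (rule S.card_kept)
  also have "\<dots> \<le> 4 * k * (4 * k + 2)" by (simp add: algebra_simps)
  finally have wb: "within_bound" using cost by (simp add: within_bound_def)
  let ?A = "A \<inter> I_kept"
  have sub: "?A \<subseteq> kept_arcs"
  proof clarify
    fix u v assume "(u, v) \<in> I_kept"
    then show "(u, v) \<in> kept_arcs" using I_keep[of u v] by (auto simp: I_kept_def kept_arcs_def)
  qed
  have "I_kept - ?A = I_kept - A" by blast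
  then have "bal (cyc (I_kept - ?A))" using S.bal_kept by simp
  then have "bal (cyc (kernel_arcs - map_prod rank rank ` ?A))" using bal_cyc_kernel[OF sub] by simp
  moreover have "map_prod rank rank ` ?A \<subseteq> kernel_arcs" using sub by (auto simp: kernel_arcs_def)
  moreover have "card (map_prod rank rank ` ?A) \<le> k - min_cost"
    using card_image_le[of ?A "map_prod rank rank"] S.finite_A cost by simp
  ultimately have "tournament_solution kept_count kernel_arcs (map_prod rank rank ` ?A) (k - min_cost)"
    using tournament_relation_kernel by (simp add: tournament_solution_def tournament_solution_axioms_def)
  with wb show ?thesis by blast
qed

text \<open>The solution is pulled back along \<open>rank\<close>; its arcs between pieces are
  dropped, as they lie on no cycle of the kernel. The set \<open>B\<close> and an optimal
  \<open>F\<close> together cost \<open>min_cost\<close>.\<close>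

lemma kernel_imp_solution:
  assumes "within_bound" "tournament_solution kept_count kernel_arcs A' (k - min_cost)"
  shows "\<exists>A. tournament_solution n T A k"
proof -
  interpret S: tournament_solution kept_count kernel_arcs A' "k - min_cost" by fact
  define A where "A = {e \<in> kept_arcs. map_prod rank rank e \<in> A'}"
  have img: "map_prod rank rank ` A = A'"
  proof (intro equalityI subsetI)
    fix x assume x: "x \<in> A'"
    then have "x \<in> map_prod rank rank ` kept_arcs" using S.A_subset unfolding kernel_arcs_def by (rule rev_subsetD)
    then obtain e where e: "e \<in> kept_arcs" "x = map_prod rank rank e" by (elim imageE)
    then have "e \<in> A" using x by (simp add: A_def)
    then show "x \<in> map_prod rank rank ` A" using e(2) by (rule rev_image_eqI)
  next
    fix x assume "x \<in> map_prod rank rank ` A"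
    then show "x \<in> A'" unfolding A_def by (elim imageE) simp
  qed
  have sub: "A \<subseteq> kept_arcs" by (auto simp: A_def)
  have inj: "inj_on (map_prod rank rank) A"
    by (rule inj_on_subset[OF map_prod_inj_on[OF inj_on_rank inj_on_rank]]) (use sub kept_arcs_subset in blast)
  have card: "card (A \<inter> I_kept) \<le> k - min_cost"
  proof -
    have fin: "finite A" using inj S.finite_A img finite_imageD by blast
    then have "card (A \<inter> I_kept) \<le> card A" by (intro card_mono) auto
    also have "\<dots> = card A'" using card_image[OF inj] img by simp
    finally show ?thesis using S.A_card by simp
  qed
  have "bal (cyc (I_kept - A))" using bal_cyc_kernel[OF sub] S.A_bal img by simp
  moreover have "I_kept - A \<inter> I_kept = I_kept - A" by blast
  ultimately have b: "bal (cyc (I_kept - A \<inter> I_kept))" by simp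
  obtain F where F: "F \<subseteq> I_solved" "bal (I_solved - F)" "min_cost = card B + card F" by (rule min_cost_attained)
  note sol = solution_of_parts[OF Int_lower2 b F(1,2)]
  have "card (B \<union> (A \<inter> I_kept) \<union> F) \<le> k"
  proof -
    have "min_cost \<le> k" using assms(1) by (simp add: within_bound_def)
    then show ?thesis using sol(3) card F(3) by linarith
  qed
  then have "tournament_solution n T (B \<union> (A \<inter> I_kept) \<union> F) k"
    using sol(1,2) tournament_relation_axioms
    by (simp add: tournament_solution_def tournament_solution_axioms_def)
  then show ?thesis by blast
qed

end

text \<open>This tournament is strongly connected, and a nonempty tournament with an even number of
  vertices is never balanced: the two degrees of a vertex have an odd sum.\<close>

definition no_instance :: "(nat \<times> nat) set" where
  "no_instance = {(0, 1), (0, 2), (1, 2), (1, 3), (2, 3), (3, 0)}"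

lemma no_instance_relation: "tournament_relation 4 no_instance"
proof
  show "(u, v) \<in> no_instance \<longleftrightarrow> (v, u) \<notin> no_instance" if "u < 4" "v < 4" "u \<noteq> v" for u v
  proof -
    have "u = 0 \<or> u = 1 \<or> u = 2 \<or> u = 3" "v = 0 \<or> v = 1 \<or> v = 2 \<or> v = 3" using that by linarith+
    then show ?thesis using that(3) by (elim disjE) (simp_all add: no_instance_def)
  qed
qed (auto simp: no_instance_def)

lemma desc_no_instance: "\<not> desc (digraph_on 4 no_instance) \<le> 0"
proof
  interpret tournament_relation 4 no_instance by (rule no_instance_relation)
  assume "desc (digraph_on 4 no_instance) \<le> 0"
  then obtain A where A: "A \<subseteq> no_instance" "bal (cyc (no_instance - A))" "card A = 0"
    unfolding desc_le_iff[OF pair_digraph_on] by auto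
  have "finite A" using A(1) finite_T by (rule finite_subset)
  then have b: "bal (cyc no_instance)" using A by simp
  let ?N = no_instance
  have a: "(0, 1) \<in> ?N" "(0, 2) \<in> ?N" "(1, 3) \<in> ?N" "(2, 3) \<in> ?N" "(3, 0) \<in> ?N" by (simp_all add: no_instance_def)
  have p: "(1, 0) \<in> ?N\<^sup>*" "(2, 0) \<in> ?N\<^sup>*" "(0, 3) \<in> ?N\<^sup>*"
    using a by (blast intro: rtrancl_trans[OF r_into_rtrancl r_into_rtrancl])+
  have "(0, w) \<in> ?N \<longleftrightarrow> w = 1 \<or> w = 2" "(w, 0) \<in> ?N \<longleftrightarrow> w = 3" for w
    by (auto simp: no_instance_def)
  then have "cyc ?N `` {0} = {1, 2}" "(cyc ?N)\<inverse> `` {0} = {3}"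
    using p by (auto simp: cyc_def)
  moreover have "card (cyc ?N `` {0}) = card ((cyc ?N)\<inverse> `` {0})" using b unfolding bal_def by (rule spec)
  ultimately show False by simp
qed

section \<open>Trying all sets of arcs\<close>

text \<open>
  Banks 40 to 44 hold the powers of 2, the number of the subset of arcs to be deleted (also used to
  count while the powers are computed), the answer, the remaining arcs and reachability.
\<close>

definition g_double :: "memory \<Rightarrow> nat \<Rightarrow> nat \<Rightarrow> nat" where
  "g_double m i j = (if scal m 41 < j then vec m 40 j + vec m 40 j else vec m 40 j)"

definition g_tick :: "memory \<Rightarrow> nat \<Rightarrow> nat \<Rightarrow> nat" where
  "g_tick m i j = Suc (scal m 41)"

text \<open>Entry \<open>j\<close> is doubled in the first \<open>j\<close> rounds only. Since loops
  run for \<open>cap m\<close> rounds, an exponential search needs an exponential capacity, which is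
  taken from this table.\<close>

definition powers :: "memory \<Rightarrow> memory" where
  "powers m = (let m' = upd 40 (\<lambda>m i j. 1) (upd 41 (\<lambda>m i j. 0) m) in
     ((\<lambda>m. upd 41 g_tick (upd 40 g_double m)) ^^ cap m') m')"

text \<open>A form of \<open>odd (c div p)\<close> without division, for the power \<open>p\<close>
  of 2 in entry \<open>x\<close> and the counter \<open>c\<close>: the bit is set if
  \<open>c\<close> lies in the upper half of a block of length \<open>2 * p\<close>.\<close>

definition bit_set :: "memory \<Rightarrow> nat \<Rightarrow> bool" where
  "bit_set m x \<longleftrightarrow> (\<exists>q<cap m. mulc m q (vec m 40 x + vec m 40 x) + vec m 40 x \<le> scal m 41 \<and>
     scal m 41 < mulc m q (vec m 40 x + vec m 40 x) + vec m 40 x + vec m 40 x)"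

definition g_E :: "memory \<Rightarrow> nat \<Rightarrow> nat \<Rightarrow> nat" where
  "g_E m i j = of_bool (mat m 12 i j \<noteq> 0 \<and> \<not> bit_set m (mulc m i (scal m 10) + j))"

definition g_reach :: "memory \<Rightarrow> nat \<Rightarrow> nat \<Rightarrow> nat" where
  "g_reach m i j = of_bool (i < scal m 10 \<and> j < scal m 10 \<and>
     (i = j \<or> (\<exists>w<cap m. mat m 44 i w \<noteq> 0 \<and> mat m 43 w j \<noteq> 0)))"

text \<open>The answer is sticky: after one successful subset, bank 42 remains nonzero. Deleted arcs
  are those present in bank 12 and absent from bank 43.\<close>

definition g_test :: "memory \<Rightarrow> nat \<Rightarrow> nat \<Rightarrow> nat" where
  "g_test m i j = of_bool (scal m 42 \<noteq> 0 \<or>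
     (\<forall>v<cap m. (\<Sum>w<cap m. of_bool (mat m 43 v w \<noteq> 0 \<and> mat m 44 w v \<noteq> 0)) =
       (\<Sum>w<cap m. of_bool (mat m 43 w v \<noteq> 0 \<and> mat m 44 v w \<noteq> 0) :: nat)) \<and>
     (\<Sum>u<cap m. \<Sum>v<cap m. of_bool (mat m 12 u v \<noteq> 0 \<and> mat m 43 u v = 0)) \<le> m 0 1)"

definition reach :: "memory \<Rightarrow> memory" where
  "reach m = (upd 44 g_reach ^^ cap m) m"

definition try_subset :: "memory \<Rightarrow> memory" where
  "try_subset m = upd 41 g_tick (upd 42 g_test (reach (upd 44 (\<lambda>m i j. 0) (upd 43 g_E m))))"

definition decide :: "memory \<Rightarrow> memory" where
  "decide m = (let m' = upd 42 (\<lambda>m i j. 0) (upd 41 (\<lambda>m i j. 0) (upd 12 g_T (upd 10 g_n m))) in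
     upd 0 (\<lambda>m i j. scal m 42) ((try_subset ^^ cap m') m'))"

lemma cmd_decide_g:
  assumes "a \<notin> {2, 3, 4, 5}"
  shows "cmd (upd a g_double)" "cmd (upd a g_tick)" "cmd (upd a g_E)" "cmd (upd a g_reach)"
    "cmd (upd a g_test)" "cmd (upd a (\<lambda>m i j. 1))" "cmd (upd a (\<lambda>m i j. scal m 42))"
  unfolding g_double_def[abs_def] g_tick_def[abs_def] g_E_def[abs_def] g_reach_def[abs_def]
    g_test_def[abs_def] bit_set_def mulc_def
  by (rule cmd_upd[OF _ assms]; (rule computable_intros | (rule computable_var, simp; fail) | (simp; fail))+)+

lemma cmd_powers: "cmd powers"
proof -
  have "cmd (\<lambda>m. upd 41 g_tick (upd 40 g_double m))"
    by ((rule cmd_upd_comp, (rule cmd_decide_g cmd_g; simp))+, rule cmd_skip)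
  from cmd_repeat[OF this] have r: "cmd (\<lambda>m. ((\<lambda>m. upd 41 g_tick (upd 40 g_double m)) ^^ cap m) m)" .
  have "cmd (\<lambda>m. upd 40 (\<lambda>m i j. 1) (upd 41 (\<lambda>m i j. 0) m))"
    by ((rule cmd_upd_comp, (rule cmd_decide_g cmd_g; simp))+, rule cmd_skip)
  from cmd_comp[OF this r] show ?thesis by (simp only: powers_def[abs_def] Let_def)
qed

lemma cmd_decide: "cmd decide"
proof -
  have "cmd (upd 44 g_reach)" by (rule cmd_decide_g) simp
  from cmd_repeat[OF this] have r: "cmd reach" by (simp only: reach_def[abs_def])
  have 1: "cmd (\<lambda>m. upd 44 (\<lambda>m i j. 0) (upd 43 g_E m))"
    by ((rule cmd_upd_comp, (rule cmd_decide_g cmd_g; simp))+, rule cmd_skip)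
  have 2: "cmd (\<lambda>m. upd 41 g_tick (upd 42 g_test m))"
    by ((rule cmd_upd_comp, (rule cmd_decide_g cmd_g; simp))+, rule cmd_skip)
  have "cmd try_subset"
    using cmd_comp[OF cmd_comp[OF 1 r] 2] by (simp only: try_subset_def[abs_def])
  from cmd_repeat[OF this] have t: "cmd (\<lambda>m. (try_subset ^^ cap m) m)" .
  have 3: "cmd (\<lambda>m. upd 42 (\<lambda>m i j. 0) (upd 41 (\<lambda>m i j. 0) (upd 12 g_T (upd 10 g_n m))))"
    by ((rule cmd_upd_comp, (rule cmd_decide_g cmd_g; simp))+, rule cmd_skip)
  have 4: "cmd (upd 0 (\<lambda>m i j. scal m 42))" by (rule cmd_decide_g) simp
  show ?thesis
    using cmd_comp[OF cmd_comp[OF 3 t] 4] by (simp only: decide_def[abs_def] Let_def)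
qed

lemma powers_spec:
  "cap (powers m) = cap m" "b < 40 \<Longrightarrow> powers m b = m b"
  "j < cap m \<Longrightarrow> powers m 40 j = 2 ^ j"
proof -
  define m' where "m' = upd 40 (\<lambda>m i j. 1) (upd 41 (\<lambda>m i j. 0) m)"
  let ?F = "\<lambda>m. upd 41 g_tick (upd 40 g_double m)"
  have c': "cap m' = cap m" by (simp add: m'_def)
  have p: "powers m = (?F ^^ cap m) m'" unfolding powers_def Let_def m'_def[symmetric] c' ..
  have fr: "cap ((?F ^^ t) m') = cap m \<and> (\<forall>b<40. (?F ^^ t) m' b = m b)" for t
    by (induction t) (simp_all add: c', simp add: m'_def)
  then show "cap (powers m) = cap m" "b < 40 \<Longrightarrow> powers m b = m b" by (simp_all add: p)
  have "scal ((?F ^^ t) m') 41 = t \<and> (\<forall>j<cap m. vec ((?F ^^ t) m') 40 j = 2 ^ min t j)" if "0 < cap m" for t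
  proof (induction t)
    case 0
    then show ?case using that by (simp add: m'_def)
  next
    case (Suc t)
    have step: "scal (?F S) 41 = Suc (scal S 41)"
      "\<forall>j<cap S. vec (?F S) 40 j = (if scal S 41 < j then 2 * vec S 40 j else vec S 40 j)" if "0 < cap S" for S
      using that by (simp_all add: g_tick_def g_double_def)
    have "0 < cap ((?F ^^ t) m')" "cap ((?F ^^ t) m') = cap m" using that fr[of t] by simp_all
    with step[OF this(1)] Suc show ?case by (simp add: min_def)
  qed
  then show "j < cap m \<Longrightarrow> powers m 40 j = 2 ^ j"
    using p by (auto simp: mat_def min_def)
qed

lemma odd_div_iff:
  fixes c p :: nat
  assumes "0 < p" "c < L"
  shows "odd (c div p) \<longleftrightarrow> (\<exists>q<L. q * (p + p) + p \<le> c \<and> c < q * (p + p) + p + p)"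
proof
  assume "odd (c div p)"
  then obtain q where q: "c div p = 2 * q + 1" by (auto elim: oddE)
  have c: "c = (2 * q + 1) * p + c mod p" using div_mult_mod_eq[of c p] by (simp only: q)
  have "c mod p < p" using assms(1) by simp
  then have "q * (p + p) + p \<le> c \<and> c < q * (p + p) + p + p"
    by (subst (1 2) c) (simp add: algebra_simps)
  moreover have "q \<le> c" using q div_le_dividend[of c p] by linarith
  ultimately show "\<exists>q<L. q * (p + p) + p \<le> c \<and> c < q * (p + p) + p + p"
    using assms(2) le_less_trans by blast
next
  assume "\<exists>q<L. q * (p + p) + p \<le> c \<and> c < q * (p + p) + p + p"
  then obtain q where q: "q * (p + p) + p \<le> c" "c < q * (p + p) + p + p" by (elim exE conjE)
  have "c div p = 2 * q + 1"
    by (rule div_nat_eqI) (use q in \<open>simp_all add: algebra_simps\<close>)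
  then show "odd (c div p)" by simp
qed

section \<open>Sets of arcs as binary numbers, and the search through them\<close>

context tournament_relation
begin

definition deleted :: "nat \<Rightarrow> (nat \<times> nat) set" where
  "deleted c = {(i, j) \<in> T. odd (c div 2 ^ (i * n + j))}"

definition good :: "nat \<Rightarrow> nat \<Rightarrow> bool" where
  "good k c \<longleftrightarrow> bal (cyc (T - deleted c)) \<and> card (deleted c) \<le> k"

text \<open>The arcs have distinct positions below \<open>n * n\<close> in the adjacency matrix, so
  the number with exactly these bits, given by \<open>set_encode\<close>, is below
  \<open>2 ^ (n * n)\<close>.\<close>

lemma deleted_surj:
  assumes "A \<subseteq> T"
  shows "\<exists>c<2 ^ (n * n). deleted c = A"
proof -
  let ?f = "\<lambda>(i, j). i * n + j"
  have lt: "?f e < n * n" if "e \<in> T" for e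
    using that T_verts by (cases e) (auto intro: matrix_index_less)
  have inj: "inj_on ?f T"
  proof (rule inj_onI, clarify)
    fix i j u v assume ij: "(i, j) \<in> T" "(u, v) \<in> T" and e: "i * n + j = u * n + v"
    have "j < n" "v < n" using T_verts ij by auto
    then have "i = (i * n + j) div n" "j = (i * n + j) mod n" "u = (u * n + v) div n" "v = (u * n + v) mod n" by auto
    then show "i = u \<and> j = v" using e by metis
  qed
  have finA: "finite A" using assms finite_T finite_subset by blast
  have sub: "?f ` A \<subseteq> {..<n * n}" using lt assms by blast
  let ?c = "set_encode (?f ` A)"
  have "?c \<le> (\<Sum>i<n * n. 2 ^ i)" unfolding set_encode_def using sub by (intro sum_mono2) auto
  also have "\<dots> < 2 ^ (n * n)" using sum_power2[of "n * n"] by (simp add: lessThan_atLeast0)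
  finally have c: "?c < 2 ^ (n * n)" .
  have "(odd (?c div 2 ^ x)) \<longleftrightarrow> x \<in> ?f ` A" for x
    using set_encode_inverse[of "?f ` A"] finA by (auto simp: set_decode_def)
  then have "deleted ?c = {e \<in> T. ?f e \<in> ?f ` A}" unfolding deleted_def by auto
  also have "\<dots> = A" using inj_on_image_mem_iff[OF inj _ assms] assms by blast
  finally show ?thesis using c by blast
qed

lemma desc_imp_good: "desc (digraph_on n T) \<le> k \<Longrightarrow> \<exists>c<2 ^ (n * n). good k c"
proof -
  assume "desc (digraph_on n T) \<le> k"
  then obtain A where A: "A \<subseteq> T" "bal (cyc (T - A))" "card A \<le> k"
    unfolding desc_le_iff[OF pair_digraph_on] by auto
  obtain c where "c < 2 ^ (n * n)" "deleted c = A" using deleted_surj[OF A(1)] by (elim exE conjE)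
  then show "\<exists>c<2 ^ (n * n). good k c" using A by (auto simp: good_def)
qed

lemma good_imp_desc: "good k c \<Longrightarrow> desc (digraph_on n T) \<le> k"
proof -
  assume "good k c"
  moreover have "deleted c \<subseteq> T" by (auto simp: deleted_def)
  ultimately show "desc (digraph_on n T) \<le> k"
    unfolding desc_le_iff[OF pair_digraph_on] by (auto simp: good_def)
qed

lemma reach_frame: "b \<noteq> 44 \<Longrightarrow> reach m b = m b" "cap (reach m) = cap m"
  by (simp_all add: reach_def funpow_upd_frame funpow_upd_cap)

text \<open>The first round yields the identity, and each further one prolongs walks by an arc. As
  an operator on sets of pairs of vertices the round is stable after \<open>n * n\<close>
  iterations.\<close>

lemma reach_spec:
  assumes cap: "n * n \<le> cap m" "n \<le> cap m" and n: "scal m 10 = n" and zero: "\<And>i j. i < n \<Longrightarrow> j < n \<Longrightarrow> mat m 44 i j = 0"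
    and E: "\<And>i j. i < cap m \<Longrightarrow> j < cap m \<Longrightarrow> mat m 43 i j = of_bool ((i, j) \<in> E)" and sub: "E \<subseteq> {..<n} \<times> {..<n}"
    and ij: "i < n" "j < n"
  shows "mat (reach m) 44 i j = of_bool ((i, j) \<in> E\<^sup>*)"
proof -
  define \<Phi> where "\<Phi> X = {(i, j). i < n \<and> j < n \<and> (i = j \<or> (\<exists>w. (i, w) \<in> X \<and> (w, j) \<in> E))}" for X
  have step: "mat ((upd 44 g_reach ^^ t) m) 44 i j = of_bool ((i, j) \<in> (\<Phi> ^^ t) {})" if "i < n" "j < n" for i j t
    using that
  proof (induction t arbitrary: i j)
    case 0
    then show ?case by (simp add: zero)
  next
    case (Suc t)
    let ?m = "(upd 44 g_reach ^^ t) m"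
    have c: "cap ?m = cap m" by (simp add: funpow_upd_cap)
    have fr: "mat ?m b = mat m b" if "b \<noteq> 44" for b
      using that by (intro mat_cong) (simp_all add: funpow_upd_frame funpow_upd_cap)
    have ltc: "i < cap m" "j < cap m" using Suc.prems cap by auto
    have ex: "(\<exists>w<cap m. mat ?m 44 i w \<noteq> 0 \<and> mat m 43 w j \<noteq> 0) \<longleftrightarrow> (\<exists>w. (i, w) \<in> (\<Phi> ^^ t) {} \<and> (w, j) \<in> E)"
    proof
      assume "\<exists>w<cap m. mat ?m 44 i w \<noteq> 0 \<and> mat m 43 w j \<noteq> 0"
      then obtain w where w: "w < cap m" "mat ?m 44 i w \<noteq> 0" "mat m 43 w j \<noteq> 0" by (elim exE conjE)
      then have "(w, j) \<in> E" using E[OF w(1) ltc(2)] by simp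
      moreover from this have "w < n" using sub by auto
      ultimately show "\<exists>w. (i, w) \<in> (\<Phi> ^^ t) {} \<and> (w, j) \<in> E"
        using w(2) Suc.IH[OF Suc.prems(1), of w] by auto
    next
      assume "\<exists>w. (i, w) \<in> (\<Phi> ^^ t) {} \<and> (w, j) \<in> E"
      then obtain w where w: "(i, w) \<in> (\<Phi> ^^ t) {}" "(w, j) \<in> E" by (elim exE conjE)
      then have "w < n" using sub by auto
      then have "w < cap m" using cap(2) by simp
      moreover have "mat ?m 44 i w \<noteq> 0" using w(1) Suc.IH[OF Suc.prems(1) \<open>w < n\<close>] by simp
      moreover have "mat m 43 w j \<noteq> 0" using w(2) E[OF \<open>w < cap m\<close> ltc(2)] by simp
      ultimately show "\<exists>w<cap m. mat ?m 44 i w \<noteq> 0 \<and> mat m 43 w j \<noteq> 0" by blast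
    qed
    have "mat ((upd 44 g_reach ^^ Suc t) m) 44 i j = g_reach ?m i j" using ltc by (simp add: c)
    also have "\<dots> = of_bool (i < n \<and> j < n \<and> (i = j \<or> (\<exists>w. (i, w) \<in> (\<Phi> ^^ t) {} \<and> (w, j) \<in> E)))"
      unfolding g_reach_def[of ?m] c fr[of 43, simplified] fr[of 10, simplified] n ex ..
    also have "\<dots> = of_bool ((i, j) \<in> (\<Phi> ^^ Suc t) {})" by (simp add: \<Phi>_def)
    finally show ?case .
  qed
  let ?X = "(\<Phi> ^^ cap m) {}"
  have stable: "\<Phi> ?X = ?X"
    by (rule iterate_stable[where S = "{..<n} \<times> {..<n}"])
      (use cap(1) in \<open>auto simp: \<Phi>_def mono_def\<close>)
  have "(i, v) \<in> ?X" if "(i, v) \<in> E\<^sup>*" for v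
    using that
  proof (induction rule: rtrancl_induct)
    case base
    have "(i, i) \<in> \<Phi> ?X" using ij by (simp add: \<Phi>_def)
    then show ?case unfolding stable .
  next
    case (step y z)
    have "z < n" using step.hyps(2) sub by auto
    then have "(i, z) \<in> \<Phi> ?X" using step ij unfolding \<Phi>_def by blast
    then show ?case unfolding stable .
  qed
  moreover have "(i, v) \<in> E\<^sup>*" if "(i, v) \<in> (\<Phi> ^^ t) {}" for t v
    using that
  proof (induction t arbitrary: v)
    case (Suc t)
    then have "(i, v) \<in> \<Phi> ((\<Phi> ^^ t) {})" by simp
    then have "i = v \<or> (\<exists>w. (i, w) \<in> (\<Phi> ^^ t) {} \<and> (w, v) \<in> E)"
      unfolding \<Phi>_def[of "(\<Phi> ^^ t) {}"] by simp
    then show ?case using Suc.IH by (auto intro: rtrancl_into_rtrancl)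
  qed simp
  ultimately have "(i, j) \<in> ?X \<longleftrightarrow> (i, j) \<in> E\<^sup>*" by blast
  then show ?thesis using step[OF ij] by (simp add: reach_def)
qed

definition ready :: "memory \<Rightarrow> nat \<Rightarrow> bool" where
  "ready m k \<longleftrightarrow> n * n < cap m \<and> n < cap m \<and> 2 ^ (n * n) \<le> cap m \<and> scal m 10 = n \<and> m 0 1 = k \<and>
     (\<forall>i<cap m. \<forall>j<cap m. mat m 12 i j = of_bool ((i, j) \<in> T)) \<and> (\<forall>x<n * n. vec m 40 x = 2 ^ x)"

lemma try_subset_frame: "b \<notin> {41, 42, 43, 44} \<Longrightarrow> try_subset m b = m b"
  by (simp add: try_subset_def reach_frame)

lemma try_subset_spec:
  assumes ready: "ready m k" and c: "scal m 41 < cap m"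
  shows "ready (try_subset m) k" "scal (try_subset m) 41 = Suc (scal m 41)"
    "scal (try_subset m) 42 = of_bool (scal m 42 \<noteq> 0 \<or> good k (scal m 41))"
proof -
  let ?L = "cap m" and ?c = "scal m 41"
  have L: "n * n \<le> ?L" "n < ?L" and n: "scal m 10 = n" and k: "m 0 1 = k"
    and T: "\<And>i j. i < ?L \<Longrightarrow> j < ?L \<Longrightarrow> mat m 12 i j = of_bool ((i, j) \<in> T)"
    and pw: "\<And>x. x < n * n \<Longrightarrow> vec m 40 x = 2 ^ x"
    using ready by (simp_all add: ready_def)
  have capt: "cap (try_subset m) = ?L" using try_subset_frame[of 2 m] by (simp add: cap_def)
  have "mat (try_subset m) b = mat m b" if "b \<notin> {41, 42, 43, 44}" for b
    using try_subset_frame[OF that] capt by (rule mat_cong)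
  then show "ready (try_subset m) k"
    using ready try_subset_frame[of 0 m] by (simp add: ready_def capt)
  define m1 where "m1 = upd 43 g_E m"
  define m2 where "m2 = upd 44 (\<lambda>m i j. 0) m1"
  define m3 where "m3 = reach m2"
  have try_eq: "try_subset m = upd 41 g_tick (upd 42 g_test m3)"
    by (simp add: try_subset_def m1_def m2_def m3_def)
  have c3: "cap m1 = ?L" "cap m2 = ?L" "cap m3 = ?L" by (simp_all add: m1_def m2_def m3_def reach_frame)
  have m3: "mat m3 b = mat m b" if "b < 43" for b
    using that unfolding m3_def mat_cong[of "reach m2" b m2, OF reach_frame(1) reach_frame(2)]
    by (simp add: mat_cong[OF reach_frame(1) reach_frame(2)] m2_def m1_def)
  let ?E = "T - deleted ?c"
  have bit: "bit_set m (i * n + j) \<longleftrightarrow> odd (?c div 2 ^ (i * n + j))" if "i < n" "j < n" for i j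
  proof -
    have x: "i * n + j < n * n" using that by (rule matrix_index_less)
    have "bit_set m (i * n + j) \<longleftrightarrow> (\<exists>q<?L. q * (2 ^ (i * n + j) + 2 ^ (i * n + j)) + 2 ^ (i * n + j) \<le> ?c \<and>
        ?c < q * (2 ^ (i * n + j) + 2 ^ (i * n + j)) + 2 ^ (i * n + j) + 2 ^ (i * n + j))"
      unfolding bit_set_def pw[OF x]
      by (rule ex_cong1, rule conj_cong, rule refl) (simp only: mulc[OF less_imp_le])
    also have "\<dots> \<longleftrightarrow> odd (?c div 2 ^ (i * n + j))" using c by (intro odd_div_iff[symmetric]) simp_all
    finally show ?thesis .
  qed
  have E1: "mat m1 43 i j = of_bool ((i, j) \<in> ?E)" if "i < ?L" "j < ?L" for i j
  proof (cases "(i, j) \<in> T")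
    case True
    then have lt: "i < n" "j < n" using T_verts by auto
    have "mulc m i n = i * n" using that(1) by (intro mulc) simp
    then show ?thesis using that True by (simp add: m1_def g_E_def T n bit[OF lt] deleted_def)
  next
    case False
    then show ?thesis using that by (simp add: m1_def g_E_def T)
  qed
  have E2: "mat m2 43 i j = of_bool ((i, j) \<in> ?E)" if "i < ?L" "j < ?L" for i j
    using E1[OF that] by (simp add: m2_def)
  have E3: "mat m3 43 i j = of_bool ((i, j) \<in> ?E)" if "i < ?L" "j < ?L" for i j
    using E2[OF that] by (simp add: m3_def mat_cong[OF reach_frame(1) reach_frame(2)])
  have subE: "?E \<subseteq> {..<n} \<times> {..<n}" using T_subset by blast
  have R3: "mat m3 44 i j = of_bool ((i, j) \<in> ?E\<^sup>*)" if "i < n" "j < n" for i j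
    unfolding m3_def using L n E2 subE that
    by (intro reach_spec) (simp_all add: c3 m2_def m1_def)
  have cyc1: "mat m3 43 v w \<noteq> 0 \<and> mat m3 44 w v \<noteq> 0 \<longleftrightarrow> (v, w) \<in> cyc ?E" if "v < ?L" "w < ?L" for v w
  proof (cases "(v, w) \<in> ?E")
    case True
    then have "v < n" "w < n" using subE by auto
    then show ?thesis using True R3[of w v] E3[OF that] by (simp add: cyc_def)
  next
    case False
    then show ?thesis using E3[OF that] by (simp add: cyc_def)
  qed
  have cycL: "(v, w) \<in> cyc ?E \<Longrightarrow> v < ?L \<and> w < ?L" for v w using subE L(2) by (force simp: cyc_def)
  have out: "(\<Sum>w<?L. of_bool (mat m3 43 v w \<noteq> 0 \<and> mat m3 44 w v \<noteq> 0)) = card (cyc ?E `` {v})" if "v < ?L" for v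
  proof -
    have "(\<Sum>w<?L. of_bool (mat m3 43 v w \<noteq> 0 \<and> mat m3 44 w v \<noteq> 0)) = (\<Sum>w<?L. of_bool ((v, w) \<in> cyc ?E) :: nat)"
      using cyc1[OF that] by (intro sum_cong_lessThan) (simp only:)
    also have "\<dots> = card {w. (v, w) \<in> cyc ?E}" using cycL by (intro sum_of_bool_card) blast
    finally show ?thesis by (simp add: Image_singleton)
  qed
  have inn: "(\<Sum>w<?L. of_bool (mat m3 43 w v \<noteq> 0 \<and> mat m3 44 v w \<noteq> 0)) = card ((cyc ?E)\<inverse> `` {v})" if "v < ?L" for v
  proof -
    have "(\<Sum>w<?L. of_bool (mat m3 43 w v \<noteq> 0 \<and> mat m3 44 v w \<noteq> 0)) = (\<Sum>w<?L. of_bool ((w, v) \<in> cyc ?E) :: nat)"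
      using cyc1[OF _ that] by (intro sum_cong_lessThan) (simp only:)
    also have "\<dots> = card {w. (w, v) \<in> cyc ?E}" using cycL by (intro sum_of_bool_card) blast
    finally show ?thesis by (simp add: Image_singleton converse_unfold)
  qed
  have "(\<forall>v<?L. (\<Sum>w<?L. of_bool (mat m3 43 v w \<noteq> 0 \<and> mat m3 44 w v \<noteq> 0)) =
       (\<Sum>w<?L. of_bool (mat m3 43 w v \<noteq> 0 \<and> mat m3 44 v w \<noteq> 0) :: nat)) \<longleftrightarrow>
       (\<forall>v<?L. card (cyc ?E `` {v}) = card ((cyc ?E)\<inverse> `` {v}))"
    by (rule all_cong1, rule imp_cong, rule refl) (simp only: out inn)
  also have "\<dots> \<longleftrightarrow> bal (cyc ?E)"
  proof -
    have "card (cyc ?E `` {v}) = card ((cyc ?E)\<inverse> `` {v})" if "\<not> v < ?L" for v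
    proof -
      have "cyc ?E `` {v} = {}" "(cyc ?E)\<inverse> `` {v} = {}" using cycL that by blast+
      then show ?thesis by (simp only: card.empty)
    qed
    then show ?thesis unfolding bal_def by metis
  qed
  finally have bal: "(\<forall>v<?L. (\<Sum>w<?L. of_bool (mat m3 43 v w \<noteq> 0 \<and> mat m3 44 w v \<noteq> 0)) =
       (\<Sum>w<?L. of_bool (mat m3 43 w v \<noteq> 0 \<and> mat m3 44 v w \<noteq> 0) :: nat)) \<longleftrightarrow> bal (cyc ?E)" .
  have "(\<Sum>u<?L. \<Sum>v<?L. of_bool (mat m3 12 u v \<noteq> 0 \<and> mat m3 43 u v = 0)) =
      (\<Sum>u<?L. \<Sum>v<?L. of_bool ((u, v) \<in> deleted ?c) :: nat)"
    by (intro sum_cong_lessThan) (auto simp: m3 T E3 deleted_def)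
  also have "\<dots> = card (deleted ?c)"
    by (rule sum_of_bool_card2) (use T_subset L(2) in \<open>auto simp: deleted_def intro: less_trans dest!: T_verts\<close>)
  finally have del: "(\<Sum>u<?L. \<Sum>v<?L. of_bool (mat m3 12 u v \<noteq> 0 \<and> mat m3 43 u v = 0)) = card (deleted ?c)" .
  have m30: "m3 0 1 = k" using k by (simp add: m3_def reach_frame m2_def m1_def)
  have L0: "0 < ?L" using L(2) by simp
  have "scal (try_subset m) 42 = g_test m3 0 0" unfolding try_eq using L0 by (simp add: c3)
  also have "\<dots> = of_bool (scal m 42 \<noteq> 0 \<or> good k ?c)"
    unfolding g_test_def c3 bal del m30 good_def m3[of 42, simplified] ..
  finally show "scal (try_subset m) 42 = of_bool (scal m 42 \<noteq> 0 \<or> good k ?c)" .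
  show "scal (try_subset m) 41 = Suc ?c"
    unfolding try_eq using L0 by (simp add: c3 g_tick_def m3)
qed

text \<open>The counter also runs through numbers beyond \<open>2 ^ (n * n)\<close>. This is
  harmless, because every counter value describes some set of arcs and \<open>good_imp_desc\<close>
  applies to all of them.\<close>

lemma decide_spec:
  assumes m: "m 0 0 = n * n" "m 0 1 = k" "\<And>i j. i < n \<Longrightarrow> j < n \<Longrightarrow> m 1 (i * n + j) \<noteq> 0 \<longleftrightarrow> (i, j) \<in> T"
    and cap: "cap m = 2 ^ (n * n) + (n * n + 20)" and pw: "\<And>x. x < n * n \<Longrightarrow> m 40 x = 2 ^ x"
  shows "decide m 0 0 = of_bool (desc (digraph_on n T) \<le> k)"
proof -
  define m1 where "m1 = upd 10 g_n m"
  define m2 where "m2 = upd 12 g_T m1"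
  define m3 where "m3 = upd 42 (\<lambda>m i j. 0) (upd 41 (\<lambda>m i j. 0) m2)"
  let ?L = "cap m"
  have nn: "n \<le> n * n" by (cases n) auto
  have L: "n < ?L" "n * n < ?L" "2 ^ (n * n) \<le> ?L" "0 < ?L" unfolding cap using nn by linarith+
  have c: "cap m1 = ?L" "cap m2 = ?L" "cap m3 = ?L" by (simp_all add: m1_def m2_def m3_def)
  have n: "scal m1 10 = n" using L m by (simp add: m1_def g_n)
  have T: "mat m2 12 i j = of_bool ((i, j) \<in> T)" if "i < ?L" "j < ?L" for i j
  proof -
    have "mulc m1 i n = i * n" using that by (intro mulc) (simp add: c)
    then have "mat m2 12 i j = of_bool (i < n \<and> j < n \<and> m 1 (i * n + j) \<noteq> 0)"
      using that by (simp add: m2_def c g_T_def n) (simp add: m1_def)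
    also have "\<dots> = of_bool ((i, j) \<in> T)" using m(3)[of i j] T_verts[of i j] by auto
    finally show ?thesis .
  qed
  have ready: "ready m3 k"
    unfolding ready_def c
    using L n T pw m by (simp add: m3_def m2_def) (simp add: m1_def mat_def)
  have start: "scal m3 41 = 0" "scal m3 42 = 0" using L by (simp_all add: m3_def c)
  have dec: "decide m = upd 0 (\<lambda>m i j. scal m 42) ((try_subset ^^ ?L) m3)"
    unfolding decide_def Let_def m1_def[symmetric] m2_def[symmetric] m3_def[symmetric] c ..
  have capt: "cap (try_subset m) = cap m" for m using try_subset_frame[of 2 m] by (simp add: cap_def)
  have capi: "cap ((try_subset ^^ t) m3) = ?L" for t by (induction t) (simp_all add: capt c)
  have "t \<le> ?L \<Longrightarrow> ready ((try_subset ^^ t) m3) k \<and> scal ((try_subset ^^ t) m3) 41 = t \<and>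
      scal ((try_subset ^^ t) m3) 42 = of_bool (\<exists>c<t. good k c)" for t
  proof (induction t)
    case 0
    then show ?case using ready start by simp
  next
    case (Suc t)
    then have IH: "ready ((try_subset ^^ t) m3) k" "scal ((try_subset ^^ t) m3) 41 = t"
      "scal ((try_subset ^^ t) m3) 42 = of_bool (\<exists>c<t. good k c)" by auto
    have "scal ((try_subset ^^ t) m3) 41 < cap ((try_subset ^^ t) m3)"
      unfolding IH(2) capi using Suc.prems by simp
    note step = try_subset_spec[OF IH(1) this]
    have "(\<exists>c<Suc t. good k c) \<longleftrightarrow> (\<exists>c<t. good k c) \<or> good k t" using less_Suc_eq by blast
    then show ?case using step IH(2,3) by simp
  qed
  from this[of ?L] have fin: "scal ((try_subset ^^ ?L) m3) 42 = of_bool (\<exists>c<?L. good k c)" by simp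
  have "(\<exists>c<?L. good k c) \<longleftrightarrow> desc (digraph_on n T) \<le> k"
  proof
    assume "\<exists>c<?L. good k c"
    then obtain c where "good k c" by (elim exE conjE)
    then show "desc (digraph_on n T) \<le> k" by (rule good_imp_desc)
  next
    assume "desc (digraph_on n T) \<le> k"
    then obtain c where "c < 2 ^ (n * n)" "good k c" using desc_imp_good by blast
    then show "\<exists>c<?L. good k c" using L(3) less_le_trans by blast
  qed
  moreover have "mat (decide m) 0 0 0 = scal ((try_subset ^^ ?L) m3) 42"
    unfolding dec using L(4) by (simp add: capi)
  ultimately show ?thesis using fin by (simp add: mat_def)
qed

end

section \<open>Running times\<close>

lemma concat_rows:
  "concat (map (\<lambda>i. map (f i) [0..<n]) [0..<m]) = map (\<lambda>x. f (x div n) (x mod n)) [0..<m * n]"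
proof (induction m)
  case (Suc m)
  have "[0..<Suc m * n] = [0..<m * n] @ map (\<lambda>j. j + m * n) [0..<n]"
    using upt_add_eq_append[of 0 "m * n" n] map_add_upt[of "m * n" n] by (simp add: add.commute)
  moreover have "map (\<lambda>x. f (x div n) (x mod n)) (map (\<lambda>j. j + m * n) [0..<n]) = map (f m) [0..<n]"
    by simp
  ultimately show ?case using Suc by simp
qed simp

lemma adjacency_encoding_digraph_on:
  "adjacency_encoding (digraph_on n T) = map (\<lambda>x. (x div n, x mod n) \<in> T) [0..<n * n]"
  using concat_rows[of "\<lambda>i j. (i, j) \<in> T" n n] by (simp add: adjacency_encoding_def)

lemma length_adjacency_encoding [simp]: "length (adjacency_encoding (digraph_on n T)) = n * n"
  by (simp add: adjacency_encoding_digraph_on)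

lemma nth_adjacency_encoding:
  "i < n \<Longrightarrow> j < n \<Longrightarrow> adjacency_encoding (digraph_on n T) ! (i * n + j) \<longleftrightarrow> (i, j) \<in> T"
  by (simp add: adjacency_encoding_digraph_on matrix_index_less)

context tournament_parameter
begin

definition kernel :: "nat pair_pre_digraph \<times> nat" where
  "kernel = (if within_bound then (digraph_on kept_count kernel_arcs, k - min_cost) else (digraph_on 4 no_instance, 0))"

lemma kernel_in_tournaments: "fst kernel \<in> tournaments"
  using tournament_relation.digraph_on_in_tournaments[OF tournament_relation_kernel]
    tournament_relation.digraph_on_in_tournaments[OF no_instance_relation]
  by (simp add: kernel_def)

lemma kernel_correct: "desc (digraph_on n T) \<le> k \<longleftrightarrow> desc (fst kernel) \<le> snd kernel"
proof (cases within_bound)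
  case True
  then show ?thesis
    using solution_imp_kernel kernel_imp_solution
    unfolding desc_digraph_on_le_iff tournament_relation.desc_digraph_on_le_iff[OF tournament_relation_kernel] kernel_def
    by (auto simp: tournament_relation.desc_digraph_on_le_iff[OF tournament_relation_kernel])
next
  case False
  then show ?thesis
    using solution_imp_kernel desc_no_instance unfolding desc_digraph_on_le_iff kernel_def by auto
qed

text \<open>The summand 4 covers \<open>no_instance\<close>. For positive \<open>k\<close> the bound
  is at least 24 and absorbs it; for \<open>k = 0\<close> the replacement occurs only if the input
  is a no-instance.\<close>

lemma kernel_size:
  "card (pverts (fst kernel)) \<le> 4 * k * (4 * k + 2) + 4"
  "0 < k \<or> desc (digraph_on n T) \<le> k \<Longrightarrow> card (pverts (fst kernel)) \<le> 4 * k * (4 * k + 2)"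
proof -
  show "card (pverts (fst kernel)) \<le> 4 * k * (4 * k + 2) + 4"
    by (simp add: kernel_def within_bound_def)
  assume *: "0 < k \<or> desc (digraph_on n T) \<le> k"
  show "card (pverts (fst kernel)) \<le> 4 * k * (4 * k + 2)"
  proof (cases within_bound)
    case True
    then show ?thesis by (simp add: kernel_def within_bound_def)
  next
    case False
    then have "\<not> desc (digraph_on n T) \<le> k" using solution_imp_kernel unfolding desc_digraph_on_le_iff by blast
    then have "1 \<le> k" using * by simp
    then have "4 * 1 * (4 * 1 + 2) \<le> 4 * k * (4 * k + 2)" by (intro mult_le_mono add_le_mono) simp_all
    then show ?thesis using False by (simp add: kernel_def)
  qed
qed

lemma kernel_program_output:
  assumes rep: "represents m n T k'" and k: "k = min k' (n * n)" and s: "agree s (kernel_program m)"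
  shows "output_memory s = (adjacency_encoding (fst kernel), snd kernel)"
proof -
  note spec = kernel_program_spec[OF rep k]
  have s01: "s 0 = kernel_program m 0" "s 1 = kernel_program m 1" using s by (simp_all add: agree_def)
  show ?thesis
  proof (cases within_bound)
    case True
    then have "map (\<lambda>i. s 1 i \<noteq> 0) [0..<s 0 0] = adjacency_encoding (digraph_on kept_count kernel_arcs)"
      unfolding adjacency_encoding_digraph_on s01 spec(1) using spec(3)[OF True] by (intro map_cong) simp_all
    then show ?thesis using True spec(2) by (simp add: output_memory_def kernel_def s01)
  next
    case False
    have 16: "[0..<16] = [0, 1, 2, 3, 4, 5, 6, 7, 8, 9, 10, 11, 12, 13, 14, 15 :: nat]"
      by (simp add: upt_rec)
    have "map (\<lambda>i. s 1 i \<noteq> 0) [0..<s 0 0] = map (\<lambda>x. x \<in> {1, 2, 6, 7, 11, 12}) [0..<16]"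
      unfolding s01 spec(1) using spec(4)[OF False] False by (intro map_cong) simp_all
    also have "\<dots> = adjacency_encoding (digraph_on 4 no_instance)"
      unfolding adjacency_encoding_digraph_on by (simp add: 16 no_instance_def)
    finally show ?thesis using False spec(2) by (simp add: output_memory_def kernel_def s01)
  qed
qed

end

section \<open>The kernelization map and the programs that compute and use it\<close>

definition K :: "nat pair_pre_digraph \<times> nat \<Rightarrow> nat pair_pre_digraph \<times> nat" where
  "K = (\<lambda>(D, k). let n = card (pverts D) in tournament_parameter.kernel n (parcs D) (min k (n * n)))"

lemma K_digraph_on: "K (digraph_on n T, k) = tournament_parameter.kernel n T (min k (n * n))"
  by (simp add: K_def)

lemma K_spec:
  assumes "D \<in> tournaments"
  shows "fst (K (D, k)) \<in> tournaments"
    "(D, k) \<in> arc_deletion_problem \<longleftrightarrow> K (D, k) \<in> arc_deletion_problem"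
    "snd (K (D, k)) \<le> k"
    "length (adjacency_encoding (fst (K (D, k)))) \<le> (4 * k * (4 * k + 2) + 4) * (4 * k * (4 * k + 2) + 4)"
    "length (adjacency_encoding (fst (K (D, k)))) \<le> length (adjacency_encoding D) + 16"
    "0 < k \<or> (D, k) \<in> arc_deletion_problem \<Longrightarrow> card (pverts (fst (K (D, k)))) \<le> 4 * k * (4 * k + 2)"
proof -
  obtain n T where D: "D = digraph_on n T" "tournament_relation n T" using assms by (rule tournaments_cases)
  define k' where "k' = min k (n * n)"
  interpret tournament_parameter n T k'
    using D(2) by (simp add: tournament_parameter_def)
  have KD: "K (D, k) = kernel" by (simp add: D(1) K_digraph_on k'_def)
  show "fst (K (D, k)) \<in> tournaments" unfolding KD by (rule kernel_in_tournaments)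
  have d: "desc D \<le> k \<longleftrightarrow> desc (digraph_on n T) \<le> k'" using desc_digraph_on_le by (auto simp: D(1) k'_def)
  show "(D, k) \<in> arc_deletion_problem \<longleftrightarrow> K (D, k) \<in> arc_deletion_problem"
    unfolding arc_deletion_problem_def KD using d kernel_correct by (cases kernel) simp
  have "snd kernel \<le> k'" by (simp add: kernel_def)
  then show "snd (K (D, k)) \<le> k" unfolding KD by (simp add: k'_def)
  have mono: "4 * k' * (4 * k' + 2) \<le> 4 * k * (4 * k + 2)"
    by (intro mult_le_mono add_le_mono) (simp_all add: k'_def)
  obtain n' T' where n': "fst kernel = digraph_on n' T'" by (cases within_bound) (auto simp: kernel_def)
  have "n' \<le> 4 * k * (4 * k + 2) + 4" using kernel_size(1) mono unfolding n' by simp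
  then show "length (adjacency_encoding (fst (K (D, k)))) \<le> (4 * k * (4 * k + 2) + 4) * (4 * k * (4 * k + 2) + 4)"
    unfolding KD n' length_adjacency_encoding by (intro mult_le_mono)
  show "length (adjacency_encoding (fst (K (D, k)))) \<le> length (adjacency_encoding D) + 16"
  proof (cases within_bound)
    case True
    then show ?thesis using mult_le_mono[OF kept_count_le kept_count_le] unfolding KD by (simp add: kernel_def D(1))
  next
    case False
    then show ?thesis unfolding KD by (simp add: kernel_def)
  qed
  assume "0 < k \<or> (D, k) \<in> arc_deletion_problem"
  \<comment> \<open>The truncated parameter can be 0 for positive \<open>k\<close> only if there are
    no vertices, and then nothing has to be deleted.\<close>
  then have "0 < k' \<or> desc (digraph_on n T) \<le> k' \<or> n = 0"
    using d by (auto simp: arc_deletion_problem_def k'_def)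
  moreover have "desc (digraph_on n T) \<le> k'" if "n = 0" using desc_digraph_on_le that by simp
  ultimately have "0 < k' \<or> desc (digraph_on n T) \<le> k'" by blast
  from kernel_size(2)[OF this] show "card (pverts (fst (K (D, k)))) \<le> 4 * k * (4 * k + 2)"
    unfolding KD using mono by simp
qed

lemma poly_bounded_affine:
  assumes "poly_bounded T"
  shows "poly_bounded (\<lambda>L. T (2 * L + 20))"
proof -
  obtain c D where T: "\<And>L. T L \<le> c * (L + 1) ^ D" using assms unfolding poly_bounded_def by auto
  have "T (2 * L + 20) \<le> (c * 21 ^ D) * (L + 1) ^ D" for L
  proof -
    have "T (2 * L + 20) \<le> c * (2 * L + 20 + 1) ^ D" by (rule T)
    also have "\<dots> \<le> c * (21 * (L + 1)) ^ D" by (intro mult_le_mono2 power_mono) simp_all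
    also have "\<dots> = (c * 21 ^ D) * (L + 1) ^ D" by (simp only: power_mult_distrib mult.assoc)
    finally show ?thesis .
  qed
  then show ?thesis unfolding poly_bounded_def by blast
qed

text \<open>The initial assignment sets a capacity that depends only on the input length, so the
  running time is independent of \<open>k\<close>.\<close>

lemma kernel_run:
  obtains c T where "poly_bounded T"
    "\<And>D k. D \<in> tournaments \<Longrightarrow> \<exists>t s. runs c (input_memory (adjacency_encoding D) k) t s \<and>
       t \<le> T (length (adjacency_encoding D)) \<and>
       output_memory s = (adjacency_encoding (fst (K (D, k))), snd (K (D, k)))"
proof -
  obtain c T where T: "poly_bounded T" and c: "\<And>d m s. agree s m \<Longrightarrow>
     executes c T kernel_program d m s"
    using cmd_kernel_program unfolding cmd_def by auto
  let ?init = "Assign 2 (Const 0) (Plus (Plus (Cell 0 (Const 0)) (Cell 0 (Const 0))) (Const 20))"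
  show ?thesis
  proof (rule that[of "\<lambda>L. 1 + T (2 * L + 20)" "Seq ?init (c 0)"])
    show "poly_bounded (\<lambda>L. 1 + T (2 * L + 20))"
      by (intro poly_bounded_intros poly_bounded_affine T)
  next
    fix D :: "nat pair_pre_digraph" and k
    assume "D \<in> tournaments"
    then obtain n A where D: "D = digraph_on n A" "tournament_relation n A" by (rule tournaments_cases)
    interpret tournament_parameter n A "min k (n * n)"
      using D(2) by (simp add: tournament_parameter_def)
    let ?m = "input_memory (adjacency_encoding D) k"
    show "\<exists>t s. runs (Seq ?init (c 0)) ?m t s \<and> t \<le> 1 + T (2 * length (adjacency_encoding D) + 20) \<and>
       output_memory s = (adjacency_encoding (fst (K (D, k))), snd (K (D, k)))"
    proof (rule runs_seq, rule runs_assign, rule refl)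
      fix m assume m: "m = ?m(2 := (?m 2)(aval (Const 0) ?m :=
        aval (Plus (Plus (Cell 0 (Const 0)) (Cell 0 (Const 0))) (Const 20)) ?m))"
      have len: "length (adjacency_encoding D) = n * n" by (simp add: D(1))
      have cap: "cap m = 2 * (n * n) + 20" by (simp add: m cap_def input_memory_def len)
      have rep: "represents m n A k"
        unfolding represents_def cap
        using nth_adjacency_encoding[of _ n _ A] by (simp add: m input_memory_def len D(1) matrix_index_less)
      obtain t s where r: "runs (c 0) m t s" "t \<le> T (cap m)" "agree s (kernel_program m)"
        using c[of m m 0] by auto
      have "output_memory s = (adjacency_encoding (fst (K (D, k))), snd (K (D, k)))"
        using kernel_program_output[OF rep refl r(3)] by (simp add: D(1) K_digraph_on)
      then show "\<exists>t s. runs (c 0) m t s \<and> t \<le> T (2 * length (adjacency_encoding D) + 20) \<and>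
         output_memory s = (adjacency_encoding (fst (K (D, k))), snd (K (D, k)))"
        using r(1,2) unfolding cap len by blast
    qed
  qed
qed

text \<open>The start memory is known only through \<open>output_memory\<close>, so the program can
  run on whatever the kernelization leaves behind. A capacity linear in the length serves to compute
  the powers of 2, an exponential one to try the subsets.\<close>

lemma decide_run:
  obtains c g where
    "\<And>D k s. D \<in> tournaments \<Longrightarrow> output_memory s = (adjacency_encoding D, k) \<Longrightarrow>
       \<exists>t s'. runs c s t s' \<and> t \<le> g (length (adjacency_encoding D)) \<and> s' 0 0 = of_bool (desc D \<le> k)"
proof -
  obtain cA TA where cA: "\<And>d m s. agree s m \<Longrightarrow>
     executes cA TA powers d m s"
    using cmd_powers unfolding cmd_def by auto
  obtain cB TB where cB: "\<And>d m s. agree s m \<Longrightarrow>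
     executes cB TB decide d m s"
    using cmd_decide unfolding cmd_def by auto
  let ?e1 = "Plus (Cell 0 (Const 0)) (Const 20)"
  let ?e2 = "Plus (Cell 40 (Cell 0 (Const 0))) (Plus (Cell 0 (Const 0)) (Const 20))"
  let ?c = "Seq (Assign 2 (Const 0) ?e1) (Seq (cA 0) (Seq (Assign 2 (Const 0) ?e2) (cB 0)))"
  let ?g = "\<lambda>l. 1 + (TA (l + 20) + (1 + TB (2 ^ l + (l + 20))))"
  show ?thesis
  proof (rule that[of ?c ?g])
    fix D :: "nat pair_pre_digraph" and k s
    assume "D \<in> tournaments" and out: "output_memory s = (adjacency_encoding D, k)"
    from \<open>D \<in> tournaments\<close> obtain n A where D: "D = digraph_on n A" "tournament_relation n A" by (rule tournaments_cases)
    interpret tournament_relation n A by (rule D(2))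
    have len: "length (adjacency_encoding D) = n * n" by (simp add: D(1))
    have enc: "map (\<lambda>i. s 1 i \<noteq> 0) [0..<s 0 0] = adjacency_encoding D" and s01: "s 0 1 = k"
      using out by (simp_all add: output_memory_def)
    have s00: "s 0 0 = n * n" using arg_cong[OF enc, of length] by (simp add: len)
    have s1: "s 1 (i * n + j) \<noteq> 0 \<longleftrightarrow> (i, j) \<in> A" if "i < n" "j < n" for i j
      using arg_cong[OF enc, of "\<lambda>xs. xs ! (i * n + j)"] nth_adjacency_encoding[OF that, of A] matrix_index_less[OF that]
      by (simp add: s00 D(1))
    show "\<exists>t s'. runs ?c s t s' \<and> t \<le> ?g (length (adjacency_encoding D)) \<and> s' 0 0 = of_bool (desc D \<le> k)"
      unfolding len
    proof (rule runs_seq, rule runs_assign, rule refl)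
      fix m1 assume m1: "m1 = s(2 := (s 2)(aval (Const 0) s := aval ?e1 s))"
      have cap1: "cap m1 = n * n + 20" by (simp add: m1 cap_def s00)
      have rA: "\<exists>t s'. runs (cA 0) m1 t s' \<and> t \<le> TA (n * n + 20) \<and> agree s' (powers m1)"
        using cA[of m1 m1 0] unfolding cap1 by auto
      show "\<exists>t s'. runs (Seq (cA 0) (Seq (Assign 2 (Const 0) ?e2) (cB 0))) m1 t s' \<and>
          t \<le> TA (n * n + 20) + (1 + TB (2 ^ (n * n) + (n * n + 20))) \<and> s' 0 0 = of_bool (desc D \<le> k)"
      proof (rule runs_seq[OF rA], rule runs_seq, rule runs_assign, rule refl)
        fix s2 m2 assume s2: "agree s2 (powers m1)" and m2: "m2 = s2(2 := (s2 2)(aval (Const 0) s2 := aval ?e2 s2))"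
        have b: "m2 b = s b" if "b \<in> {0, 1}" for b
          using that s2 powers_spec(2)[of b m1] by (auto simp: m2 m1 agree_def)
        \<comment> \<open>The table was written under the smaller capacity; it remains readable
          because row 0 has the same addresses under both.\<close>
        have pw: "m2 40 x = 2 ^ x" if "x < n * n + 20" for x
          using that s2 powers_spec(3)[of x m1] by (simp add: m2 agree_def cap1)
        have "s2 0 = s 0" "s2 40 (n * n) = 2 ^ (n * n)"
          using b[of 0] pw[of "n * n"] by (simp_all add: m2)
        then have cap2: "cap m2 = 2 ^ (n * n) + (n * n + 20)" by (simp add: m2 cap_def s00)
        have dec: "decide m2 0 0 = of_bool (desc (digraph_on n A) \<le> k)"
          by (rule decide_spec) (use b pw s00 s01 s1 cap2 in simp_all)
        obtain t s' where r: "runs (cB 0) m2 t s'" "t \<le> TB (cap m2)" "agree s' (decide m2)"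
          using cB[of m2 m2 0] by auto
        then have "s' 0 0 = of_bool (desc D \<le> k)" using dec by (simp add: agree_def D(1))
        then show "\<exists>t s'. runs (cB 0) m2 t s' \<and> t \<le> TB (2 ^ (n * n) + (n * n + 20)) \<and> s' 0 0 = of_bool (desc D \<le> k)"
          using r(1,2) unfolding cap2 by blast
      qed
    qed
  qed
qed

lemma size_ge: "length (enc D) + 1 \<le> instance_size enc (D, k)"
  by (simp add: instance_size_def)

lemma kernelization_K: "kernelization adjacency_encoding tournaments arc_deletion_problem K"
proof -
  have "polynomial_time adjacency_encoding tournaments K"
  proof -
    obtain c T where T: "poly_bounded T" and c:
      "\<And>D k. D \<in> tournaments \<Longrightarrow> \<exists>t s. runs c (input_memory (adjacency_encoding D) k) t s \<and>
         t \<le> T (length (adjacency_encoding D)) \<and>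
         output_memory s = (adjacency_encoding (fst (K (D, k))), snd (K (D, k)))"
      by (rule kernel_run) blast
    have "poly_bounded (\<lambda>L. T L + (L + 16))" by (intro poly_bounded_intros T)
    then obtain b d where b: "\<And>L. T L + (L + 16) \<le> b * (L + 1) ^ d" unfolding poly_bounded_def by auto
    show ?thesis
      unfolding polynomial_time_def
    proof (rule exI[of _ c], rule exI[of _ b], rule exI[of _ d], intro ballI allI)
      fix D k assume D: "D \<in> tournaments"
      let ?l = "length (adjacency_encoding D)"
      obtain t s where r: "runs c (input_memory (adjacency_encoding D) k) t s" "t \<le> T ?l"
        "output_memory s = (adjacency_encoding (fst (K (D, k))), snd (K (D, k)))"
        using c[OF D, of k] by (elim exE conjE)
      have "t + length (adjacency_encoding (fst (K (D, k)))) \<le> b * (?l + 1) ^ d"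
        using r(2) K_spec(5)[OF D, of k] b[of ?l] by linarith
      also have "\<dots> \<le> b * instance_size adjacency_encoding (D, k) ^ d"
        by (intro mult_le_mono2 power_mono size_ge) simp
      finally show "\<exists>t s. runs c (input_memory (adjacency_encoding D) k) t s \<and>
        output_memory s = (adjacency_encoding (fst (K (D, k))), snd (K (D, k))) \<and>
        t + length (adjacency_encoding (fst (K (D, k)))) \<le> b * instance_size adjacency_encoding (D, k) ^ d"
        using r(1,3) by blast
    qed
  qed
  moreover have "\<exists>h. \<forall>D\<in>tournaments. \<forall>k. snd (K (D, k)) \<le> h k"
    by (rule exI[of _ "\<lambda>k. k"]) (simp add: K_spec(3))
  moreover have "\<exists>g. \<forall>D\<in>tournaments. \<forall>k. length (adjacency_encoding (fst (K (D, k)))) \<le> g k"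
    by (intro exI[of _ "\<lambda>k. (4 * k * (4 * k + 2) + 4) * (4 * k * (4 * k + 2) + 4)"] ballI allI K_spec(4))
  ultimately show ?thesis
    unfolding kernelization_def using K_spec(1,2) by blast
qed

lemma fixed_parameter_tractable:
  "fixed_parameter_tractable adjacency_encoding tournaments arc_deletion_problem"
proof -
  obtain c T where T: "poly_bounded T" and c:
    "\<And>D k. D \<in> tournaments \<Longrightarrow> \<exists>t s. runs c (input_memory (adjacency_encoding D) k) t s \<and>
       t \<le> T (length (adjacency_encoding D)) \<and>
       output_memory s = (adjacency_encoding (fst (K (D, k))), snd (K (D, k)))"
    by (rule kernel_run) blast
  obtain c' g where c':
    "\<And>D k s. D \<in> tournaments \<Longrightarrow> output_memory s = (adjacency_encoding D, k) \<Longrightarrow>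
       \<exists>t s'. runs c' s t s' \<and> t \<le> g (length (adjacency_encoding D)) \<and> s' 0 0 = of_bool (desc D \<le> k)"
    by (rule decide_run) blast
  obtain b d where b: "\<And>L. T L \<le> b * (L + 1) ^ d" using T unfolding poly_bounded_def by auto
  \<comment> \<open>The bound \<open>g\<close> comes without monotonicity; summing it over all
    possible lengths of the kernel gives a bound in terms of \<open>k\<close>.\<close>
  define G where "G k = (\<Sum>l\<le>(4 * k * (4 * k + 2) + 4) * (4 * k * (4 * k + 2) + 4). g l)" for k
  show ?thesis
    unfolding fixed_parameter_tractable_def
  proof (rule exI[of _ "Seq c c'"], rule exI[of _ "\<lambda>k. b + G k"], rule exI[of _ d], intro ballI allI)
    fix D k assume D: "D \<in> tournaments"
    let ?l = "length (adjacency_encoding D)" and ?s = "instance_size adjacency_encoding (D, k)"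
    obtain t s where r: "runs c (input_memory (adjacency_encoding D) k) t s" "t \<le> T ?l"
      "output_memory s = (adjacency_encoding (fst (K (D, k))), snd (K (D, k)))"
      using c[OF D, of k] by (elim exE conjE)
    obtain u s' where r': "runs c' s u s'" "u \<le> g (length (adjacency_encoding (fst (K (D, k)))))"
      "s' 0 0 = of_bool (desc (fst (K (D, k))) \<le> snd (K (D, k)))"
      using c'[OF K_spec(1)[OF D] r(3)] by (elim exE conjE)
    have "(D, k) \<in> arc_deletion_problem \<longleftrightarrow> desc (fst (K (D, k))) \<le> snd (K (D, k))"
      unfolding K_spec(2)[OF D] by (cases "K (D, k)") (simp add: arc_deletion_problem_def)
    then have ans: "s' 0 0 = (if (D, k) \<in> arc_deletion_problem then 1 else 0)" using r'(3) by simp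
    have "u \<le> G k"
      unfolding G_def using r'(2) by (rule order_trans) (intro member_le_sum, use K_spec(4)[OF D] in simp_all)
    moreover have "1 \<le> ?s ^ d" by (simp add: instance_size_def)
    from mult_le_mono2[OF this, of "G k"] have "G k \<le> G k * ?s ^ d" by (simp only: mult_1_right)
    moreover have "T ?l \<le> b * ?s ^ d"
      using b[of ?l] by (rule order_trans) (intro mult_le_mono2 power_mono size_ge, simp)
    ultimately have "t + u \<le> (b + G k) * ?s ^ d" using r(2) unfolding add_mult_distrib by linarith
    then show "\<exists>t s. runs (Seq c c') (input_memory (adjacency_encoding D) k) t s \<and>
        s 0 0 = (if (D, k) \<in> arc_deletion_problem then 1 else 0) \<and> t \<le> (b + G k) * ?s ^ d"
      using runs.Seq[OF r(1) r'(1)] ans by blast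
  qed
qed

theorem theorem1:
  shows "fixed_parameter_tractable adjacency_encoding tournaments arc_deletion_problem \<and>
    (\<exists>K. kernelization adjacency_encoding tournaments arc_deletion_problem K \<and>
      (\<forall>T \<in> tournaments. \<forall>k. 0 < k \<or> (T, k) \<in> arc_deletion_problem \<longrightarrow>
        card (pverts (fst (K (T, k)))) \<le> 4 * k * (4 * k + 2)))"
  using fixed_parameter_tractable kernelization_K K_spec(6) by blast

end
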